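(* Let $\Omega\subset\mathbb{R}^N$ ($N\ge2$) be a bounded and regular domain, let $n\ge1$, and let $G:\overline\Omega\times\mathbb{R}^n\to\mathbb{R}$, $(x,u)\mapsto G(x,u)$, satisfy: (1) (a) $u\mapsto G(x,u)$ is of class $C^2(\mathbb{R}^n,\mathbb{R})$ for every $x\in\overline\Omega$; (b) $x\mapsto G(x,u)$ is continuous on $\overline\Omega$ for every $u\in\mathbb{R}^n$. (2) There exist continuous $n\times n$ real matrix functions $A(\cdot)$, $B(\cdot)$ on $\overline\Omega$, with $B(x)$ diagonal with entries $b_{ii}(x)$, and $p_i\in(N/2,\infty]$, $1\le i\le n$, such that $$A(x)\le G_{uu}(x,u)\le B(x)\ \text{ for all }(x,u)\in\overline\Omega\times\mathbb{R}^n,$$ $$\|b_{ii}^+\|_{p_i}<\beta_{p_i},\ 1\le i\le n,$$ $$\int_\Omega\langle A(x)k,k\rangle\,dx>0\quad\text{for all }k\in\mathbb{R}^n\setminus\{0\}.$$ Then the system $$\Delta u(x)+G_u(x,u(x))=0,\ x\in\Omega,\qquad \frac{\partial u(x)}{\partial n}=0,\ x\in\partial\Omega,$$ has a unique solution $u:\Omega\to\mathbb{R}^n$.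
   Context: $G_u$ and $G_{uu}$ denote the gradient and the Hessian matrix of $G$ with respect to $u\in\mathbb{R}^n$. $\partial/\partial n$ is the outer normal derivative on $\partial\Omega$; the Laplacian acts componentwise. $\langle\cdot,\cdot\rangle$ is the usual scalar product in $\mathbb{R}^n$. For $n\times n$ matrices, $C\le D$ means that $D-C$ is positive semi-definite. $f^+=\max\{f,0\}$ and $\|\cdot\|_p$ is the usual norm of $L^p(\Omega)$. Solutions are understood as $u\in(H^1(\Omega))^n$ in the usual weak sense: $\sum_i\int_\Omega\nabla u_i\cdot\nabla v_i\,dx=\int_\Omega\langle G_u(x,u),v\rangle\,dx$ for all $v\in(H^1(\Omega))^n$. The constants $\beta_p$, for $N/2<p\le\infty$, depend on $p$ and $\Omega$ and are defined by $\beta_p=\min_{X_p\setminus\{0\}}I_p$ (the minimum is attained), where: for $N/2<p<\infty$: $X_p=\{v\in H^1(\Omega):\int_\Omega|v|^{\frac{2}{p-1}}v=0\}$ and $I_p(v)=\dfrac{\int_\Omega|\nabla v|^2}{\left(\int_\Omega|v|^{\frac{2p}{p-1}}\right)^{\frac{p-1}{p}}}$; for $p=\infty$: $X_\infty=\{v\in H^1(\Omega):\int_\Omega v=0\}$ and $I_\infty(v)=\dfrac{\int_\Omega|\nabla v|^2}{\int_\Omega v^2}$. *)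

theory Defs
  imports "HOL-Analysis.Analysis" "HOL-Probability.Essential_Supremum"
begin

section \<open>Differential calculus\<close>

text \<open>Functions of class \<open>C\<^sup>k\<close> on the whole space: Frechet differentiable, with partial
  derivatives of class \<open>C\<close> of order \<open>k - 1\<close>.\<close>

primrec C_k :: "nat \<Rightarrow> ('a::euclidean_space \<Rightarrow> real) \<Rightarrow> bool" where
  "C_k 0 f \<longleftrightarrow> continuous_on UNIV f"
| "C_k (Suc k) f \<longleftrightarrow> (\<forall>x. f differentiable (at x)) \<and>
     (\<forall>i\<in>Basis. C_k k (\<lambda>x. frechet_derivative f (at x) i))"

definition C_inf :: "('a::euclidean_space \<Rightarrow> real) \<Rightarrow> bool" where
  "C_inf f \<longleftrightarrow> (\<forall>k. C_k k f)"

definition grad :: "(real^'n \<Rightarrow> real) \<Rightarrow> real^'n \<Rightarrow> real^'n" where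
  "grad f u = (\<chi> i. frechet_derivative f (at u) (axis i 1))"

definition hessian :: "(real^'n \<Rightarrow> real) \<Rightarrow> real^'n \<Rightarrow> real^'n^'n" where
  "hessian f u = (\<chi> i j. frechet_derivative (\<lambda>w. grad f w $ j) (at u) (axis i 1))"

text \<open>Positive semi-definiteness is a condition on the quadratic form only; symmetry of the
  matrices is not part of it.\<close>

definition psd_le :: "real^'n^'n \<Rightarrow> real^'n^'n \<Rightarrow> bool" where
  "psd_le C D \<longleftrightarrow> (\<forall>k. 0 \<le> ((D - C) *v k) \<bullet> k)"

section \<open>Bounded regular domains\<close>

text \<open>Near each boundary point, and in a suitable orthonormal frame with last vector \<open>e\<close>, the set
  lies strictly above the graph of a \<open>C\<^sup>1\<close> function \<open>\<gamma>\<close> of the remaining coordinates. A function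
  of these coordinates is represented as a function on the whole space that is constant in the
  direction \<open>e\<close>.\<close>

definition C1_boundary :: "'a::euclidean_space set \<Rightarrow> bool" where
  "C1_boundary \<Omega> \<longleftrightarrow> (\<forall>x\<in>frontier \<Omega>. \<exists>r>0. \<exists>e \<gamma>. norm e = 1 \<and> C_k 1 \<gamma> \<and>
     (\<forall>y t. \<gamma> (y + t *\<^sub>R e) = \<gamma> y) \<and>
     \<Omega> \<inter> ball x r = {y \<in> ball x r. \<gamma> y < y \<bullet> e})"

definition bounded_regular_domain :: "'a::euclidean_space set \<Rightarrow> bool" where
  "bounded_regular_domain \<Omega> \<longleftrightarrow>
     open \<Omega> \<and> connected \<Omega> \<and> \<Omega> \<noteq> {} \<and> bounded \<Omega> \<and> C1_boundary \<Omega>"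

section \<open>Lebesgue and Sobolev spaces\<close>

text \<open>Elements of these spaces are represented by functions; equality in the space is equality
  almost everywhere on \<open>\<Omega>\<close>. Values outside \<open>\<Omega>\<close> are irrelevant.\<close>

definition L2 :: "'a::euclidean_space set \<Rightarrow> ('a \<Rightarrow> 'b::euclidean_space) set" where
  "L2 \<Omega> = {f \<in> borel_measurable (lebesgue_on \<Omega>). integrable (lebesgue_on \<Omega>) (\<lambda>x. (norm (f x))\<^sup>2)}"

text \<open>The norm of \<open>L\<^sup>p\<close> for \<open>1 \<le> p \<le> \<infinity>\<close>. Being real-valued, it is only meaningful for
  functions that do belong to \<open>L\<^sup>p\<close>, for instance bounded measurable ones when \<open>\<Omega>\<close> is bounded.\<close>

definition Lp_norm :: "'a::euclidean_space set \<Rightarrow> ereal \<Rightarrow> ('a \<Rightarrow> real) \<Rightarrow> real" where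
  "Lp_norm \<Omega> p f =
     (if p = \<infinity> then real_of_ereal (esssup (lebesgue_on \<Omega>) (\<lambda>x. ereal \<bar>f x\<bar>))
      else (LINT x|lebesgue_on \<Omega>. \<bar>f x\<bar> powr real_of_ereal p) powr (1 / real_of_ereal p))"

definition test_functions :: "'a::euclidean_space set \<Rightarrow> ('a \<Rightarrow> real) set" where
  "test_functions \<Omega> =
     {\<phi>. C_inf \<phi> \<and> compact (closure {x. \<phi> x \<noteq> 0}) \<and> closure {x. \<phi> x \<noteq> 0} \<subseteq> \<Omega>}"

definition is_weak_gradient ::
    "'a::euclidean_space set \<Rightarrow> ('a \<Rightarrow> real) \<Rightarrow> ('a \<Rightarrow> 'a) \<Rightarrow> bool" where
  "is_weak_gradient \<Omega> v g \<longleftrightarrow> (\<forall>\<phi>\<in>test_functions \<Omega>. \<forall>i\<in>Basis.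
     (LINT x|lebesgue_on \<Omega>. v x * frechet_derivative \<phi> (at x) i) =
     - (LINT x|lebesgue_on \<Omega>. (g x \<bullet> i) * \<phi> x))"

definition H1 :: "'a::euclidean_space set \<Rightarrow> ('a \<Rightarrow> real) set" where
  "H1 \<Omega> = {v \<in> L2 \<Omega>. \<exists>g\<in>L2 \<Omega>. is_weak_gradient \<Omega> v g}"

text \<open>For \<open>v\<close> in \<open>H1 \<Omega>\<close> the weak gradient is unique up to a null set, so integrals
  involving it do not depend on the choice made here.\<close>

definition weak_grad :: "'a::euclidean_space set \<Rightarrow> ('a \<Rightarrow> real) \<Rightarrow> 'a \<Rightarrow> 'a" where
  "weak_grad \<Omega> v = (SOME g. g \<in> L2 \<Omega> \<and> is_weak_gradient \<Omega> v g)"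

section \<open>The constants \<open>\<beta>\<^sub>p\<close>\<close>

text \<open>For \<open>N/2 < p\<close> the exponents \<open>(p+1)/(p-1)\<close> and \<open>2p/(p-1)\<close> are below the critical Sobolev
  exponent, so on a bounded regular domain all the integrals below are integrals of integrable
  functions.\<close>

definition X_space :: "'a::euclidean_space set \<Rightarrow> ereal \<Rightarrow> ('a \<Rightarrow> real) set" where
  "X_space \<Omega> p =
     (if p = \<infinity> then {v \<in> H1 \<Omega>. (LINT x|lebesgue_on \<Omega>. v x) = 0}
      else (let q = real_of_ereal p in
        {v \<in> H1 \<Omega>. (LINT x|lebesgue_on \<Omega>. \<bar>v x\<bar> powr (2 / (q - 1)) * v x) = 0}))"

definition I_fun :: "'a::euclidean_space set \<Rightarrow> ereal \<Rightarrow> ('a \<Rightarrow> real) \<Rightarrow> real" where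
  "I_fun \<Omega> p v =
     (LINT x|lebesgue_on \<Omega>. (norm (weak_grad \<Omega> v x))\<^sup>2) /
     (if p = \<infinity> then (LINT x|lebesgue_on \<Omega>. (v x)\<^sup>2)
      else (let q = real_of_ereal p in
        (LINT x|lebesgue_on \<Omega>. \<bar>v x\<bar> powr (2 * q / (q - 1))) powr ((q - 1) / q)))"

text \<open>The minimum over \<open>X\<^sub>p\<close> without its zero element, i.e. without the functions vanishing almost
  everywhere. The minimum is attained, so it equals the infimum.\<close>

definition \<beta> :: "'a::euclidean_space set \<Rightarrow> ereal \<Rightarrow> real" where
  "\<beta> \<Omega> p = (INF v \<in> {v \<in> X_space \<Omega> p. \<not> (AE x in lebesgue_on \<Omega>. v x = 0)}. I_fun \<Omega> p v)"

section \<open>Weak solutions of the Neumann system\<close>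

definition H1_vec :: "'a::euclidean_space set \<Rightarrow> ('a \<Rightarrow> real^'n) set" where
  "H1_vec \<Omega> = {u. \<forall>i. (\<lambda>x. u x $ i) \<in> H1 \<Omega>}"

text \<open>The boundary condition is natural: it is encoded by testing against all of
  \<open>(H\<^sup>1(\<Omega>))\<^sup>n\<close>.\<close>

definition neumann_weak_solution ::
    "'a::euclidean_space set \<Rightarrow> ('a \<Rightarrow> real^'n \<Rightarrow> real) \<Rightarrow> ('a \<Rightarrow> real^'n) \<Rightarrow> bool" where
  "neumann_weak_solution \<Omega> G u \<longleftrightarrow> u \<in> H1_vec \<Omega> \<and>
     (\<forall>v\<in>H1_vec \<Omega>.
        integrable (lebesgue_on \<Omega>) (\<lambda>x. grad (G x) (u x) \<bullet> v x) \<and>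
        (\<Sum>i\<in>UNIV. LINT x|lebesgue_on \<Omega>.
            weak_grad \<Omega> (\<lambda>y. u y $ i) x \<bullet> weak_grad \<Omega> (\<lambda>y. v y $ i) x) =
        (LINT x|lebesgue_on \<Omega>. grad (G x) (u x) \<bullet> v x))"

end

theory Submission
  imports Defs "HOL-Library.Function_Algebras"
begin

text \<open>
  Solutions are the critical points of
  \<open>J(u) = 1/2 \<integral>|\<nabla>u|\<^sup>2 - \<integral>G(x, u)\<close> on \<open>H\<^sup>1(\<Omega>)\<^sup>n\<close>. The lower bound \<open>A\<close> makes \<open>J\<close> uniformly
  concave along constants, so \<open>J\<close> has a maximiser in every class of functions modulo constants;
  these maximisers form the set \<open>S\<close> of functions at which \<open>J'\<close> annihilates all constants. The upper
  bound \<open>B\<close> gives, for every increment \<open>z\<close>, a constant \<open>k\<close> with \<open>z\<^sub>i + k\<^sub>i \<in> X\<^sub>p\<close> for \<open>p = p\<^sub>i\<close>, and by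
  Hoelder's inequality the form \<open>\<integral>|\<nabla>h|\<^sup>2 - \<integral>\<langle>Bh, h\<rangle>\<close> is coercive at \<open>h = z + k\<close>. Since \<open>J(w + k) \<le> J(w)\<close>
  for \<open>w \<in> S\<close>, this yields
  \<open>J(w) \<ge> J(u) + J'(u)(w - u) + \<kappa>'\<parallel>w - u\<parallel>\<^sup>2\<close> for \<open>u, w \<in> S\<close>. Hence minimising sequences of \<open>J\<close> in \<open>S\<close>
  are Cauchy, the minimiser is a critical point, and critical points are unique. No compactness is
  used.
\<close>

section \<open>Functionals that are concave along constants\<close>

text \<open>The obstacle is that \<open>J\<close> is indefinite and that the sets X_p with finite p
  are in general not linear, so there is no splitting of the space into constants and a complement
  on which the two bounds could be tested separately. Coercivity is instead applied to a difference
  \<open>w - u\<close> corrected by a constant \<open>c k\<close>, and the correction is shown to be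
  harmless: it leaves the linear term unchanged since \<open>D u\<close> annihilates constants, it
  does not raise \<open>J w\<close> since \<open>w\<close> is maximal in its class, and
  \<open>w - u\<close> is bounded by a multiple of \<open>w - u + c k\<close>, because
  \<open>D\<close> is Lipschitz in its base point and strict concavity then bounds \<open>k\<close>.
  As \<open>S\<close> need not be affine, the parallelogram argument for Cauchy sequences uses the
  point of \<open>S\<close> in the class of the midpoint. The nonlinearity \<open>G\<close> enters
  only through two-sided quadratic bounds on its Taylor remainder; Lipschitz continuity,
  measurability in \<open>x\<close> and linear growth of its gradient are all derived from
  them.\<close>

lemma quadratic_le_imp_nonpos:
  fixes a C :: real
  assumes "\<And>t. 0 < t \<Longrightarrow> t * a \<le> C * t\<^sup>2"
  shows "a \<le> 0"
proof (rule ccontr)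
  assume "\<not> a \<le> 0"
  then have a: "a > 0" by simp
  \<comment> \<open>With this \<open>t\<close> the right-hand side \<open>C * t\<close> is at most
    \<open>a / 2\<close>, which contradicts \<open>a \<le> C * t\<close>.\<close>
  define t where "t = a / (2 * (\<bar>C\<bar> + 1))"
  have t: "t > 0" using a by (simp add: t_def)
  have "a \<le> C * t"
    using assms[OF t] t by (simp add: power2_eq_square)
  also have "\<dots> \<le> (\<bar>C\<bar> + 1) * t"
    using t by (intro mult_right_mono) auto
  also have "\<dots> = a / 2" by (simp add: t_def field_simps)
  finally show False using a by simp
qed

text \<open>\<open>V\<close> holds representatives and \<open>N\<close> is a seminorm, because
  functions equal almost everywhere are not identified. \<open>c\<close> embeds the constants and
  \<open>D u\<close> is the derivative of \<open>J\<close> at \<open>u\<close>. Completeness is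
  stated for sequences with geometrically decreasing steps, the form that a suitably chosen
  minimising sequence has. A single \<open>C\<close> bounds the Lipschitz constant and the Taylor
  error.\<close>

locale saddle_functional =
  fixes V :: "'a::real_vector set"
    and N :: "'a \<Rightarrow> real"
    and c :: "'k::euclidean_space \<Rightarrow> 'a"
    and J :: "'a \<Rightarrow> real"
    and D :: "'a \<Rightarrow> 'a \<Rightarrow> real"
    and C \<alpha> \<kappa> L :: real
  assumes V: "subspace V"
    and N_nonneg: "N u \<ge> 0"
    and N_triangle: "u \<in> V \<Longrightarrow> w \<in> V \<Longrightarrow> N (u + w) \<le> N u + N w"
    and N_scale: "u \<in> V \<Longrightarrow> N (t *\<^sub>R u) = \<bar>t\<bar> * N u"
    and complete: "(\<And>m. s m \<in> V) \<Longrightarrow> (\<And>m. N (s (Suc m) - s m) \<le> r * (1/2)^m) \<Longrightarrow>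
                     \<exists>u\<in>V. (\<lambda>m. N (s m - u)) \<longlonglongrightarrow> 0"
    and c_V: "c k \<in> V" and c_linear: "linear c" and c_bound: "N (c k) \<le> L * norm k"
    and D_add: "u \<in> V \<Longrightarrow> h \<in> V \<Longrightarrow> h' \<in> V \<Longrightarrow> D u (h + h') = D u h + D u h'"
    and D_scale: "u \<in> V \<Longrightarrow> h \<in> V \<Longrightarrow> D u (t *\<^sub>R h) = t * D u h"
    and D_bound: "u \<in> V \<Longrightarrow> \<exists>b. \<forall>h\<in>V. \<bar>D u h\<bar> \<le> b * N h"
    and D_Lip: "u \<in> V \<Longrightarrow> w \<in> V \<Longrightarrow> h \<in> V \<Longrightarrow> \<bar>D u h - D w h\<bar> \<le> C * N (u - w) * N h"
    and taylor: "u \<in> V \<Longrightarrow> h \<in> V \<Longrightarrow> \<bar>J (u + h) - J u - D u h\<bar> \<le> C * (N h)\<^sup>2"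
    and concave: "u \<in> V \<Longrightarrow> J (u + c k) \<le> J u + D u (c k) - \<alpha> * (norm k)\<^sup>2"
    and coercive: "z \<in> V \<Longrightarrow> \<exists>k. \<forall>u\<in>V. J u + D u (z + c k) + \<kappa> * (N (z + c k))\<^sup>2 \<le> J (u + (z + c k))"
    and pos: "\<alpha> > 0" "\<kappa> > 0" "C \<ge> 0" "L \<ge> 0"
begin

lemmas V_add = subspace_add[OF V] and V_diff = subspace_diff[OF V]
  and V_scale = subspace_scale[OF V] and V_0 = subspace_0[OF V]

lemmas V_closed = V_add V_diff V_scale V_0 c_V

lemma V_minus: "u \<in> V \<Longrightarrow> - u \<in> V"
  using V_scale[of u "-1"] by simp

lemma N_minus: "u \<in> V \<Longrightarrow> N (- u) = N u"
  using N_scale[of u "-1"] by simp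

lemma N_commute: "u \<in> V \<Longrightarrow> w \<in> V \<Longrightarrow> N (u - w) = N (w - u)"
  using N_minus[of "u - w"] by (simp add: V_closed)

lemma D_minus: "u \<in> V \<Longrightarrow> h \<in> V \<Longrightarrow> D u (- h) = - D u h"
  using D_scale[of u h "-1"] by simp

lemma c_scale: "c (t *\<^sub>R k) = t *\<^sub>R c k" and c_add: "c (k + k') = c k + c k'"
  and c_minus: "c (- k) = - c k"
  using c_linear by (auto simp: linear_scale linear_add linear_neg)

definition S :: "'a set" where "S = {u \<in> V. \<forall>k. D u (c k) = 0}"

lemma S_V: "u \<in> S \<Longrightarrow> u \<in> V" and S_D: "u \<in> S \<Longrightarrow> D u (c k) = 0"
  by (auto simp: S_def)

lemma taylor_lower: "u \<in> V \<Longrightarrow> h \<in> V \<Longrightarrow> J (u + h) \<ge> J u + D u h - C * (N h)\<^sup>2"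
  using taylor[of u h] by (auto simp: abs_le_iff)

text \<open>Taylor's bound and \<open>c_bound\<close> turn closeness of constants into closeness of
  values; this is what the extreme value theorem on a ball of constants requires.\<close>

lemma continuous_on_constants:
  assumes u: "u \<in> V"
  shows "continuous_on UNIV (\<lambda>k. J (u + c k))"
proof -
  have "isCont (\<lambda>k. J (u + c k)) k0" for k0
  proof -
    define w where "w = u + c k0"
    have w: "w \<in> V" using u by (simp add: w_def V_closed)
    obtain b where b: "\<And>h. h \<in> V \<Longrightarrow> \<bar>D w h\<bar> \<le> b * N h" using D_bound[OF w] by blast
    have "((\<lambda>k. J (u + c k) - J (u + c k0)) \<longlongrightarrow> 0) (at k0)"
    proof (rule Lim_null_comparison)
      show "\<forall>\<^sub>F k in at k0. norm (J (u + c k) - J (u + c k0)) \<le>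
              \<bar>b\<bar> * (L * norm (k - k0)) + C * (L * norm (k - k0))\<^sup>2"
      proof (rule always_eventually, rule allI)
        fix k
        define h where "h = c (k - k0)"
        have h: "h \<in> V" by (simp add: h_def c_V)
        have eq: "u + c k = w + h"
          using c_linear by (simp add: w_def h_def linear_diff)
        have "N h \<le> L * norm (k - k0)" unfolding h_def by (rule c_bound)
        moreover have "\<bar>D w h\<bar> \<le> \<bar>b\<bar> * N h"
          using b[OF h] mult_right_mono[OF abs_ge_self[of b] N_nonneg[of h]] by linarith
        ultimately have "\<bar>D w h\<bar> \<le> \<bar>b\<bar> * (L * norm (k - k0))"
          and "C * (N h)\<^sup>2 \<le> C * (L * norm (k - k0))\<^sup>2"
          using N_nonneg[of h] pos
          by (meson abs_ge_zero mult_left_mono order_trans, auto intro!: mult_left_mono power_mono)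
        then show "norm (J (u + c k) - J (u + c k0)) \<le>
              \<bar>b\<bar> * (L * norm (k - k0)) + C * (L * norm (k - k0))\<^sup>2"
          using taylor[OF w h] unfolding eq real_norm_def w_def[symmetric] by linarith
      qed
      show "((\<lambda>k. \<bar>b\<bar> * (L * norm (k - k0)) + C * (L * norm (k - k0))\<^sup>2) \<longlongrightarrow> 0) (at k0)"
        by (auto intro!: tendsto_eq_intros)
    qed
    then show ?thesis
      unfolding isCont_def by (rule LIM_zero_cancel)
  qed
  then show ?thesis by (simp add: continuous_at_imp_continuous_on)
qed

lemma ex_shift_in_S:
  assumes u: "u \<in> V"
  shows "\<exists>k. u + c k \<in> S"
proof -
  obtain b where b: "\<And>h. h \<in> V \<Longrightarrow> \<bar>D u h\<bar> \<le> b * N h" using D_bound[OF u] by blast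
  \<comment> \<open>Outside the ball of radius \<open>R\<close> the loss
    \<open>\<alpha> * (norm k)\<^sup>2\<close> outweighs the linear gain, which is at most
    \<open>\<bar>b\<bar> * L * norm k\<close>. There \<open>J (u + c k)\<close> is at most
    \<open>J u\<close>, so the maximum over the ball is global.\<close>
  define R where "R = \<bar>b\<bar> * L / \<alpha>"
  have R: "R \<ge> 0" using pos by (simp add: R_def)
  obtain k0 where k0: "\<And>k. k \<in> cball 0 R \<Longrightarrow> J (u + c k) \<le> J (u + c k0)"
    using continuous_attains_sup[of "cball 0 R" "\<lambda>k. J (u + c k)"]
      continuous_on_subset[OF continuous_on_constants[OF u] subset_UNIV] R
    by (metis cball_eq_empty compact_cball not_less)
  have max: "J (u + c k) \<le> J (u + c k0)" for k
  proof (cases "norm k \<le> R")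
    case True
    then show ?thesis by (intro k0) simp
  next
    case False
    have "D u (c k) \<le> \<bar>b\<bar> * (L * norm k)"
      using b[OF c_V, of k] c_bound[of k] mult_right_mono[OF abs_ge_self[of b] N_nonneg[of "c k"]]
        mult_left_mono[OF c_bound[of k] abs_ge_zero[of b]] by linarith
    also have "\<dots> = \<alpha> * (R * norm k)" using pos by (simp add: R_def)
    also have "\<dots> \<le> \<alpha> * (norm k)\<^sup>2"
      using False pos R by (auto simp: power2_eq_square intro!: mult_left_mono mult_right_mono)
    finally have "J (u + c k) \<le> J u" using concave[OF u, of k] by simp
    also have "\<dots> \<le> J (u + c k0)" using k0[of 0] R linear_0[OF c_linear] by simp
    finally show ?thesis .
  qed
  define w where "w = u + c k0"
  have w: "w \<in> V" using u by (simp add: w_def V_closed)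
  have "D w (c k) \<le> 0" for k
  proof (rule quadratic_le_imp_nonpos)
    fix t :: real assume "t > 0"
    have "J (w + c (t *\<^sub>R k)) \<le> J w"
      using max[of "k0 + t *\<^sub>R k"] by (simp add: w_def c_add algebra_simps)
    then show "t * D w (c k) \<le> C * (N (c k))\<^sup>2 * t\<^sup>2"
      using taylor_lower[OF w c_V, of "t *\<^sub>R k"] w
      by (simp add: c_scale D_scale N_scale c_V power_mult_distrib mult.assoc mult.commute[of "t\<^sup>2"])
  qed
  from this this[of "- k" for k] have "D w (c k) = 0" for k
    by (smt (verit) w D_minus c_V c_minus)
  then show ?thesis using w unfolding S_def w_def by blast
qed

text \<open>The remaining freedom of adding constants is controlled by strict concavity.\<close>

definition "K1 = C * L / (2 * \<alpha>)"

definition "K2 = 1 + L * K1"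

lemma K_nonneg: "K1 \<ge> 0" "K2 \<ge> 1"
  using pos by (auto simp: K1_def K2_def)

text \<open>Concavity from \<open>u\<close> to \<open>v = u - c k\<close> and back from
  \<open>v\<close> to \<open>u\<close> gives
  \<open>2 * \<alpha> * (norm k)\<^sup>2 \<le> D v (c k)\<close>. Since \<open>D w (c k) = 0\<close>
  and \<open>v - w = - y\<close>, the Lipschitz bound makes the right-hand side at most
  \<open>C * N y * L * norm k\<close>; hence \<open>norm k \<le> K1 * N y\<close>.\<close>

lemma S_control:
  assumes u: "u \<in> S" and w: "w \<in> S"
  shows "N (w - u) \<le> K2 * N (w - u + c k)"
proof -
  define y where "y = w - u + c k"
  have uV: "u \<in> V" and wV: "w \<in> V" using u w by (auto simp: S_V)
  have yV: "y \<in> V" using uV wV by (simp add: y_def V_closed)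
  define v where "v = u + c (- k)"
  have vV: "v \<in> V" using uV by (simp add: v_def V_closed)
  have "J v \<le> J u - \<alpha> * (norm k)\<^sup>2"
    using concave[OF uV, of "- k"] S_D[OF u] by (simp add: v_def)
  moreover have "J u \<le> J v + D v (c k) - \<alpha> * (norm k)\<^sup>2"
    using concave[OF vV, of k] by (simp add: v_def c_minus)
  ultimately have "2 * \<alpha> * (norm k)\<^sup>2 \<le> D v (c k)" by simp
  also have "\<dots> = D v (c k) - D w (c k)" using S_D[OF w] by simp
  also have "\<dots> \<le> C * N (v - w) * N (c k)" using D_Lip[OF vV wV c_V, of k] by simp
  also have "v - w = - y" by (simp add: v_def y_def c_minus)
  also have "N (- y) = N y" by (rule N_minus[OF yV])
  also have "C * N y * N (c k) \<le> C * N y * (L * norm k)"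
    using pos N_nonneg[of y] by (intro mult_left_mono c_bound) simp
  finally have *: "2 * \<alpha> * norm k * norm k \<le> (C * L * N y) * norm k"
    by (simp add: power2_eq_square mult_ac)
  have "norm k \<le> K1 * N y"
  proof (cases "k = 0")
    case False
    then have "2 * \<alpha> * norm k \<le> C * L * N y" using * by simp
    then show ?thesis using pos by (simp add: K1_def field_simps)
  qed (use K_nonneg N_nonneg[of y] in simp)
  then have "L * norm k \<le> L * (K1 * N y)" using pos by (intro mult_left_mono) auto
  moreover have "N (w - u) \<le> N y + L * norm k"
  proof -
    have "w - u = y + c (- k)" by (simp add: y_def c_minus)
    then have "N (w - u) \<le> N y + N (c (- k))" using N_triangle[OF yV c_V] by simp
    also have "N (c (- k)) \<le> L * norm k" using c_bound[of "- k"] by simp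
    finally show ?thesis by simp
  qed
  ultimately show ?thesis unfolding K2_def y_def[symmetric] by (simp add: algebra_simps)
qed

definition "\<kappa>' = \<kappa> / K2\<^sup>2"

lemma \<kappa>'_pos: "\<kappa>' > 0"
  using pos K_nonneg by (simp add: \<kappa>'_def)

text \<open>Coercivity at \<open>u\<close> is used for the increment \<open>w - u + c k\<close>.
  Membership of \<open>u\<close> in \<open>S\<close> removes \<open>c k\<close> from the linear
  term, membership of \<open>w\<close> removes it from the value of \<open>J\<close>, and
  \<open>S_control\<close> removes it from the norm at the price of the factor
  \<open>K2\<close>.\<close>

lemma S_strongly_convex:
  assumes u: "u \<in> S" and w: "w \<in> S"
  shows "J u + D u (w - u) + \<kappa>' * (N (w - u))\<^sup>2 \<le> J w"
proof -
  have uV: "u \<in> V" and wV: "w \<in> V" using u w by (auto simp: S_V)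
  then have zV: "w - u \<in> V" by (simp add: V_closed)
  obtain k where k: "J u + D u (w - u + c k) + \<kappa> * (N (w - u + c k))\<^sup>2 \<le> J (u + (w - u + c k))"
    using coercive[OF zV] uV by blast
  have "(N (w - u))\<^sup>2 \<le> (K2 * N (w - u + c k))\<^sup>2"
    by (intro power_mono S_control u w N_nonneg)
  then have "\<kappa>' * (N (w - u))\<^sup>2 \<le> \<kappa>' * (K2 * N (w - u + c k))\<^sup>2"
    using \<kappa>'_pos by (intro mult_left_mono) auto
  also have "\<dots> = \<kappa> * (N (w - u + c k))\<^sup>2"
    using K_nonneg by (simp add: \<kappa>'_def power_mult_distrib)
  finally have "\<kappa>' * (N (w - u))\<^sup>2 \<le> \<kappa> * (N (w - u + c k))\<^sup>2" .
  moreover have "J (u + (w - u + c k)) \<le> J w"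
    using concave[OF wV, of k] S_D[OF w, of k] pos
    by (simp add: algebra_simps) (smt (verit) mult_nonneg_nonneg zero_le_power2)
  moreover have "D u (w - u + c k) = D u (w - u)"
    using D_add[OF uV zV c_V] S_D[OF u] by simp
  ultimately show ?thesis using k by linarith
qed

lemma J_bounded_below: "bdd_below (J ` S)"
proof -
  obtain k0 where "0 + c k0 \<in> S" using ex_shift_in_S[OF V_0] by blast
  then obtain u where u: "u \<in> S" by blast
  obtain b where b: "\<And>h. h \<in> V \<Longrightarrow> \<bar>D u h\<bar> \<le> b * N h" using D_bound[OF S_V[OF u]] by blast
  \<comment> \<open>Completing the square: \<open>\<kappa>' * t\<^sup>2 - b * t\<close> is never
    below \<open>- b\<^sup>2 / (4 * \<kappa>')\<close>.\<close>
  have "J u - b\<^sup>2 / (4 * \<kappa>') \<le> J w" if w: "w \<in> S" for w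
  proof -
    have "w - u \<in> V" using u w by (simp add: S_V V_closed)
    then have "- (b * N (w - u)) \<le> D u (w - u)" using b[of "w - u"] by linarith
    moreover have "0 \<le> (2 * \<kappa>' * N (w - u) - b)\<^sup>2 / (4 * \<kappa>')" using \<kappa>'_pos by simp
    then have "- b\<^sup>2 / (4 * \<kappa>') \<le> \<kappa>' * (N (w - u))\<^sup>2 - b * N (w - u)"
      using \<kappa>'_pos by (simp add: power2_diff power_mult_distrib divide_simps) (simp add: algebra_simps power2_eq_square)
    ultimately show ?thesis using S_strongly_convex[OF u w] by linarith
  qed
  then show ?thesis by (auto intro!: bdd_belowI)
qed

text \<open>The two strong convexity inequalities are based at a point \<open>v\<close> of
  \<open>S\<close> that differs from the midpoint by a constant. Then \<open>u - v\<close> and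
  \<open>w - v\<close> add up to a constant, so the linear terms cancel and only the squares
  remain.\<close>

lemma S_midpoint:
  assumes u: "u \<in> S" and w: "w \<in> S"
  shows "\<kappa>' / 2 * (N (w - u))\<^sup>2 \<le> J u + J w - 2 * Inf (J ` S)"
proof -
  have uV: "u \<in> V" and wV: "w \<in> V" using u w by (auto simp: S_V)
  define m where "m = (1/2) *\<^sub>R (u + w)"
  have mV: "m \<in> V" using uV wV by (simp add: m_def V_closed)
  obtain k where k: "m + c k \<in> S" using ex_shift_in_S[OF mV] by blast
  define v where "v = m + c k"
  have v: "v \<in> S" and vV: "v \<in> V" using k mV by (auto simp: v_def V_closed)
  have 2: "u - v + (w - v) = c ((- 2) *\<^sub>R k)"
  proof -
    have "u + w = 2 *\<^sub>R m" by (simp add: m_def)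
    then show ?thesis unfolding v_def c_scale by (simp add: algebra_simps scaleR_2)
  qed
  have "D v (u - v) + D v (w - v) = D v (u - v + (w - v))"
    using uV wV vV by (simp add: D_add V_closed)
  also have "\<dots> = 0" unfolding 2 by (rule S_D[OF v])
  finally have 0: "D v (u - v) + D v (w - v) = 0" .
  have "N (w - u) \<le> N (w - v) + N (u - v)"
    using N_triangle[of "w - v" "v - u"] N_commute[of u v] uV wV vV by (simp add: V_closed)
  then have "(N (w - u))\<^sup>2 \<le> (N (w - v) + N (u - v))\<^sup>2"
    by (intro power_mono N_nonneg)
  also have "\<dots> \<le> 2 * (N (w - v))\<^sup>2 + 2 * (N (u - v))\<^sup>2"
    using sum_squares_bound[of "N (w - v)" "N (u - v)"] by (simp add: power2_sum)
  finally have "\<kappa>' / 2 * (N (w - u))\<^sup>2 \<le> \<kappa>' / 2 * (2 * (N (w - v))\<^sup>2 + 2 * (N (u - v))\<^sup>2)"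
    using \<kappa>'_pos by (intro mult_left_mono) auto
  also have "\<dots> = \<kappa>' * (N (w - v))\<^sup>2 + \<kappa>' * (N (u - v))\<^sup>2" by (simp add: algebra_simps)
  also have "\<dots> \<le> J u + J w - 2 * J v"
    using S_strongly_convex[OF v u] S_strongly_convex[OF v w] 0 by linarith
  also have "\<dots> \<le> J u + J w - 2 * Inf (J ` S)"
    using cInf_lower[OF imageI[OF v] J_bounded_below] by simp
  finally show ?thesis .
qed

lemma ex_minimizer: "\<exists>u\<in>S. \<forall>w\<in>S. J u \<le> J w"
proof -
  define I where "I = Inf (J ` S)"
  have ne: "S \<noteq> {}" using ex_shift_in_S[OF V_0] by blast
  \<comment> \<open>The excess \<open>\<kappa>' / 4 * (1/4)^m\<close> is chosen so that
    \<open>S_midpoint\<close> bounds the distance of consecutive terms by \<open>(1/2)^m\<close>, as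
    \<open>complete\<close> demands.\<close>
  have "\<exists>u\<in>S. J u < I + \<kappa>' / 4 * (1/4)^m" for m :: nat
    using cInf_lessD[of "J ` S" "I + \<kappa>' / 4 * (1/4)^m"] ne \<kappa>'_pos by (auto simp: I_def)
  then obtain s where s: "\<And>m. s m \<in> S" and Js: "\<And>m. J (s m) < I + \<kappa>' / 4 * (1/4)^m" by metis
  have sV: "s m \<in> V" for m using s by (simp add: S_V)
  have "N (s (Suc m) - s m) \<le> 1 * (1/2)^m" for m
  proof (rule power2_le_imp_le)
    have "\<kappa>' / 2 * (N (s (Suc m) - s m))\<^sup>2 \<le> \<kappa>' / 4 * (1/4)^m + \<kappa>' / 4 * (1/4)^Suc m"
      using S_midpoint[OF s[of m] s[of "Suc m"]] Js[of m] Js[of "Suc m"] unfolding I_def by linarith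
    also have "\<dots> \<le> \<kappa>' / 2 * (1/4)^m" using \<kappa>'_pos by simp
    finally have "(N (s (Suc m) - s m))\<^sup>2 \<le> (1/4)^m" using \<kappa>'_pos by simp
    also have "\<dots> = ((1/2)^m)\<^sup>2" by (simp add: power2_eq_square flip: power_mult_distrib)
    finally show "(N (s (Suc m) - s m))\<^sup>2 \<le> (1 * (1/2)^m)\<^sup>2" by simp
  qed simp
  from complete[OF sV this] obtain u where u: "u \<in> V" and lim: "(\<lambda>m. N (s m - u)) \<longlonglongrightarrow> 0" by blast
  \<comment> \<open>\<open>S\<close> is closed: \<open>D\<close> is Lipschitz in its base point, so
    the equations defining \<open>S\<close> pass to the limit.\<close>
  have "D u (c k) = 0" for k
  proof -
    have "\<bar>D u (c k)\<bar> \<le> C * N (s m - u) * N (c k)" for m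
      using D_Lip[OF sV u c_V, of m k] S_D[OF s] by simp
    moreover have "(\<lambda>m. C * N (s m - u) * N (c k)) \<longlonglongrightarrow> C * 0 * N (c k)"
      by (intro tendsto_intros lim)
    ultimately have "\<bar>D u (c k)\<bar> \<le> 0"
      using tendsto_lowerbound[of _ "C * 0 * N (c k)" sequentially "\<bar>D u (c k)\<bar>"] by simp
    then show ?thesis by simp
  qed
  then have uS: "u \<in> S" using u by (simp add: S_def)
  obtain b where b: "\<And>h. h \<in> V \<Longrightarrow> \<bar>D u h\<bar> \<le> b * N h" using D_bound[OF u] by blast
  \<comment> \<open>Strong convexity based at the limit \<open>u\<close> supplies the
    semicontinuity: \<open>J u\<close> exceeds \<open>J (s m)\<close> by at most
    \<open>b * N (s m - u)\<close>.\<close>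
  have "J u \<le> I + \<kappa>' / 4 * (1/4)^m + b * N (s m - u)" for m
  proof -
    have "- (b * N (s m - u)) \<le> D u (s m - u)" using b[of "s m - u"] sV[of m] u by (simp add: V_closed abs_le_iff)
    moreover have "\<kappa>' * (N (s m - u))\<^sup>2 \<ge> 0" using \<kappa>'_pos by simp
    ultimately show ?thesis using S_strongly_convex[OF uS s[of m]] Js[of m] by linarith
  qed
  moreover have "(\<lambda>m. I + \<kappa>' / 4 * (1/4)^m + b * N (s m - u)) \<longlonglongrightarrow> I + \<kappa>' / 4 * 0 + b * 0"
    by (intro tendsto_intros lim LIMSEQ_power_zero) simp
  ultimately have "J u \<le> I"
    using tendsto_lowerbound[of _ "I + \<kappa>' / 4 * 0 + b * 0" sequentially "J u"] by simp
  then show ?thesis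
    using uS cInf_lower[OF imageI J_bounded_below] unfolding I_def by force
qed

text \<open>A perturbation \<open>u + t *\<^sub>R h\<close> leaves \<open>S\<close> and is returned
  to it by a constant, giving \<open>w\<close>. Strong convexity based at \<open>w\<close>, not at
  \<open>u\<close>, together with \<open>J u \<le> J w\<close> yields \<open>D w h \<ge> 0\<close>;
  the constant drops out. By \<open>S_control\<close> the point \<open>w\<close> is within order
  \<open>t\<close> of \<open>u\<close>, so \<open>D u h\<close> is at least minus a multiple of
  \<open>t\<close>. No differentiability of the choice of constant is involved.\<close>

lemma minimizer_critical:
  assumes u: "u \<in> S" and min: "\<And>w. w \<in> S \<Longrightarrow> J u \<le> J w" and h: "h \<in> V"
  shows "- D u h \<le> 0"
proof (rule quadratic_le_imp_nonpos)
  fix t :: real assume t: "t > 0"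
  have uV: "u \<in> V" using u by (rule S_V)
  obtain k where k: "u + t *\<^sub>R h + c k \<in> S" using ex_shift_in_S[of "u + t *\<^sub>R h"] uV h by (auto simp: V_closed)
  define w where "w = u + t *\<^sub>R h + c k"
  have w: "w \<in> S" and wV: "w \<in> V" using k by (auto simp: w_def S_V)
  have "D w (u - w) = - t * D w h"
  proof -
    have "u - w = (- t) *\<^sub>R h + c (- k)" by (simp add: w_def c_minus)
    then have "D w (u - w) = D w ((- t) *\<^sub>R h) + D w (c (- k))"
      using wV h by (simp only: D_add V_closed)
    then show ?thesis using D_scale[OF wV h, of "- t"] S_D[OF w, of "- k"] by simp
  qed
  moreover have "\<kappa>' * (N (u - w))\<^sup>2 \<ge> 0" using \<kappa>'_pos by simp
  ultimately have "0 \<le> t * D w h"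
    using S_strongly_convex[OF w u] min[OF w] by linarith
  then have "D w h \<ge> 0" using t by (simp add: zero_le_mult_iff)
  moreover have "\<bar>D w h - D u h\<bar> \<le> C * N (w - u) * N h" by (rule D_Lip[OF wV uV h])
  moreover have "N (w - u) \<le> K2 * (t * N h)"
  proof -
    have "w - u + c (- k) = t *\<^sub>R h" by (simp add: w_def c_minus)
    then show ?thesis using S_control[OF u w, of "- k"] t h by (simp add: N_scale)
  qed
  then have "C * N (w - u) * N h \<le> C * (K2 * (t * N h)) * N h"
    using pos N_nonneg by (intro mult_right_mono mult_left_mono) auto
  ultimately have "- D u h \<le> C * (K2 * (t * N h)) * N h" by linarith
  then have "t * - D u h \<le> t * (C * (K2 * (t * N h)) * N h)" using t by (intro mult_left_mono) auto
  then show "t * - D u h \<le> C * K2 * (N h)\<^sup>2 * t\<^sup>2" by (simp add: power2_eq_square mult_ac)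
qed

theorem ex_critical_point: "\<exists>u\<in>V. \<forall>h\<in>V. D u h = 0"
proof -
  obtain u where u: "u \<in> S" and min: "\<And>w. w \<in> S \<Longrightarrow> J u \<le> J w" using ex_minimizer by blast
  have "D u h = 0" if h: "h \<in> V" for h
    using minimizer_critical[OF u min h] minimizer_critical[OF u min V_minus[OF h]]
      D_minus[OF S_V[OF u] h] by simp
  then show ?thesis using S_V[OF u] by blast
qed

theorem critical_point_unique:
  assumes "u \<in> V" "w \<in> V" and "\<And>h. h \<in> V \<Longrightarrow> D u h = 0" "\<And>h. h \<in> V \<Longrightarrow> D w h = 0"
  shows "N (w - u) = 0"
proof -
  have "u \<in> S" "w \<in> S" using assms by (auto simp: S_def c_V)
  from S_strongly_convex[OF this] S_strongly_convex[OF this(2,1)]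
  have "\<kappa>' * (N (w - u))\<^sup>2 + \<kappa>' * (N (u - w))\<^sup>2 \<le> 0"
    using assms by (simp add: V_closed)
  moreover have "\<kappa>' * (N (u - w))\<^sup>2 \<ge> 0" "\<kappa>' * (N (w - u))\<^sup>2 \<ge> 0" using \<kappa>'_pos by auto
  ultimately have "\<kappa>' * (N (w - u))\<^sup>2 = 0" by linarith
  then show ?thesis using \<kappa>'_pos by simp
qed

end

section \<open>Hoelder's inequality for Bochner integrals\<close>

lemma integral_Holder:
  fixes f g :: "'a \<Rightarrow> real"
  assumes [measurable]: "f \<in> borel_measurable M" "g \<in> borel_measurable M"
    and pq: "p > 1" "q > 1" "1/p + 1/q = 1"
    and f: "integrable M (\<lambda>x. \<bar>f x\<bar> powr p)" and g: "integrable M (\<lambda>x. \<bar>g x\<bar> powr q)"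
  shows "integrable M (\<lambda>x. f x * g x)"
    and "(LINT x|M. \<bar>f x * g x\<bar>) \<le>
           (LINT x|M. \<bar>f x\<bar> powr p) powr (1/p) * (LINT x|M. \<bar>g x\<bar> powr q) powr (1/q)"
proof -
  define F where "F = (LINT x|M. \<bar>f x\<bar> powr p)"
  define H where "H = (LINT x|M. \<bar>g x\<bar> powr q)"
  have young: "\<bar>a * b\<bar> \<le> \<bar>a\<bar> powr p / p + \<bar>b\<bar> powr q / q" for a b :: real
    using Youngs_inequality[OF pq, of "\<bar>a\<bar>" "\<bar>b\<bar>"] by (simp add: abs_mult)
  show int: "integrable M (\<lambda>x. f x * g x)"
  proof (rule Bochner_Integration.integrable_bound)
    show "integrable M (\<lambda>x. \<bar>f x\<bar> powr p / p + \<bar>g x\<bar> powr q / q)" using f g by simp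
    show "AE x in M. norm (f x * g x) \<le> norm (\<bar>f x\<bar> powr p / p + \<bar>g x\<bar> powr q / q)"
      using young by (auto intro!: always_eventually order_trans[OF young abs_ge_self])
  qed simp
  have FH: "F \<ge> 0" "H \<ge> 0" by (auto simp: F_def H_def)
  show "(LINT x|M. \<bar>f x * g x\<bar>) \<le> F powr (1/p) * H powr (1/q)"
  \<comment> \<open>Young's inequality is applied to functions of norm one, so both norms must be
    positive; otherwise the product vanishes almost everywhere.\<close>
  proof (cases "F = 0 \<or> H = 0")
    case True
    then have "AE x in M. f x * g x = 0"
    proof
      assume "F = 0"
      then have "AE x in M. \<bar>f x\<bar> powr p = 0"
        using integral_nonneg_eq_0_iff_AE[OF f] by (simp add: F_def)
      then show ?thesis by eventually_elim (use pq in auto)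
    next
      assume "H = 0"
      then have "AE x in M. \<bar>g x\<bar> powr q = 0"
        using integral_nonneg_eq_0_iff_AE[OF g] by (simp add: H_def)
      then show ?thesis by eventually_elim (use pq in auto)
    qed
    then have "AE x in M. \<bar>f x * g x\<bar> = 0" by eventually_elim simp
    then have "(LINT x|M. \<bar>f x * g x\<bar>) = 0" by (rule integral_eq_zero_AE)
    then show ?thesis by simp
  next
    case False
    define a where "a = F powr (1/p)"
    define b where "b = H powr (1/q)"
    have ab: "a > 0" "b > 0" "a powr p = F" "b powr q = H"
      using False FH pq by (auto simp: a_def b_def powr_powr)
    have "(LINT x|M. \<bar>f x * g x\<bar> / (a * b)) \<le>
          (LINT x|M. \<bar>f x\<bar> powr p / (F * p) + \<bar>g x\<bar> powr q / (H * q))"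
    proof (rule integral_mono)
      show "\<bar>f x * g x\<bar> / (a * b) \<le> \<bar>f x\<bar> powr p / (F * p) + \<bar>g x\<bar> powr q / (H * q)" for x
        using young[of "f x / a" "g x / b"] ab by (simp add: abs_mult powr_divide)
    qed (use int f g in auto)
    also have "\<dots> = 1"
      using f g False pq by (simp add: F_def[symmetric] H_def[symmetric])
    finally show ?thesis using ab by (simp add: a_def b_def)
  qed
qed

section \<open>Square integrable functions\<close>

definition l2_set :: "'a measure \<Rightarrow> ('a \<Rightarrow> 'b::euclidean_space) set" where
  "l2_set M = {f \<in> borel_measurable M. integrable M (\<lambda>x. (norm (f x))\<^sup>2)}"

definition l2_norm :: "'a measure \<Rightarrow> ('a \<Rightarrow> 'b::euclidean_space) \<Rightarrow> real" where
  "l2_norm M f = sqrt (LINT x|M. (norm (f x))\<^sup>2)"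

lemma L2_eq_l2_set: "L2 \<Omega> = l2_set (lebesgue_on \<Omega>)"
  by (auto simp: L2_def l2_set_def)

lemma l2_setD:
  assumes "f \<in> l2_set M"
  shows l2_measurable: "f \<in> borel_measurable M" and l2_integrable: "integrable M (\<lambda>x. (norm (f x))\<^sup>2)"
  using assms by (auto simp: l2_set_def)

lemma l2_norm_nonneg [simp]: "l2_norm M f \<ge> 0"
  by (simp add: l2_norm_def)

lemma l2_norm_square: "(l2_norm M f)\<^sup>2 = (LINT x|M. (norm (f x))\<^sup>2)"
  by (simp add: l2_norm_def)

lemma l2_cong:
  assumes "f \<in> l2_set M" "g \<in> borel_measurable M" "AE x in M. f x = g x"
  shows "g \<in> l2_set M" and "l2_norm M g = l2_norm M f"
proof -
  have *: "AE x in M. (norm (f x))\<^sup>2 = (norm (g x))\<^sup>2" using assms(3) by eventually_elim simp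
  note [measurable] = assms(2) l2_measurable[OF assms(1)]
  have "integrable M (\<lambda>x. (norm (f x))\<^sup>2) \<longleftrightarrow> integrable M (\<lambda>x. (norm (g x))\<^sup>2)"
    by (rule integrable_cong_AE) (use * in simp_all)
  then show "g \<in> l2_set M"
    using l2_integrable[OF assms(1)] assms(2) by (simp add: l2_set_def)
  show "l2_norm M g = l2_norm M f"
    unfolding l2_norm_def
    by (rule arg_cong[where f=sqrt], rule integral_cong_AE) (use * in \<open>simp_all add: eq_commute\<close>)
qed

lemma l2_bound:
  fixes f :: "'a \<Rightarrow> 'b::euclidean_space" and g :: "'a \<Rightarrow> 'c::euclidean_space"
  assumes "f \<in> l2_set M" "g \<in> borel_measurable M" "AE x in M. norm (g x) \<le> norm (f x)"
  shows "g \<in> l2_set M"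
proof -
  note [measurable] = assms(2)
  have "AE x in M. norm ((norm (g x))\<^sup>2) \<le> norm ((norm (f x))\<^sup>2)"
    using assms(3) by eventually_elim (simp add: power_mono)
  then have "integrable M (\<lambda>x. (norm (g x))\<^sup>2)"
    by (intro Bochner_Integration.integrable_bound[OF l2_integrable[OF assms(1)]]) measurable
  then show ?thesis using assms(2) by (simp add: l2_set_def)
qed

lemma l2_norm_mono:
  fixes f :: "'a \<Rightarrow> 'b::euclidean_space" and g :: "'a \<Rightarrow> 'c::euclidean_space"
  assumes f: "f \<in> l2_set M" and g: "g \<in> l2_set M" and "AE x in M. norm (g x) \<le> norm (f x)"
  shows "l2_norm M g \<le> l2_norm M f"
  unfolding l2_norm_def
proof (rule real_sqrt_le_mono, rule integral_mono_AE)
  show "AE x in M. (norm (g x))\<^sup>2 \<le> (norm (f x))\<^sup>2"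
    using assms(3) by eventually_elim (simp add: power_mono)
qed (use f g in \<open>auto simp: l2_integrable\<close>)

lemma l2_zero: "(\<lambda>x. 0) \<in> l2_set M"
  by (simp add: l2_set_def)

lemma l2_scaleR:
  assumes "f \<in> l2_set M" shows "(\<lambda>x. t *\<^sub>R f x) \<in> l2_set M"
  using assms by (auto simp: l2_set_def power_mult_distrib)

lemma l2_norm_scaleR: "l2_norm M (\<lambda>x. t *\<^sub>R f x) = \<bar>t\<bar> * l2_norm M f"
  by (simp add: l2_norm_def power_mult_distrib real_sqrt_mult)

lemma l2_add:
  assumes f: "f \<in> l2_set M" and g: "g \<in> l2_set M" shows "(\<lambda>x. f x + g x) \<in> l2_set M"
proof -
  note [measurable] = l2_measurable[OF f] l2_measurable[OF g]
  have "integrable M (\<lambda>x. (norm (f x + g x))\<^sup>2)"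
  proof (rule Bochner_Integration.integrable_bound)
    show "integrable M (\<lambda>x. 2 * (norm (f x))\<^sup>2 + 2 * (norm (g x))\<^sup>2)"
      using f g by (simp add: l2_integrable)
    have "(norm (f x + g x))\<^sup>2 \<le> 2 * (norm (f x))\<^sup>2 + 2 * (norm (g x))\<^sup>2" for x
    proof -
      have "(norm (f x + g x))\<^sup>2 \<le> (norm (f x) + norm (g x))\<^sup>2"
        by (intro power_mono norm_triangle_ineq) simp
      then show ?thesis using sum_squares_bound[of "norm (f x)" "norm (g x)"]
        by (simp add: power2_sum)
    qed
    then show "AE x in M. norm ((norm (f x + g x))\<^sup>2) \<le> norm (2 * (norm (f x))\<^sup>2 + 2 * (norm (g x))\<^sup>2)"
      by simp
  qed simp
  then show ?thesis by (simp add: l2_set_def)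
qed

lemma l2_minus: "f \<in> l2_set M \<Longrightarrow> (\<lambda>x. - f x) \<in> l2_set M"
  by (simp add: l2_set_def)

lemma l2_diff:
  assumes "f \<in> l2_set M" "g \<in> l2_set M" shows "(\<lambda>x. f x - g x) \<in> l2_set M"
  using l2_add[OF assms(1) l2_minus[OF assms(2)]] by simp

lemma l2_norm_minus_commute: "l2_norm M (\<lambda>x. f x - g x) = l2_norm M (\<lambda>x. g x - f x)"
  by (simp add: l2_norm_def norm_minus_commute)

lemma l2_Cauchy_Schwarz:
  fixes f :: "'a \<Rightarrow> 'b::euclidean_space" and g :: "'a \<Rightarrow> 'c::euclidean_space"
  assumes f: "f \<in> l2_set M" and g: "g \<in> l2_set M"
  shows "integrable M (\<lambda>x. norm (f x) * norm (g x))"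
    and "(LINT x|M. norm (f x) * norm (g x)) \<le> l2_norm M f * l2_norm M g"
proof -
  have [simp]: "\<bar>norm a\<bar> powr 2 = (norm a)\<^sup>2" for a :: "'d::real_normed_vector"
    by (cases "a = 0") (simp_all add: powr_numeral)
  note [measurable] = l2_measurable[OF f] l2_measurable[OF g]
  note * = integral_Holder[of "\<lambda>x. norm (f x)" M "\<lambda>x. norm (g x)" 2 2]
  show "integrable M (\<lambda>x. norm (f x) * norm (g x))"
    by (rule *) (use f g in \<open>auto simp: l2_integrable\<close>)
  show "(LINT x|M. norm (f x) * norm (g x)) \<le> l2_norm M f * l2_norm M g"
    using *(2) l2_integrable[OF f] l2_integrable[OF g]
    by (simp add: powr_half_sqrt l2_norm_def)
qed

lemma l2_inner:
  fixes f g :: "'a \<Rightarrow> 'b::euclidean_space"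
  assumes f: "f \<in> l2_set M" and g: "g \<in> l2_set M"
  shows l2_inner_integrable: "integrable M (\<lambda>x. f x \<bullet> g x)"
    and l2_inner_bound: "\<bar>LINT x|M. f x \<bullet> g x\<bar> \<le> l2_norm M f * l2_norm M g"
proof -
  note [measurable] = l2_measurable[OF f] l2_measurable[OF g]
  show int: "integrable M (\<lambda>x. f x \<bullet> g x)"
    by (rule Bochner_Integration.integrable_bound[OF l2_Cauchy_Schwarz(1)[OF f g]])
       (auto simp: Cauchy_Schwarz_ineq2)
  have "\<bar>LINT x|M. f x \<bullet> g x\<bar> \<le> (LINT x|M. \<bar>f x \<bullet> g x\<bar>)" by (rule integral_abs_bound)
  also have "\<dots> \<le> (LINT x|M. norm (f x) * norm (g x))"
    using int by (intro integral_mono l2_Cauchy_Schwarz f g) (auto simp: Cauchy_Schwarz_ineq2)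
  finally show "\<bar>LINT x|M. f x \<bullet> g x\<bar> \<le> l2_norm M f * l2_norm M g"
    using l2_Cauchy_Schwarz(2)[OF f g] by linarith
qed

lemma l2_norm_triangle:
  assumes f: "f \<in> l2_set M" and g: "g \<in> l2_set M"
  shows "l2_norm M (\<lambda>x. f x + g x) \<le> l2_norm M f + l2_norm M g"
proof (rule power2_le_imp_le)
  have "(l2_norm M (\<lambda>x. f x + g x))\<^sup>2 = (LINT x|M. (norm (f x))\<^sup>2 + 2 * (f x \<bullet> g x) + (norm (g x))\<^sup>2)"
    unfolding l2_norm_square by (simp add: power2_norm_eq_inner inner_add inner_commute algebra_simps)
  also have "\<dots> = (l2_norm M f)\<^sup>2 + 2 * (LINT x|M. f x \<bullet> g x) + (l2_norm M g)\<^sup>2"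
    using f g by (simp add: l2_norm_square l2_integrable l2_inner_integrable)
  also have "\<dots> \<le> (l2_norm M f)\<^sup>2 + 2 * (l2_norm M f * l2_norm M g) + (l2_norm M g)\<^sup>2"
    using l2_inner_bound[OF f g] by (simp add: abs_le_iff)
  finally show "(l2_norm M (\<lambda>x. f x + g x))\<^sup>2 \<le> (l2_norm M f + l2_norm M g)\<^sup>2"
    by (simp add: power2_sum)
qed simp

lemma l2_norm_zero_AE:
  assumes "f \<in> l2_set M" "l2_norm M f = 0" shows "AE x in M. f x = 0"
proof -
  have "(LINT x|M. (norm (f x))\<^sup>2) = 0" using assms(2) by (simp add: l2_norm_def)
  then have "AE x in M. (norm (f x))\<^sup>2 = 0"
    using integral_nonneg_eq_0_iff_AE[OF l2_integrable[OF assms(1)]] by simp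
  then show ?thesis by eventually_elim simp
qed

context finite_measure
begin

lemma l2_bounded:
  fixes f :: "'a \<Rightarrow> 'b::euclidean_space"
  assumes "f \<in> borel_measurable M" "\<And>x. x \<in> space M \<Longrightarrow> norm (f x) \<le> B"
  shows "f \<in> l2_set M"
proof -
  have "(\<lambda>x. B) \<in> l2_set M" by (simp add: l2_set_def)
  moreover have "AE x in M. norm (f x) \<le> norm B"
    using order_trans[OF assms(2) abs_ge_self] by (intro AE_I2) simp
  ultimately show ?thesis using l2_bound assms(1) by blast
qed

lemma l2_imp_integrable:
  fixes f :: "'a \<Rightarrow> 'b::euclidean_space"
  assumes f: "f \<in> l2_set M"
  shows "integrable M f" and "(LINT x|M. norm (f x)) \<le> l2_norm M f * sqrt (measure M (space M))"
proof -
  have 1: "(\<lambda>x. 1::real) \<in> l2_set M" by (rule l2_bounded[where B=1]) auto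
  have n1: "l2_norm M (\<lambda>x. 1::real) = sqrt (measure M (space M))" by (simp add: l2_norm_def)
  show "integrable M f"
    by (rule Bochner_Integration.integrable_bound[OF l2_Cauchy_Schwarz(1)[OF f 1]]) (use f in \<open>auto simp: l2_measurable\<close>)
  show "(LINT x|M. norm (f x)) \<le> l2_norm M f * sqrt (measure M (space M))"
    using l2_Cauchy_Schwarz(2)[OF f 1] by (simp add: n1)
qed

text \<open>Riesz-Fischer for a sequence with geometric steps. On a finite measure space the steps
  are also summable in mean, so the increments are absolutely summable at almost every point and a
  pointwise limit exists. Fatou's lemma, applied to the distances from a fixed \<open>s m\<close>,
  upgrades this to convergence in norm.\<close>

lemma l2_complete:
  fixes s :: "nat \<Rightarrow> 'a \<Rightarrow> 'b::euclidean_space"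
  assumes s: "\<And>m. s m \<in> l2_set M"
    and bd: "\<And>m. l2_norm M (\<lambda>x. s (Suc m) x - s m x) \<le> r * (1/2)^m"
  shows "\<exists>f\<in>l2_set M. (\<lambda>m. l2_norm M (\<lambda>x. s m x - f x)) \<longlonglongrightarrow> 0"
proof -
  note [measurable] = l2_measurable[OF s]
  define d where "d m x = s (Suc m) x - s m x" for m x
  have d: "d m \<in> l2_set M" for m
    using l2_diff[OF s[of "Suc m"] s[of m]] by (simp add: d_def[abs_def])
  note [measurable] = l2_measurable[OF d]
  define c where "c = sqrt (measure M (space M))"
  have "l2_norm M (d 0) \<le> r" using bd[of 0] by (simp add: d_def[abs_def])
  then have r: "r \<ge> 0" using l2_norm_nonneg[of M "d 0"] by linarith
  have "AE x in M. summable (\<lambda>m. norm (d m x))"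
  proof -
    have "(\<integral>\<^sup>+x. (\<Sum>m. ennreal (norm (d m x))) \<partial>M) = (\<Sum>m. \<integral>\<^sup>+x. ennreal (norm (d m x)) \<partial>M)"
      by (intro nn_integral_suminf) measurable
    also have "\<dots> = (\<Sum>m. ennreal (LINT x|M. norm (d m x)))"
      using l2_imp_integrable(1)[OF d] by (intro suminf_cong nn_integral_eq_integral) auto
    also have "\<dots> \<le> (\<Sum>m. ennreal (r * c * (1/2)^m))"
    proof (intro suminf_le summableI ennreal_leI)
      fix m
      have "(LINT x|M. norm (d m x)) \<le> l2_norm M (d m) * c"
        unfolding c_def by (rule l2_imp_integrable[OF d])
      also have "\<dots> \<le> (r * (1/2)^m) * c"
        using bd[of m] by (intro mult_right_mono) (auto simp: c_def d_def[abs_def])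
      finally show "(LINT x|M. norm (d m x)) \<le> r * c * (1/2)^m" by (simp add: mult_ac)
    qed
    also have "\<dots> < \<infinity>"
    proof -
      have "summable (\<lambda>m. r * c * (1/2::real)^m)" by (intro summable_mult summable_geometric) simp
      then show ?thesis using r by (subst suminf_ennreal2) (auto simp: c_def)
    qed
    finally have "AE x in M. (\<Sum>m. ennreal (norm (d m x))) \<noteq> \<infinity>"
      by (intro nn_integral_PInf_AE) (auto simp: less_top[symmetric])
    then show ?thesis by eventually_elim (rule summable_suminf_not_top, auto)
  qed
  then have conv: "AE x in M. convergent (\<lambda>m. s m x)"
  proof eventually_elim
    fix x assume "summable (\<lambda>m. norm (d m x))"
    then have "summable (\<lambda>m. d m x)" by (rule summable_norm_cancel)
    then have "convergent (\<lambda>n. \<Sum>m<n. d m x)"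
      by (simp add: summable_iff_convergent)
    also have "(\<lambda>n. \<Sum>m<n. d m x) = (\<lambda>n. s n x - s 0 x)"
      unfolding d_def by (rule ext, rule sum_lessThan_telescope)
    finally show "convergent (\<lambda>m. s m x)"
      using convergent_add[OF _ convergent_const[of "s 0 x"]] by fastforce
  qed
  define f where "f x = lim (\<lambda>m. s m x)" for x
  have [measurable]: "f \<in> borel_measurable M"
    unfolding f_def[abs_def] by (rule borel_measurable_lim_metric) simp
  have lim: "AE x in M. (\<lambda>m. s m x) \<longlonglongrightarrow> f x"
    using conv by eventually_elim (simp add: f_def convergent_LIMSEQ_iff)
  \<comment> \<open>The exact partial sum of the geometric series is carried along, so that the
    induction closes; the bound \<open>e m\<close> below is its limit in \<open>j\<close>.\<close>
  have cau: "l2_norm M (\<lambda>x. s (m + j) x - s m x) \<le> 2 * r * (1/2)^m * (1 - (1/2)^j)" for m j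
  proof (induction j)
    case 0 then show ?case by (simp add: l2_norm_def)
  next
    case (Suc j)
    have "l2_norm M (\<lambda>x. s (m + Suc j) x - s m x) = l2_norm M (\<lambda>x. d (m + j) x + (s (m + j) x - s m x))"
      by (simp add: d_def)
    also have "\<dots> \<le> l2_norm M (d (m + j)) + l2_norm M (\<lambda>x. s (m + j) x - s m x)"
      by (intro l2_norm_triangle l2_diff d s)
    also have "\<dots> \<le> r * (1/2)^(m + j) + 2 * r * (1/2)^m * (1 - (1/2)^j)"
      using bd[of "m + j"] Suc by (simp add: d_def[abs_def])
    also have "\<dots> = 2 * r * (1/2)^m * (1 - (1/2)^Suc j)"
      by (simp add: power_add algebra_simps)
    finally show ?case .
  qed
  define e where "e m = 2 * r * (1/2::real)^m" for m :: nat
  have e: "e m \<ge> 0" for m using r by (simp add: e_def)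
  have fat: "(\<integral>\<^sup>+x. ennreal ((norm (f x - s m x))\<^sup>2) \<partial>M) \<le> ennreal ((e m)\<^sup>2)" for m
  proof -
    have "(\<integral>\<^sup>+x. ennreal ((norm (f x - s m x))\<^sup>2) \<partial>M)
        = (\<integral>\<^sup>+x. liminf (\<lambda>j. ennreal ((norm (s (m + j) x - s m x))\<^sup>2)) \<partial>M)"
    proof (rule nn_integral_cong_AE, use lim in eventually_elim)
      fix x assume "(\<lambda>m. s m x) \<longlonglongrightarrow> f x"
      then have "(\<lambda>j. s (m + j) x) \<longlonglongrightarrow> f x"
        by (subst add.commute) (rule LIMSEQ_ignore_initial_segment)
      then have "(\<lambda>j. ennreal ((norm (s (m + j) x - s m x))\<^sup>2)) \<longlonglongrightarrow> ennreal ((norm (f x - s m x))\<^sup>2)"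
        by (intro tendsto_ennrealI tendsto_intros)
      then show "ennreal ((norm (f x - s m x))\<^sup>2) = liminf (\<lambda>j. ennreal ((norm (s (m + j) x - s m x))\<^sup>2))"
        by (rule lim_imp_Liminf[OF trivial_limit_sequentially, symmetric])
    qed
    also have "\<dots> \<le> liminf (\<lambda>j. \<integral>\<^sup>+x. ennreal ((norm (s (m + j) x - s m x))\<^sup>2) \<partial>M)"
      by (rule nn_integral_liminf) measurable
    also have "\<dots> \<le> liminf (\<lambda>j. ennreal ((e m)\<^sup>2))"
    proof (rule Liminf_mono, rule always_eventually, rule allI)
      fix j
      have "(\<integral>\<^sup>+x. ennreal ((norm (s (m + j) x - s m x))\<^sup>2) \<partial>M)
          = ennreal ((l2_norm M (\<lambda>x. s (m + j) x - s m x))\<^sup>2)"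
        unfolding l2_norm_square
        by (intro nn_integral_eq_integral l2_integrable l2_diff s) auto
      also have "\<dots> \<le> ennreal ((e m)\<^sup>2)"
      proof (intro ennreal_leI power_mono l2_norm_nonneg)
        have "e m * (1 - (1/2)^j) \<le> e m * 1" using e[of m] by (intro mult_left_mono) auto
        then show "l2_norm M (\<lambda>x. s (m + j) x - s m x) \<le> e m" using cau[of m j] by (simp add: e_def)
      qed
      finally show "(\<integral>\<^sup>+x. ennreal ((norm (s (m + j) x - s m x))\<^sup>2) \<partial>M) \<le> ennreal ((e m)\<^sup>2)" .
    qed
    also have "\<dots> = ennreal ((e m)\<^sup>2)" by (simp add: Liminf_const)
    finally show ?thesis .
  qed
  have fs: "(\<lambda>x. f x - s m x) \<in> l2_set M" for m
  proof -
    have "(\<integral>\<^sup>+x. ennreal (norm ((norm (f x - s m x))\<^sup>2)) \<partial>M) < \<infinity>"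
      using le_less_trans[OF fat[of m] ennreal_less_top] by simp
    then have "integrable M (\<lambda>x. (norm (f x - s m x))\<^sup>2)"
      by (intro integrableI_bounded) measurable
    then show ?thesis by (simp add: l2_set_def)
  qed
  have le: "l2_norm M (\<lambda>x. s m x - f x) \<le> e m" for m
  proof -
    have "ennreal ((l2_norm M (\<lambda>x. f x - s m x))\<^sup>2) = (\<integral>\<^sup>+x. ennreal ((norm (f x - s m x))\<^sup>2) \<partial>M)"
      unfolding l2_norm_square
      by (intro nn_integral_eq_integral[symmetric] l2_integrable fs) auto
    then have "ennreal ((l2_norm M (\<lambda>x. f x - s m x))\<^sup>2) \<le> ennreal ((e m)\<^sup>2)" using fat[of m] by simp
    then have "(l2_norm M (\<lambda>x. f x - s m x))\<^sup>2 \<le> (e m)\<^sup>2" by (subst (asm) ennreal_le_iff) auto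
    then show ?thesis using e[of m] by (subst l2_norm_minus_commute) (rule power2_le_imp_le)
  qed
  have *: "(\<lambda>m. e m) \<longlonglongrightarrow> 2 * r * 0"
    unfolding e_def by (intro tendsto_mult tendsto_const LIMSEQ_power_zero) simp
  have "(\<lambda>m. l2_norm M (\<lambda>x. s m x - f x)) \<longlonglongrightarrow> 0"
    by (rule Lim_null_comparison[of _ e]) (use le * in \<open>simp_all add: always_eventually\<close>)
  moreover have "f \<in> l2_set M"
    using l2_add[OF fs[of 0] s[of 0]] by simp
  ultimately show ?thesis by blast
qed

end

section \<open>Test functions\<close>

lemma C_k_SucI:
  assumes "\<And>x. (f has_derivative f' x) (at x)" "\<And>i. i \<in> Basis \<Longrightarrow> C_k k (\<lambda>x. f' x i)"
  shows "C_k (Suc k) f"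
proof -
  have "frechet_derivative f (at x) = f' x" for x
    using frechet_derivative_at[OF assms(1)[of x]] by simp
  then show ?thesis
    using assms by (auto simp: differentiable_def)
qed

lemma C_k_has_derivative:
  assumes "C_k (Suc k) f" shows "(f has_derivative frechet_derivative f (at x)) (at x)"
  using assms by (simp add: frechet_derivative_works)

lemma C_k_imp_continuous: "C_k k f \<Longrightarrow> continuous_on UNIV f"
  by (cases k) (auto intro!: continuous_at_imp_continuous_on differentiable_imp_continuous_within)

text \<open>In the product rule one factor stays undifferentiated and has to be regarded as a
  function of the lower class; hence the monotonicity in \<open>k\<close>.\<close>

lemma C_k_Suc_imp_C_k: "C_k (Suc k) f \<Longrightarrow> C_k k f"
proof (induction k arbitrary: f)
  case 0
  then show ?case using C_k_imp_continuous by (subst C_k.simps)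
next
  case (Suc k)
  have "C_k k (\<lambda>x. frechet_derivative f (at x) i)" if "i \<in> Basis" for i
    using Suc.prems that C_k.simps(2)[of "Suc k" f] by (blast intro: Suc.IH)
  then show ?case using Suc.prems C_k.simps(2)[of "Suc k" f] C_k.simps(2)[of k f] by blast
qed

lemma C_k_const: "C_k k (\<lambda>x. c)"
proof (induction k arbitrary: c)
  case (Suc k)
  show ?case by (rule C_k_SucI[where f'="\<lambda>x h. 0"]) (auto intro: Suc)
qed simp

lemma C_k_add: "C_k k f \<Longrightarrow> C_k k g \<Longrightarrow> C_k k (\<lambda>x. f x + g x)"
proof (induction k arbitrary: f g)
  case (Suc k)
  show ?case
  proof (rule C_k_SucI)
    show "((\<lambda>x. f x + g x) has_derivative
        (\<lambda>h. frechet_derivative f (at x) h + frechet_derivative g (at x) h)) (at x)" for x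
      using Suc.prems by (intro derivative_intros C_k_has_derivative)
  qed (use Suc in auto)
qed (auto intro: continuous_intros)

lemma C_k_mult: "C_k k f \<Longrightarrow> C_k k g \<Longrightarrow> C_k k (\<lambda>x. f x * g x)"
proof (induction k arbitrary: f g)
  case (Suc k)
  show ?case
  proof (rule C_k_SucI)
    show "((\<lambda>x. f x * g x) has_derivative
        (\<lambda>h. f x * frechet_derivative g (at x) h + frechet_derivative f (at x) h * g x)) (at x)" for x
      using Suc.prems by (intro has_derivative_mult C_k_has_derivative)
    show "C_k k (\<lambda>x. f x * frechet_derivative g (at x) i + frechet_derivative f (at x) i * g x)"
      if "i \<in> Basis" for i
      using Suc.prems that by (intro C_k_add Suc.IH) (auto dest: C_k_Suc_imp_C_k simp del: C_k.simps(2), auto)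
  qed
qed (auto intro: continuous_intros)

lemma C_k_prod:
  assumes "finite A" "\<And>a. a \<in> A \<Longrightarrow> C_k k (f a)" shows "C_k k (\<lambda>x. \<Prod>a\<in>A. f a x)"
  using assms by (induction A rule: finite_induct) (auto intro: C_k_const C_k_mult)

text \<open>For \<open>n = 0\<close> this is the flat function exp(-1/t), extended by zero. The
  extra power makes the family closed under differentiation up to linear combinations, so smoothness
  follows by induction on the order for all \<open>n\<close> at once.\<close>

definition bump :: "nat \<Rightarrow> real \<Rightarrow> real" where
  "bump n t = (if t > 0 then inverse t ^ n / exp (inverse t) else 0)"

lemma bump_tendsto_0: "(bump n \<longlongrightarrow> 0) (at 0)"
proof -
  have "((\<lambda>t. inverse t ^ n / exp (inverse t)) \<longlongrightarrow> (0::real)) (at_right 0)"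
    by (rule filterlim_compose[OF tendsto_power_div_exp_0 filterlim_inverse_at_top_right])
  then have "(bump n \<longlongrightarrow> 0) (at_right 0)"
    by (rule Lim_transform_eventually) (auto simp: eventually_at bump_def intro!: exI[of _ 1])
  moreover have "((\<lambda>t. 0) \<longlongrightarrow> (0::real)) (at_left 0)" by simp
  then have "(bump n \<longlongrightarrow> 0) (at_left 0)"
    by (rule Lim_transform_eventually) (auto simp: eventually_at bump_def intro!: exI[of _ 1])
  ultimately show ?thesis by (simp add: filterlim_at_split)
qed

lemma bump_DERIV: "(bump n has_real_derivative bump (n + 2) t - real n * bump (n + 1) t) (at t)"
proof -
  consider "t > 0" | "t < 0" | "t = 0" by linarith
  then show ?thesis
  proof cases
    case 1
    have "((\<lambda>t. inverse t ^ n / exp (inverse t)) has_real_derivative bump (n + 2) t - real n * bump (n + 1) t) (at t)"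
    proof -
      define y where "y = inverse t"
      have "((\<lambda>y. y ^ n / exp y) has_real_derivative (real n * y ^ (n - 1) - y ^ n) / exp y) (at y)"
        by (auto intro!: derivative_eq_intros simp: divide_simps) (simp add: algebra_simps)
      moreover have "(inverse has_real_derivative - (y ^ 2)) (at t)"
        using 1 DERIV_inverse[of t] by (simp add: y_def numeral_2_eq_2)
      ultimately have "((\<lambda>t. inverse t ^ n / exp (inverse t)) has_real_derivative
          (real n * y ^ (n - 1) - y ^ n) / exp y * - (y ^ 2)) (at t)"
        unfolding y_def by (rule DERIV_chain2)
      also have "(real n * y ^ (n - 1) - y ^ n) / exp y * - (y ^ 2) = bump (n + 2) t - real n * bump (n + 1) t"
        using 1 by (cases n) (auto simp: bump_def y_def[symmetric] power2_eq_square diff_divide_distrib add_divide_distrib algebra_simps)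
      finally show ?thesis .
    qed
    then show ?thesis
      by (rule has_field_derivative_transform_within_open[of _ _ _ "{0<..}"]) (use 1 in \<open>auto simp: bump_def\<close>)
  next
    case 2
    have "((\<lambda>t. 0) has_real_derivative bump (n + 2) t - real n * bump (n + 1) t) (at t)"
      using 2 by (simp add: bump_def)
    then show ?thesis
      by (rule has_field_derivative_transform_within_open[of _ _ _ "{..<0}"]) (use 2 in \<open>auto simp: bump_def\<close>)
  next
    case 3
    \<comment> \<open>At the origin the difference quotient of \<open>bump n\<close> is
      \<open>bump (Suc n)\<close>, which tends to 0.\<close>
    have "((\<lambda>h. (bump n (0 + h) - bump n 0) / h) \<longlongrightarrow> 0) (at 0)"
      by (rule Lim_transform_eventually[OF bump_tendsto_0[of "Suc n"]])
         (auto simp: eventually_at bump_def field_simps intro!: exI[of _ 1])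
    then show ?thesis using 3 by (simp add: DERIV_def bump_def)
  qed
qed

lemma C_k_bump_affine: "C_k k (\<lambda>x::'a::euclidean_space. bump n (a + b * (x \<bullet> e)))"
proof (induction k arbitrary: n)
  case 0
  have "continuous_on UNIV (bump n)"
    by (intro continuous_at_imp_continuous_on ballI DERIV_isCont[OF bump_DERIV])
  then show ?case
    by (auto intro!: continuous_on_compose2[of UNIV "bump n"] continuous_intros)
next
  case (Suc k)
  show ?case
  proof (rule C_k_SucI)
    fix x :: 'a
    have "((\<lambda>x. a + b * (x \<bullet> e)) has_derivative (\<lambda>h. b * (h \<bullet> e))) (at x)"
      by (auto intro!: derivative_eq_intros)
    from has_derivative_compose[OF this bump_DERIV[unfolded has_field_derivative_def]]
    show "((\<lambda>x. bump n (a + b * (x \<bullet> e))) has_derivative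
        (\<lambda>h. (bump (n + 2) (a + b * (x \<bullet> e)) + - real n * bump (n + 1) (a + b * (x \<bullet> e))) * (b * (h \<bullet> e)))) (at x)"
      by (simp add: mult.commute)
  qed (intro C_k_mult C_k_add C_k_const Suc)
qed

lemma bump_0_bounds: "0 \<le> bump 0 t" "bump 0 t \<le> 1"
  by (auto simp: bump_def)

lemma bump_0_tendsto_1: "(bump 0 \<longlongrightarrow> 1) at_top"
proof -
  have "((\<lambda>t::real. inverse t ^ 0 / exp (inverse t)) \<longlongrightarrow> 1 / exp 0) at_top"
    by (intro tendsto_divide tendsto_exp tendsto_inverse_0_at_top filterlim_ident) simp_all
  then have "((\<lambda>t::real. inverse t ^ 0 / exp (inverse t)) \<longlongrightarrow> 1) at_top" by simp
  then show ?thesis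
    by (rule Lim_transform_eventually) (auto simp: bump_def intro: eventually_mono[OF eventually_gt_at_top[of 0]])
qed

lemma bump_0_scaled_tendsto:
  "(\<lambda>m. bump 0 (- 1 + real m * s)) \<longlonglongrightarrow> (if s > 0 then 1 else 0)"
proof (cases "s > 0")
  case True
  then have "filterlim (\<lambda>m. - 1 + real m * s) at_top sequentially"
    by (intro filterlim_tendsto_add_at_top[OF tendsto_const]
        filterlim_at_top_mult_tendsto_pos[OF tendsto_const] filterlim_real_sequentially)
  from filterlim_compose[OF bump_0_tendsto_1 this] True show ?thesis by simp
next
  case False
  then have "bump 0 (- 1 + real m * s) = 0" for m
    by (auto simp: bump_def) (smt (verit) mult_nonneg_nonpos of_nat_0_le_iff)
  then show ?thesis using False by simp
qed

text \<open>The shift by \<open>-1\<close> keeps the closed support inside the open box.\<close>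

definition box_bump :: "'a::euclidean_space \<Rightarrow> 'a \<Rightarrow> nat \<Rightarrow> 'a \<Rightarrow> real" where
  "box_bump l u m x = (\<Prod>i\<in>Basis. bump 0 (- 1 + real m * (x \<bullet> i - l \<bullet> i)) * bump 0 (- 1 + real m * (u \<bullet> i - x \<bullet> i)))"

lemma box_bump_bounds: "0 \<le> box_bump l u m x" "box_bump l u m x \<le> 1"
  unfolding box_bump_def by (auto intro!: prod_nonneg prod_le_1 mult_le_one simp: bump_0_bounds)

lemma box_bump_tendsto: "(\<lambda>m. box_bump l u m x) \<longlonglongrightarrow> indicator (box l u) x"
proof -
  have "(\<lambda>m. box_bump l u m x) \<longlonglongrightarrow>
      (\<Prod>i\<in>Basis. (if x \<bullet> i - l \<bullet> i > 0 then 1 else 0) * (if u \<bullet> i - x \<bullet> i > 0 then 1 else 0))"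
    unfolding box_bump_def by (intro tendsto_prod tendsto_mult bump_0_scaled_tendsto)
  also have "(\<Prod>i\<in>Basis. (if x \<bullet> i - l \<bullet> i > 0 then 1 else 0) * (if u \<bullet> i - x \<bullet> i > 0 then 1 else 0))
      = (indicator (box l u) x :: real)"
  proof (cases "x \<in> box l u")
    case True
    then show ?thesis by (auto simp: mem_box intro!: prod.neutral)
  next
    case False
    then obtain i where "i \<in> Basis" "\<not> (l \<bullet> i < x \<bullet> i \<and> x \<bullet> i < u \<bullet> i)" by (auto simp: mem_box)
    then have "(\<Prod>i\<in>Basis. (if x \<bullet> i - l \<bullet> i > 0 then 1 else 0) * (if u \<bullet> i - x \<bullet> i > 0 then 1 else 0)) = (0::real)"
      by (intro prod_zero) (auto intro!: bexI[of _ i])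
    then show ?thesis using False by simp
  qed
  finally show ?thesis .
qed

lemma box_bump_test_function:
  assumes "box l u \<subseteq> \<Omega>"
  shows "box_bump l u m \<in> test_functions \<Omega>"
proof -
  have "C_k k (box_bump l u m)" for k
  proof -
    have "C_k k (\<lambda>x. \<Prod>i\<in>Basis. bump 0 ((- 1 - real m * (l \<bullet> i)) + real m * (x \<bullet> i)) *
        bump 0 ((- 1 + real m * (u \<bullet> i)) + (- real m) * (x \<bullet> i)))"
      by (intro C_k_prod C_k_mult C_k_bump_affine finite_Basis)
    then show ?thesis unfolding box_bump_def[abs_def] by (simp add: algebra_simps)
  qed
  moreover have "closure {x. box_bump l u m x \<noteq> 0} \<subseteq> box l u \<inter> cbox l u"
  proof -
    \<comment> \<open>A nonzero value forces every argument of \<open>bump\<close> to be positive,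
      hence a distance of at least \<open>1 / m\<close> from each face: the support lies in the
      closed box shrunk by \<open>d\<close>. For \<open>m = 0\<close> all arguments are
      \<open>-1\<close> and the function vanishes identically.\<close>
    define d where "d = (\<Sum>i\<in>Basis. (1 / real m) *\<^sub>R i :: 'a)"
    have d: "d \<bullet> i = 1 / real m" if "i \<in> Basis" for i
      using that by (simp add: d_def)
    have m: "m > 0" if "box_bump l u m x \<noteq> 0" for x
      using that by (cases "m = 0") (auto simp: box_bump_def bump_def)
    have "x \<in> cbox (l + d) (u - d)" if x: "box_bump l u m x \<noteq> 0" for x
    proof -
      have "- 1 + real m * (x \<bullet> i - l \<bullet> i) > 0 \<and> - 1 + real m * (u \<bullet> i - x \<bullet> i) > 0" if "i \<in> Basis" for i
        using x that unfolding box_bump_def by (force simp: bump_def split: if_splits)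
      then have "1 / real m \<le> x \<bullet> i - l \<bullet> i \<and> 1 / real m \<le> u \<bullet> i - x \<bullet> i" if "i \<in> Basis" for i
        using m[OF x] that by (simp add: divide_le_eq mult.commute less_imp_le)
      then show ?thesis using d by (auto simp: mem_box inner_simps algebra_simps)
    qed
    then have "closure {x. box_bump l u m x \<noteq> 0} \<subseteq> cbox (l + d) (u - d)"
      by (intro closure_minimal closed_cbox) auto
    moreover have "cbox (l + d) (u - d) \<subseteq> box l u" if "m > 0"
      using that d by (auto simp: mem_box inner_simps) (smt (verit) divide_pos_pos of_nat_0_less_iff)+
    ultimately show ?thesis
      using m box_subset_cbox[of l u] by (cases "m > 0") fastforce+
  qed
  ultimately show ?thesis
    using assms by (auto simp: test_functions_def C_inf_def compact_eq_bounded_closed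
        intro: bounded_subset[OF bounded_cbox])
qed

lemma test_function_C_k: "\<phi> \<in> test_functions \<Omega> \<Longrightarrow> C_k k \<phi>"
  by (simp add: test_functions_def C_inf_def)

lemma test_function_continuous:
  assumes "\<phi> \<in> test_functions \<Omega>"
  shows "continuous_on UNIV \<phi>"
    and "i \<in> Basis \<Longrightarrow> continuous_on UNIV (\<lambda>x. frechet_derivative \<phi> (at x) i)"
  using C_k_imp_continuous[OF test_function_C_k[OF assms, of 1]] test_function_C_k[OF assms, of 1] by auto

lemma test_function_has_derivative:
  "\<phi> \<in> test_functions \<Omega> \<Longrightarrow> (\<phi> has_derivative frechet_derivative \<phi> (at x)) (at x)"
  using C_k_has_derivative[OF test_function_C_k] by blast

lemma test_function_directional_derivative:
  assumes "\<phi> \<in> test_functions \<Omega>"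
  shows "((\<lambda>t. \<phi> (x + t *\<^sub>R i)) has_real_derivative frechet_derivative \<phi> (at (x + t *\<^sub>R i)) i) (at t)"
proof -
  have "((\<lambda>t. x + t *\<^sub>R i) has_derivative (\<lambda>s. s *\<^sub>R i)) (at t)"
    by (auto intro!: derivative_eq_intros)
  from has_derivative_compose[OF this test_function_has_derivative[OF assms]]
  show ?thesis
    using linear_scale[OF has_derivative_linear[OF test_function_has_derivative[OF assms, of "x + t *\<^sub>R i"]]]
    by (simp add: has_field_derivative_def mult.commute[of _ "frechet_derivative _ _ _"])
qed

lemma test_function_derivative_outside:
  assumes "x \<notin> closure {x. \<phi> x \<noteq> 0}"
  shows "frechet_derivative \<phi> (at x) = (\<lambda>h. 0)"
proof -
  have "((\<lambda>x. 0) has_derivative (\<lambda>h. 0)) (at x)" by simp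
  then have "(\<phi> has_derivative (\<lambda>h. 0)) (at x)"
    by (rule has_derivative_transform_within_open[of _ _ _ _ "- closure {x. \<phi> x \<noteq> 0}"])
       (use assms closure_subset[of "{x. \<phi> x \<noteq> 0}"] in auto)
  from frechet_derivative_at[OF this] show ?thesis by simp
qed

text \<open>The derivative is the limit of difference quotients, each of which has integral zero by
  translation invariance of Lebesgue measure; dominated convergence does the rest.\<close>

lemma integral_test_function_derivative:
  fixes \<phi> :: "'a::euclidean_space \<Rightarrow> real"
  assumes \<phi>: "\<phi> \<in> test_functions \<Omega>" and i: "i \<in> Basis"
  shows "(LINT x|lborel. frechet_derivative \<phi> (at x) i) = 0"
proof -
  define \<psi> where "\<psi> x = frechet_derivative \<phi> (at x) i" for x
  define K where "K = closure {x. \<phi> x \<noteq> 0}"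
  have K: "compact K" using \<phi> by (simp add: test_functions_def K_def)
  have cont: "continuous_on UNIV \<phi>" "continuous_on UNIV \<psi>"
    using test_function_continuous[OF \<phi>] i by (auto simp: \<psi>_def[abs_def])
  have [measurable]: "\<phi> \<in> borel_measurable borel" "\<psi> \<in> borel_measurable borel"
    using cont by (auto intro: borel_measurable_continuous_onI)
  have \<phi>0: "\<phi> x = 0" if "x \<notin> K" for x using that closure_subset by (force simp: K_def)
  have \<psi>0: "\<psi> x = 0" if "x \<notin> K" for x
    using test_function_derivative_outside[of x \<phi>] that by (simp add: K_def \<psi>_def)
  have int\<phi>: "integrable lborel \<phi>"
  proof -
    have "integrable lborel (\<lambda>x. indicator K x *\<^sub>R \<phi> x)"
      by (intro borel_integrable_compact K continuous_on_subset[OF cont(1)]) auto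
    also have "(\<lambda>x. indicator K x *\<^sub>R \<phi> x) = \<phi>" by (intro ext) (use \<phi>0 in \<open>auto simp: indicator_def\<close>)
    finally show ?thesis .
  qed
  obtain B where B: "\<And>x. x \<in> K \<Longrightarrow> \<bar>\<psi> x\<bar> \<le> B"
    using compact_imp_bounded[OF compact_continuous_image[OF continuous_on_subset[OF cont(2)] K]]
    by (auto simp: bounded_iff)
  have B': "\<bar>\<psi> x\<bar> \<le> \<bar>B\<bar>" for x using B[of x] \<psi>0[of x] by (cases "x \<in> K") auto
  obtain R where R: "\<And>x. x \<in> K \<Longrightarrow> norm x \<le> R" using compact_imp_bounded[OF K] by (auto simp: bounded_iff)
  define d where "d n x = real (Suc n) * (\<phi> (inverse (real (Suc n)) *\<^sub>R i + x) - \<phi> x)" for n x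
  have "(\<lambda>n. LINT x|lborel. d n x) \<longlonglongrightarrow> (LINT x|lborel. \<psi> x)"
  proof (rule integral_dominated_convergence)
    show "integrable lborel (\<lambda>x. indicator (cball 0 (R + 1)) x *\<^sub>R \<bar>B\<bar> :: real)"
      by (rule borel_integrable_compact) auto
    show "AE x in lborel. (\<lambda>n. d n x) \<longlonglongrightarrow> \<psi> x"
    proof (rule AE_I2)
      fix x
      have "((\<lambda>t. \<phi> (x + t *\<^sub>R i)) has_real_derivative \<psi> x) (at 0)"
        using test_function_directional_derivative[OF \<phi>, of x i 0] by (simp add: \<psi>_def)
      then have "((\<lambda>h. (\<phi> (x + h *\<^sub>R i) - \<phi> x) / h) \<longlongrightarrow> \<psi> x) (at 0)"
        by (simp add: DERIV_def)
      moreover have "filterlim (\<lambda>n. inverse (real (Suc n))) (at 0) sequentially"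
        using LIMSEQ_inverse_real_of_nat by (simp add: filterlim_at)
      ultimately have "(\<lambda>n. (\<phi> (x + inverse (real (Suc n)) *\<^sub>R i) - \<phi> x) / inverse (real (Suc n))) \<longlonglongrightarrow> \<psi> x"
        by (rule filterlim_compose)
      then show "(\<lambda>n. d n x) \<longlonglongrightarrow> \<psi> x" by (simp add: d_def add.commute mult.commute divide_inverse)
    qed
    \<comment> \<open>Steps have length at most 1. Within radius \<open>R + 1\<close> the mean value
      theorem gives the bound on the derivative; beyond it both points of the quotient miss the
      support.\<close>
    show "AE x in lborel. norm (d n x) \<le> indicator (cball 0 (R + 1)) x *\<^sub>R \<bar>B\<bar>" for n
    proof (rule AE_I2)
      fix x
      define t where "t = inverse (real (Suc n))"
      have t: "0 < t" "t \<le> 1" by (auto simp: t_def field_simps)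
      show "norm (d n x) \<le> indicator (cball 0 (R + 1)) x *\<^sub>R \<bar>B\<bar>"
      proof (cases "norm x \<le> R + 1")
        case True
        obtain s where "\<phi> (x + t *\<^sub>R i) - \<phi> (x + 0 *\<^sub>R i) = (t - 0) * \<psi> (x + s *\<^sub>R i)"
          using MVT2[OF t(1), of "\<lambda>t. \<phi> (x + t *\<^sub>R i)" "\<lambda>t. \<psi> (x + t *\<^sub>R i)"]
            test_function_directional_derivative[OF \<phi>] by (auto simp: \<psi>_def)
        then have "d n x = \<psi> (x + s *\<^sub>R i)"
          using t by (simp add: d_def t_def add.commute)
        then show ?thesis using True B' by simp
      next
        case False
        have "norm (t *\<^sub>R i + x) \<ge> norm x - norm (t *\<^sub>R i)" by (metis add.commute norm_diff_ineq)
        moreover have "norm (t *\<^sub>R i) \<le> 1" using t i by simp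
        ultimately have "t *\<^sub>R i + x \<notin> K" "x \<notin> K" using False R by force+
        then show ?thesis using \<phi>0 False by (simp add: d_def t_def)
      qed
    qed
  qed (auto simp: d_def)
  moreover have "(LINT x|lborel. d n x) = 0" for n
  proof -
    define c where "c = inverse (real (Suc n)) *\<^sub>R i"
    have "integrable (distr lborel borel ((+) c)) \<phi>" using int\<phi> by (simp add: lborel_distr_plus)
    then have int: "integrable lborel (\<lambda>x. \<phi> (c + x))" by (subst (asm) integrable_distr_eq) auto
    have "(LINT x|lborel. \<phi> (c + x)) = (LINT x|distr lborel borel ((+) c). \<phi> x)"
      by (subst integral_distr) auto
    also have "\<dots> = (LINT x|lborel. \<phi> x)" by (simp add: lborel_distr_plus)
    finally show ?thesis using int int\<phi> by (simp add: d_def c_def)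
  qed
  ultimately show ?thesis by (simp add: \<psi>_def LIMSEQ_const_iff)
qed

section \<open>Weak gradients on a bounded open set\<close>

lemma l2_component:
  fixes g :: "'b \<Rightarrow> 'c::euclidean_space"
  assumes "g \<in> l2_set N" shows "(\<lambda>x. g x \<bullet> i) \<in> l2_set N"
proof -
  note [measurable] = l2_measurable[OF assms]
  have "\<bar>g x \<bullet> i\<bar> \<le> norm i * norm (g x)" for x
    using Cauchy_Schwarz_ineq2[of "g x" i] by (simp add: mult.commute)
  then show ?thesis
    by (intro l2_bound[OF l2_scaleR[OF assms, of "norm i"]]) (auto intro!: AE_I2)
qed

lemma l2_mult_integrable:
  fixes f g :: "'b \<Rightarrow> real"
  shows "f \<in> l2_set N \<Longrightarrow> g \<in> l2_set N \<Longrightarrow> integrable N (\<lambda>x. f x * g x)"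
  using l2_inner_integrable[of f N g] by simp

locale bounded_open =
  fixes \<Omega> :: "'a::euclidean_space set"
  assumes open_\<Omega>: "open \<Omega>" and bounded_\<Omega>: "bounded \<Omega>"
begin

abbreviation M :: "'a measure" where "M \<equiv> lebesgue_on \<Omega>"

lemma \<Omega>_lebesgue [measurable]: "\<Omega> \<in> sets lebesgue"
  using open_\<Omega> by (simp add: borel_open sets_completionI_sets)

sublocale finite_measure M
  by (rule finite_measure_lebesgue_on) (simp add: bounded_set_imp_lmeasurable bounded_\<Omega>)

lemma space_M [simp]: "space M = \<Omega>" by simp

lemma continuous_measurable_M: "continuous_on \<Omega> f \<Longrightarrow> f \<in> borel_measurable M"
  by (rule continuous_imp_measurable_on_sets_lebesgue) simp_all

lemma compact_closure_\<Omega>: "compact (closure \<Omega>)"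
  using bounded_\<Omega> by (simp add: compact_closure)

lemma continuous_on_closure_bounded:
  fixes f :: "'a \<Rightarrow> 'b::real_normed_vector"
  assumes "continuous_on (closure \<Omega>) f"
  obtains B where "B \<ge> 0" "\<And>x. x \<in> closure \<Omega> \<Longrightarrow> norm (f x) \<le> B"
proof -
  obtain B where B: "\<And>x. x \<in> closure \<Omega> \<Longrightarrow> norm (f x) \<le> B"
    using compact_imp_bounded[OF compact_continuous_image[OF assms compact_closure_\<Omega>]]
    by (auto simp: bounded_iff)
  show thesis by (rule that[of "\<bar>B\<bar>"]) (use B in force)+
qed

lemma continuous_l2:
  fixes f :: "'a \<Rightarrow> 'b::euclidean_space"
  assumes "continuous_on (closure \<Omega>) f"
  shows "f \<in> l2_set M"
proof -
  obtain B where "\<And>x. x \<in> closure \<Omega> \<Longrightarrow> norm (f x) \<le> B"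
    using continuous_on_closure_bounded[OF assms] by blast
  then show ?thesis
    using continuous_on_subset[OF assms closure_subset] closure_subset[of \<Omega>]
    by (intro l2_bounded[where B=B] continuous_measurable_M) auto
qed

lemma test_function_l2:
  assumes "\<phi> \<in> test_functions \<Omega>"
  shows "\<phi> \<in> l2_set M" and "i \<in> Basis \<Longrightarrow> (\<lambda>x. frechet_derivative \<phi> (at x) i) \<in> l2_set M"
  using test_function_continuous[OF assms]
  by (auto intro!: continuous_l2 intro: continuous_on_subset)

lemma sets_M_eq: "A \<in> sets M \<longleftrightarrow> A \<subseteq> \<Omega> \<and> A \<in> sets lebesgue"
  by (subst sets_restrict_space_iff) auto

text \<open>A Dynkin system argument with the open boxes as intersection-stable generator.
  Everything is cut down to one box \<open>box a b\<close> inside \<Omega>, whose own integral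
  vanishes; this is what makes the step to complements work.\<close>

lemma set_integral_borel_eq_0:
  fixes f :: "'a \<Rightarrow> real"
  assumes f: "integrable M f"
    and box0: "\<And>l u. box l u \<subseteq> \<Omega> \<Longrightarrow> (LINT x:box l u|M. f x) = 0"
    and ab: "box a b \<subseteq> \<Omega>" and A: "A \<in> sets borel"
  shows "(LINT x:A \<inter> box a b|M. f x) = 0"
proof -
  have int: "set_integrable M S f" if "S \<in> sets M" for S
    using f that unfolding set_integrable_def by (rule integrable_mult_indicator[rotated])
  have bM: "S \<inter> box a b \<in> sets M" if "S \<in> sets borel" for S
    using that ab by (auto simp: sets_M_eq intro!: sets_completionI_sets sets.Int)
  have "Int_stable (range (\<lambda>(a, b). box a b))"
    by (auto simp: Int_stable_def box_Int_box)
  moreover have "range (\<lambda>(a, b). box a b) \<subseteq> Pow (UNIV :: 'a set)" by auto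
  moreover have "A \<in> sigma_sets UNIV (range (\<lambda>(a, b). box a b))"
    using A unfolding borel_eq_box by simp
  ultimately show ?thesis
  proof (induction rule: sigma_sets_induct_disjoint)
    case (basic A)
    then obtain l u where A: "A = box l u" by auto
    obtain l' u' where *: "box l u \<inter> box a b = box l' u'" using box_Int_box by blast
    have "box l' u' \<subseteq> \<Omega>" using ab unfolding *[symmetric] by blast
    then show ?case unfolding A * by (rule box0)
  next
    case empty
    then show ?case by (simp add: set_lebesgue_integral_def)
  next
    case (compl A)
    then have A: "A \<in> sets borel" by (simp add: borel_eq_box)
    have "(LINT x:box a b|M. f x) = (LINT x:(A \<inter> box a b) \<union> ((UNIV - A) \<inter> box a b)|M. f x)"
      by (rule arg_cong[where f="\<lambda>S. LINT x:S|M. f x"]) auto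
    also have "\<dots> = (LINT x:A \<inter> box a b|M. f x) + (LINT x:(UNIV - A) \<inter> box a b|M. f x)"
      by (rule set_integral_Un) (use A in \<open>auto intro!: int bM\<close>)
    finally show ?case using box0[OF ab] compl.IH by simp
  next
    case (union F)
    then have F: "F i \<in> sets borel" for i by (auto simp: borel_eq_box subset_eq)
    have "(LINT x:(\<Union>i. F i \<inter> box a b)|M. f x) = (\<Sum>i. LINT x:F i \<inter> box a b|M. f x)"
    proof (rule lebesgue_integral_countable_add)
      show "set_integrable M (\<Union>i. F i \<inter> box a b) f"
        using F by (intro int sets.countable_UN) (auto intro: bM)
    qed (use F union(1) in \<open>auto intro: bM simp: disjoint_family_on_def\<close>)
    then show ?case using union.IH by simp
  qed
qed

text \<open>A Lebesgue set differs from a Borel set by a null set, so the integral of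
  \<open>f\<close> vanishes over every measurable part of a box. Taking the sets where
  \<open>f\<close> is positive or negative shows that \<open>f\<close> is zero almost everywhere on
  the box, and countably many boxes cover \<Omega>.\<close>

lemma AE_eq_0_of_boxes:
  fixes f :: "'a \<Rightarrow> real"
  assumes f: "integrable M f"
    and box0: "\<And>l u. box l u \<subseteq> \<Omega> \<Longrightarrow> (LINT x:box l u|M. f x) = 0"
  shows "AE x in M. f x = 0"
proof -
  have [measurable]: "f \<in> borel_measurable M" using f by auto
  have ab0: "AE x in M. x \<in> box a b \<longrightarrow> f x = 0" if ab: "box a b \<subseteq> \<Omega>" for a b
  proof -
    have *: "(LINT x:A \<inter> box a b|M. f x) = 0" if A: "A \<in> sets M" for A
    proof -
      have "A \<in> sets lebesgue" using A by (simp add: sets_M_eq)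
      then obtain S N N' where A_eq: "A = S \<union> N" and N: "N \<subseteq> N'" and N': "N' \<in> null_sets lborel"
        and S: "S \<in> sets lborel" by (rule sets_completionE)
      have Sb: "S \<inter> box a b \<in> sets M"
        using S ab by (auto simp: sets_M_eq intro!: sets_completionI_sets sets.Int)
      have Ab: "A \<inter> box a b \<in> sets M"
        using A ab by (auto simp: sets_M_eq)
      have N'0: "N' \<in> null_sets lebesgue" using N' by (rule null_sets_completionI)
      have "(A \<inter> box a b - S \<inter> box a b) \<union> (S \<inter> box a b - A \<inter> box a b) \<in> null_sets lebesgue"
        by (rule null_sets_completion_subset[OF _ N'0]) (use N A_eq in auto)
      then have "(A \<inter> box a b - S \<inter> box a b) \<union> (S \<inter> box a b - A \<inter> box a b) \<in> null_sets M"
        using ab by (subst null_sets_restrict_space) auto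
      then have "(LINT x:A \<inter> box a b|M. f x) = (LINT x:S \<inter> box a b|M. f x)"
        by (rule set_integral_null_delta[OF f Ab Sb])
      then show ?thesis using set_integral_borel_eq_0[OF f box0 ab, of S] S by simp
    qed
    have sgn: "AE x in M. x \<in> box a b \<longrightarrow> s * f x \<le> 0" if s: "s \<in> {1, -1}" for s :: real
    proof -
      define A where "A = {x \<in> space M. s * f x > 0}"
      have A: "A \<in> sets M" unfolding A_def by measurable
      have Ab: "A \<inter> box a b \<in> sets M" using A ab by (auto simp: sets_M_eq)
      have int: "integrable M (\<lambda>x. indicator (A \<inter> box a b) x *\<^sub>R (s * f x))"
        using f by (intro integrable_mult_indicator Ab) simp
      have "(LINT x|M. indicator (A \<inter> box a b) x *\<^sub>R (s * f x)) = s * (LINT x:A \<inter> box a b|M. f x)"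
        by (simp add: set_lebesgue_integral_def mult.left_commute flip: integral_mult_right_zero)
      then have "(LINT x|M. indicator (A \<inter> box a b) x *\<^sub>R (s * f x)) = 0" using *[OF A] by simp
      then have "AE x in M. indicator (A \<inter> box a b) x *\<^sub>R (s * f x) = 0"
        by (subst (asm) integral_nonneg_eq_0_iff_AE[OF int])
           (auto intro!: AE_I2 simp: indicator_def A_def)
      then show ?thesis by (rule AE_mp) (auto intro!: AE_I2 simp: A_def indicator_def)
    qed
    show ?thesis
      using sgn[of 1, simplified] sgn[of "-1", simplified] by eventually_elim force
  qed
  \<comment> \<open>Boxes with rational corners: countably many of them exhaust the open set, so the
    exceptional null sets can be united.\<close>
  define a' where "a' f = (\<Sum>(i::'a)\<in>Basis. fst (f i) *\<^sub>R i)" for f :: "'a \<Rightarrow> real \<times> real"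
  define b' where "b' f = (\<Sum>(i::'a)\<in>Basis. snd (f i) *\<^sub>R i)" for f :: "'a \<Rightarrow> real \<times> real"
  define I where "I = {f\<in>Basis \<rightarrow>\<^sub>E \<rat> \<times> \<rat>. box (a' f) (b' f) \<subseteq> \<Omega>}"
  have "countable (Basis \<rightarrow>\<^sub>E \<rat> \<times> \<rat> :: ('a \<Rightarrow> real \<times> real) set)"
    by (intro countable_PiE finite_Basis countable_SIGMA countable_rat)
  moreover have "I \<subseteq> Basis \<rightarrow>\<^sub>E \<rat> \<times> \<rat>" unfolding I_def by (rule Collect_restrict)
  ultimately have "countable I" by (rule countable_subset[rotated])
  moreover have "AE x in M. x \<in> box (a' i) (b' i) \<longrightarrow> f x = 0" if "i \<in> I" for i
    using that by (intro ab0) (simp add: I_def)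
  ultimately have *: "AE x in M. \<forall>i\<in>I. x \<in> box (a' i) (b' i) \<longrightarrow> f x = 0"
    by (subst AE_ball_countable) blast+
  have U: "\<Omega> = (\<Union>f\<in>I. box (a' f) (b' f))"
    unfolding I_def a'_def b'_def by (rule open_UNION_box[OF open_\<Omega>])
  show ?thesis
  proof (rule AE_mp[OF *], rule AE_I2, rule impI)
    fix x assume "x \<in> space M" and 0: "\<forall>i\<in>I. x \<in> box (a' i) (b' i) \<longrightarrow> f x = 0"
    then have "x \<in> (\<Union>f\<in>I. box (a' f) (b' f))" unfolding U[symmetric] by simp
    with 0 show "f x = 0" by blast
  qed
qed

text \<open>The cutoffs \<open>box_bump l u m\<close> are test functions with values between 0 and 1
  that converge to the indicator of the box; \<open>\<bar>f\<bar>\<close> dominates. The integral of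
  \<open>f\<close> over each box inside \<Omega> is therefore zero.\<close>

lemma fundamental_lemma:
  fixes f :: "'a \<Rightarrow> real"
  assumes f: "f \<in> l2_set M" and 0: "\<And>\<phi>. \<phi> \<in> test_functions \<Omega> \<Longrightarrow> (LINT x|M. f x * \<phi> x) = 0"
  shows "AE x in M. f x = 0"
proof (rule AE_eq_0_of_boxes)
  show int: "integrable M f" by (rule l2_imp_integrable[OF f])
  fix l u :: 'a assume lu: "box l u \<subseteq> \<Omega>"
  have [measurable]: "f \<in> borel_measurable M" using f by (rule l2_measurable)
  have [measurable]: "box_bump l u m \<in> borel_measurable M" for m
    by (rule l2_measurable[OF test_function_l2(1)[OF box_bump_test_function[OF lu]]])
  have [measurable]: "box l u \<in> sets M" using lu by (auto simp: sets_M_eq)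
  have "(\<lambda>m. LINT x|M. f x * box_bump l u m x) \<longlonglongrightarrow> (LINT x|M. f x * indicator (box l u) x)"
  proof (rule integral_dominated_convergence)
    show "integrable M (\<lambda>x. norm (f x))" using int by simp
    show "AE x in M. (\<lambda>m. f x * box_bump l u m x) \<longlonglongrightarrow> f x * indicator (box l u) x"
      by (intro AE_I2 tendsto_intros box_bump_tendsto)
    show "AE x in M. norm (f x * box_bump l u m x) \<le> norm (f x)" for m
      using box_bump_bounds[of l u m] by (intro AE_I2) (auto simp: abs_mult intro!: mult_left_le)
  qed measurable
  then have "(LINT x|M. f x * indicator (box l u) x) = 0"
    using 0[OF box_bump_test_function[OF lu]] by (simp add: LIMSEQ_const_iff)
  then show "(LINT x:box l u|M. f x) = 0"
    by (simp add: set_lebesgue_integral_def mult.commute)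
qed

section \<open>Uniqueness, linearity and closedness of weak gradients\<close>

lemma weak_gradient_unique:
  assumes g: "g \<in> l2_set M" "is_weak_gradient \<Omega> v g" and h: "h \<in> l2_set M" "is_weak_gradient \<Omega> v h"
  shows "AE x in M. g x = h x"
proof -
  have "AE x in M. (g x - h x) \<bullet> i = 0" if i: "i \<in> Basis" for i
  proof (rule fundamental_lemma)
    show "(\<lambda>x. (g x - h x) \<bullet> i) \<in> l2_set M" by (intro l2_component l2_diff g h)
    fix \<phi> assume \<phi>: "\<phi> \<in> test_functions \<Omega>"
    have "(LINT x|M. (g x - h x) \<bullet> i * \<phi> x) = (LINT x|M. (g x \<bullet> i) * \<phi> x) - (LINT x|M. (h x \<bullet> i) * \<phi> x)"
      using g h \<phi> by (simp add: inner_diff_left left_diff_distrib l2_mult_integrable l2_component test_function_l2)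
    also have "\<dots> = 0"
      using g(2) h(2) \<phi> i unfolding is_weak_gradient_def by fastforce
    finally show "(LINT x|M. (g x - h x) \<bullet> i * \<phi> x) = 0" .
  qed
  then have "AE x in M. \<forall>i\<in>Basis. (g x - h x) \<bullet> i = 0"
    by (intro AE_finite_allI) auto
  then show ?thesis
    by eventually_elim (auto intro: euclidean_eqI simp: inner_diff_left)
qed

lemma weak_gradient_add:
  assumes "v \<in> l2_set M" "w \<in> l2_set M" "g \<in> l2_set M" "h \<in> l2_set M"
    and "is_weak_gradient \<Omega> v g" "is_weak_gradient \<Omega> w h"
  shows "is_weak_gradient \<Omega> (\<lambda>x. v x + w x) (\<lambda>x. g x + h x)"
  using assms unfolding is_weak_gradient_def
  by (simp add: inner_add_left distrib_right l2_mult_integrable l2_component test_function_l2)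

lemma weak_gradient_cmult:
  assumes "is_weak_gradient \<Omega> v g"
  shows "is_weak_gradient \<Omega> (\<lambda>x. t * v x) (\<lambda>x. t *\<^sub>R g x)"
  using assms unfolding is_weak_gradient_def by (simp add: mult.assoc)

lemma weak_gradient_const: "is_weak_gradient \<Omega> (\<lambda>x. c) (\<lambda>x. 0)"
proof -
  have "(LINT x|M. frechet_derivative \<phi> (at x) i) = 0"
    if \<phi>: "\<phi> \<in> test_functions \<Omega>" and i: "i \<in> Basis" for \<phi> i
  proof -
    \<comment> \<open>The derivative of a test function vanishes off \<Omega>, so its integral over
      \<Omega> is the one over the whole space.\<close>
    have 0: "frechet_derivative \<phi> (at x) i = 0" if "x \<notin> \<Omega>" for x
    proof -
      have "x \<notin> closure {x. \<phi> x \<noteq> 0}" using \<phi> that unfolding test_functions_def by blast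
      from test_function_derivative_outside[OF this] show ?thesis by simp
    qed
    have "(LINT x|M. frechet_derivative \<phi> (at x) i) = (LINT x|lebesgue. indicator \<Omega> x *\<^sub>R frechet_derivative \<phi> (at x) i)"
      by (rule integral_restrict_space) simp
    also have "\<dots> = (LINT x|lebesgue. frechet_derivative \<phi> (at x) i)"
      by (rule arg_cong[where f="integral\<^sup>L lebesgue"], rule ext) (use 0 in \<open>auto simp: indicator_def\<close>)
    also have "\<dots> = (LINT x|lborel. frechet_derivative \<phi> (at x) i)"
      using test_function_continuous(2)[OF \<phi> i]
      by (intro integral_completion) (auto intro: borel_measurable_continuous_onI)
    also have "\<dots> = 0" by (rule integral_test_function_derivative[OF \<phi> i])
    finally show ?thesis .
  qed
  then show ?thesis by (simp add: is_weak_gradient_def)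
qed

text \<open>The weak gradient is a closed operator: both sides of its defining identity are
  continuous in the square norm once the test function is fixed. Completeness of the Sobolev space
  rests on this.\<close>

lemma weak_gradient_limit:
  assumes v: "v \<in> l2_set M" "\<And>m. s m \<in> l2_set M" "(\<lambda>m. l2_norm M (\<lambda>x. s m x - v x)) \<longlonglongrightarrow> 0"
    and g: "g \<in> l2_set M" "\<And>m. h m \<in> l2_set M" "(\<lambda>m. l2_norm M (\<lambda>x. h m x - g x)) \<longlonglongrightarrow> 0"
    and wg: "\<And>m. is_weak_gradient \<Omega> (s m) (h m)"
  shows "is_weak_gradient \<Omega> v g"
  unfolding is_weak_gradient_def
proof (intro ballI)
  fix \<phi> and i :: 'a assume \<phi>: "\<phi> \<in> test_functions \<Omega>" and i: "i \<in> Basis"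
  have lim: "(\<lambda>m. LINT x|M. a m x * f x) \<longlonglongrightarrow> (LINT x|M. b x * f x)"
    if a: "\<And>m. a m \<in> l2_set M" and b: "b \<in> l2_set M" and f: "f \<in> l2_set M"
      and l: "(\<lambda>m. l2_norm M (\<lambda>x. a m x - b x)) \<longlonglongrightarrow> 0" for a :: "nat \<Rightarrow> 'a \<Rightarrow> real" and b f
  proof -
    have "(\<lambda>m. (LINT x|M. a m x * f x) - (LINT x|M. b x * f x)) \<longlonglongrightarrow> 0"
    proof (rule Lim_null_comparison[of _ "\<lambda>m. l2_norm M (\<lambda>x. a m x - b x) * l2_norm M f"])
      have "(LINT x|M. a m x * f x) - (LINT x|M. b x * f x) = (LINT x|M. (a m x - b x) \<bullet> f x)" for m
        using a b f by (simp add: left_diff_distrib l2_mult_integrable)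
      then show "\<forall>\<^sub>F m in sequentially. norm ((LINT x|M. a m x * f x) - (LINT x|M. b x * f x)) \<le>
          l2_norm M (\<lambda>x. a m x - b x) * l2_norm M f"
        using l2_inner_bound[OF l2_diff[OF a b] f] by simp
      show "(\<lambda>m. l2_norm M (\<lambda>x. a m x - b x) * l2_norm M f) \<longlonglongrightarrow> 0"
        using tendsto_mult_right[OF l, of "l2_norm M f"] by simp
    qed
    then show ?thesis by (rule LIM_zero_cancel)
  qed
  have "(\<lambda>m. l2_norm M (\<lambda>x. h m x \<bullet> i - g x \<bullet> i)) \<longlonglongrightarrow> 0"
  proof (rule Lim_null_comparison[OF _ g(3)])
    have "l2_norm M (\<lambda>x. h m x \<bullet> i - g x \<bullet> i) \<le> l2_norm M (\<lambda>x. h m x - g x)" for m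
      using Basis_le_norm[OF i] g
      by (intro l2_norm_mono l2_diff l2_component AE_I2) (auto simp flip: inner_diff_left)
    then show "\<forall>\<^sub>F m in sequentially. norm (l2_norm M (\<lambda>x. h m x \<bullet> i - g x \<bullet> i)) \<le> l2_norm M (\<lambda>x. h m x - g x)"
      by simp
  qed
  then have 2: "(\<lambda>m. - (LINT x|M. (h m x \<bullet> i) * \<phi> x)) \<longlonglongrightarrow> - (LINT x|M. (g x \<bullet> i) * \<phi> x)"
    using g \<phi> by (intro tendsto_minus lim l2_component test_function_l2)
  have "(\<lambda>m. LINT x|M. s m x * frechet_derivative \<phi> (at x) i) \<longlonglongrightarrow> (LINT x|M. v x * frechet_derivative \<phi> (at x) i)"
    by (rule lim[OF v(2,1) test_function_l2(2)[OF \<phi> i] v(3)])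
  moreover have "(LINT x|M. s m x * frechet_derivative \<phi> (at x) i) = - (LINT x|M. (h m x \<bullet> i) * \<phi> x)" for m
    using wg[of m] \<phi> i by (auto simp: is_weak_gradient_def)
  ultimately have "(\<lambda>m. - (LINT x|M. (h m x \<bullet> i) * \<phi> x)) \<longlonglongrightarrow> (LINT x|M. v x * frechet_derivative \<phi> (at x) i)"
    by simp
  from LIMSEQ_unique[OF this 2]
  show "(LINT x|M. v x * frechet_derivative \<phi> (at x) i) = - (LINT x|M. (g x \<bullet> i) * \<phi> x)" .
qed

lemma H1_weak_grad:
  assumes "v \<in> H1 \<Omega>"
  shows "v \<in> l2_set M" and "weak_grad \<Omega> v \<in> l2_set M" and "is_weak_gradient \<Omega> v (weak_grad \<Omega> v)"
proof -
  show "v \<in> l2_set M" using assms by (simp add: H1_def L2_eq_l2_set)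
  have "\<exists>g. g \<in> L2 \<Omega> \<and> is_weak_gradient \<Omega> v g" using assms by (auto simp: H1_def)
  from someI_ex[OF this] show "weak_grad \<Omega> v \<in> l2_set M" "is_weak_gradient \<Omega> v (weak_grad \<Omega> v)"
    by (auto simp: weak_grad_def L2_eq_l2_set)
qed

text \<open>Every explicit weak gradient agrees almost everywhere with the chosen one, so identities
  for \<open>weak_grad\<close> are obtained by exhibiting a weak gradient.\<close>

lemma H1_I:
  assumes "v \<in> l2_set M" "g \<in> l2_set M" "is_weak_gradient \<Omega> v g"
  shows "v \<in> H1 \<Omega>" and "AE x in M. weak_grad \<Omega> v x = g x"
proof -
  show v: "v \<in> H1 \<Omega>" using assms by (auto simp: H1_def L2_eq_l2_set)
  show "AE x in M. weak_grad \<Omega> v x = g x"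
    using H1_weak_grad[OF v] assms by (intro weak_gradient_unique)
qed

lemma H1_add:
  assumes "v \<in> H1 \<Omega>" "w \<in> H1 \<Omega>"
  shows "(\<lambda>x. v x + w x) \<in> H1 \<Omega>"
    and "AE x in M. weak_grad \<Omega> (\<lambda>x. v x + w x) x = weak_grad \<Omega> v x + weak_grad \<Omega> w x"
  using H1_I[OF l2_add l2_add weak_gradient_add] H1_weak_grad[OF assms(1)] H1_weak_grad[OF assms(2)] by auto

lemma H1_cmult:
  assumes "v \<in> H1 \<Omega>"
  shows "(\<lambda>x. t * v x) \<in> H1 \<Omega>" and "AE x in M. weak_grad \<Omega> (\<lambda>x. t * v x) x = t *\<^sub>R weak_grad \<Omega> v x"
  using H1_I[OF _ l2_scaleR[OF H1_weak_grad(2)[OF assms]] weak_gradient_cmult[OF H1_weak_grad(3)[OF assms]]]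
    l2_scaleR[OF H1_weak_grad(1)[OF assms], of t] by auto

lemma H1_const:
  shows "(\<lambda>x. c) \<in> H1 \<Omega>" and "AE x in M. weak_grad \<Omega> (\<lambda>x. c) x = 0"
  using H1_I[OF _ l2_zero weak_gradient_const] l2_bounded[of "\<lambda>x. c" "\<bar>c\<bar>"] by auto

end

section \<open>Coercivity from the constants \<open>\<beta>\<^sub>p\<close>\<close>

text \<open>The derivative of \<bar>t\<bar>^(r+2) / (r+2). With \<open>r = 2 / (q - 1)\<close> one
  has r + 2 = 2q/(q-1), so \<open>v + k\<close> lies in the constraint set of \<open>q\<close> when,
  formally, \<open>k\<close> is a critical point of the integral of \<bar>v + k\<bar>^(r+2).\<close>

definition odd_power :: "real \<Rightarrow> real \<Rightarrow> real" where
  "odd_power r t = \<bar>t\<bar> powr r * t"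

lemma odd_power_uminus: "odd_power r (- t) = - odd_power r t"
  by (simp add: odd_power_def)

lemma odd_power_mono:
  assumes "r > 0" "s \<le> t" shows "odd_power r s \<le> odd_power r t"
proof -
  have pos: "odd_power r s \<le> odd_power r t" if "0 \<le> s" "s \<le> t" for s t
    unfolding odd_power_def using that assms by (intro mult_mono powr_mono2) auto
  consider "0 \<le> s" | "t \<le> 0" | "s \<le> 0" "0 \<le> t" by linarith
  then show ?thesis
  proof cases
    case 2
    then show ?thesis using pos[of "- t" "- s"] assms by (simp add: odd_power_uminus)
  next
    case 3
    have "odd_power r s \<le> 0" "0 \<le> odd_power r t"
      using 3 by (auto simp: odd_power_def mult_nonneg_nonpos)
    then show ?thesis by linarith
  qed (use assms pos in auto)
qed

lemma odd_power_continuous: "r > 0 \<Longrightarrow> continuous_on UNIV (odd_power r)"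
  unfolding odd_power_def[abs_def] by (intro continuous_intros continuous_on_powr') auto

lemma odd_power_measurable: "r > 0 \<Longrightarrow> odd_power r \<in> borel_measurable borel"
  by (intro borel_measurable_continuous_onI odd_power_continuous)

lemma odd_power_bound: "\<bar>odd_power r t\<bar> \<le> 1 + \<bar>t\<bar> powr (r + 2)" if "r > 0"
proof (cases "\<bar>t\<bar> \<le> 1")
  case True
  then have "\<bar>t\<bar> powr r * \<bar>t\<bar> \<le> 1 * 1" using that by (intro mult_mono powr_le1) auto
  also have "\<dots> \<le> 1 + \<bar>t\<bar> powr (r + 2)" by simp
  finally show ?thesis by (simp add: odd_power_def abs_mult)
next
  case False
  then have "\<bar>t\<bar> powr r * \<bar>t\<bar> = \<bar>t\<bar> powr (r + 1)" by (simp add: powr_add)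
  also have "\<dots> \<le> \<bar>t\<bar> powr (r + 2)" using False by (intro powr_mono) auto
  finally show ?thesis by (simp add: odd_power_def abs_mult)
qed

text \<open>\<open>D\<close> is the Dirichlet integral, \<open>Q\<close> the squared norm whose
  ratio to \<open>D\<close> is controlled by \<beta>, \<open>Ib\<close> the weighted and
  \<open>I2\<close> the plain square integral. A fraction \<open>s / \<beta>\<close> of
  \<open>D\<close> absorbs \<open>Ib\<close>. The minimum splits \<open>D\<close> into halves: one
  pays for the gradient, the other, through \<open>\<beta> * Q \<le> D\<close>, for
  \<open>I2\<close>.\<close>

lemma scalar_coercive_aux:
  fixes Q D s \<beta> m I2 Ib :: real
  assumes "0 \<le> s" "s < \<beta>" "0 < m" "0 \<le> Q" "\<beta> * Q \<le> D" "Ib \<le> s * Q" "I2 \<le> m * Q"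
  shows "(1 - s / \<beta>) * min (1/2) (\<beta> / (2 * m)) * (D + I2) \<le> D - Ib"
proof -
  have \<beta>: "\<beta> > 0" using assms by simp
  have "0 \<le> D" using assms \<beta> by (meson mult_nonneg_nonneg less_imp_le order_trans)
  have "Q \<le> D / \<beta>" using assms \<beta> by (simp add: le_divide_eq mult.commute)
  have "s * Q \<le> s * (D / \<beta>)" using assms \<open>Q \<le> D / \<beta>\<close> by (intro mult_left_mono) auto
  then have 1: "(1 - s / \<beta>) * D \<le> D - Ib" using assms by (simp add: algebra_simps)
  define w where "w = min (1/2) (\<beta> / (2 * m))"
  have w: "w \<ge> 0" using assms \<beta> by (simp add: w_def)
  have "w * D \<le> 1/2 * D" using \<open>0 \<le> D\<close> by (intro mult_right_mono) (auto simp: w_def)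
  moreover have "w * I2 \<le> w * (m * Q)" using assms w by (intro mult_left_mono) auto
  moreover have "w * (m * Q) \<le> \<beta> / (2 * m) * (m * Q)" using assms by (intro mult_right_mono) (auto simp: w_def)
  moreover have "\<beta> / (2 * m) * (m * Q) = \<beta> * Q / 2" using assms by simp
  ultimately have "w * (D + I2) \<le> D" using assms by (simp add: distrib_left)
  then have "(1 - s / \<beta>) * (w * (D + I2)) \<le> (1 - s / \<beta>) * D"
    using assms \<beta> by (intro mult_left_mono) auto
  then show ?thesis using 1 unfolding w_def by (simp add: mult.assoc)
qed

locale bounded_domain = bounded_open +
  assumes nonempty_\<Omega>: "\<Omega> \<noteq> {}"
begin

lemma measure_\<Omega>_pos: "measure M \<Omega> > 0"
proof -
  have "\<not> negligible \<Omega>" using open_not_negligible[OF open_\<Omega> nonempty_\<Omega>] .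
  then have "emeasure lebesgue \<Omega> \<noteq> 0"
    by (simp add: negligible_iff_null_sets null_sets_def)
  then have "emeasure M \<Omega> \<noteq> 0" by (simp add: emeasure_restrict_space)
  then show ?thesis by (simp add: emeasure_eq_measure measure_nonneg less_le)
qed

lemma I_fun_nonneg: "I_fun \<Omega> p v \<ge> 0"
  unfolding I_fun_def Let_def by (auto intro!: divide_nonneg_nonneg integral_nonneg_AE)

text \<open>Nonnegativity of the quotient provides the lower bound without which a real infimum says
  nothing about its members.\<close>

lemma \<beta>_le_I_fun:
  assumes "v \<in> X_space \<Omega> p" "\<not> (AE x in M. v x = 0)"
  shows "\<beta> \<Omega> p \<le> I_fun \<Omega> p v"
  unfolding \<beta>_def using assms
  by (intro cINF_lower bdd_belowI[of _ 0]) (auto simp: I_fun_nonneg)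

text \<open>By the junk value of the integral of a non-integrable function, positivity of \<open>\<beta>\<^sub>q\<close>
  already contains the Sobolev embedding: a function violating it would belong to \<open>X\<^sub>q\<close> up to a
  constant and have \<open>I\<^sub>q\<close> equal to zero.\<close>

context
  fixes q r :: real
  assumes q: "q > 1" and r: "r = 2 / (q - 1)" and \<beta>_pos: "\<beta> \<Omega> (ereal q) > 0"
begin

lemma r_pos: "r > 0" and r_2: "2 * q / (q - 1) = r + 2"
  using q by (auto simp: r field_simps)

lemma X_space_iff:
  "v \<in> X_space \<Omega> (ereal q) \<longleftrightarrow> v \<in> H1 \<Omega> \<and> (LINT x|M. odd_power r (v x)) = 0"
  by (simp add: X_space_def odd_power_def r)

lemma X_space_Sobolev:
  assumes v: "v \<in> X_space \<Omega> (ereal q)"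
  shows "integrable M (\<lambda>x. \<bar>v x\<bar> powr (r + 2))"
    and "\<beta> \<Omega> (ereal q) * (LINT x|M. \<bar>v x\<bar> powr (r + 2)) powr ((q - 1) / q)
           \<le> (LINT x|M. (norm (weak_grad \<Omega> v x))\<^sup>2)"
proof -
  have "v \<in> H1 \<Omega>" using v by (simp add: X_space_iff)
  then have [measurable]: "v \<in> borel_measurable M" by (intro l2_measurable H1_weak_grad)
  have "integrable M (\<lambda>x. \<bar>v x\<bar> powr (r + 2)) \<and>
      \<beta> \<Omega> (ereal q) * (LINT x|M. \<bar>v x\<bar> powr (r + 2)) powr ((q - 1) / q)
           \<le> (LINT x|M. (norm (weak_grad \<Omega> v x))\<^sup>2)"
  proof (cases "AE x in M. v x = 0")
    case True
    then have 0: "AE x in M. \<bar>v x\<bar> powr (r + 2) = 0" by eventually_elim simp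
    then have "integrable M (\<lambda>x. \<bar>v x\<bar> powr (r + 2)) \<longleftrightarrow> integrable M (\<lambda>x. 0::real)"
      by (intro integrable_cong_AE) measurable
    moreover have "(LINT x|M. \<bar>v x\<bar> powr (r + 2)) = 0" using 0 by (rule integral_eq_zero_AE)
    ultimately show ?thesis by simp
  next
    case False
    define P where "P = (LINT x|M. \<bar>v x\<bar> powr (r + 2))"
    have le: "\<beta> \<Omega> (ereal q) \<le> (LINT x|M. (norm (weak_grad \<Omega> v x))\<^sup>2) / P powr ((q - 1) / q)"
      using \<beta>_le_I_fun[OF v False] by (simp add: I_fun_def r_2 P_def)
    \<comment> \<open>If the denominator were zero, the quotient would be zero by convention and
      could not dominate a positive number. Hence \<open>P\<close> is nonzero, and \<open>P\<close>
      is the integral of an integrable function.\<close>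
    with \<beta>_pos have "P powr ((q - 1) / q) \<noteq> 0" by auto
    then have "P \<noteq> 0" and pos: "P powr ((q - 1) / q) > 0" by auto
    then have "integrable M (\<lambda>x. \<bar>v x\<bar> powr (r + 2))"
      using not_integrable_integral_eq unfolding P_def by blast
    then show ?thesis using le pos by (simp add: pos_le_divide_eq P_def)
  qed
  then show "integrable M (\<lambda>x. \<bar>v x\<bar> powr (r + 2))"
    and "\<beta> \<Omega> (ereal q) * (LINT x|M. \<bar>v x\<bar> powr (r + 2)) powr ((q - 1) / q)
           \<le> (LINT x|M. (norm (weak_grad \<Omega> v x))\<^sup>2)" by auto
qed

text \<open>A non-integrable integrand has integral zero by default, which would put
  \<open>v\<close> into the constraint set. There \<bar>v\<bar>^(r+2) is integrable and dominates
  the odd power up to a constant: a contradiction.\<close>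

lemma H1_odd_power_integrable:
  assumes v: "v \<in> H1 \<Omega>"
  shows "integrable M (\<lambda>x. odd_power r (v x))"
proof (rule ccontr)
  assume not: "\<not> ?thesis"
  have [measurable]: "v \<in> borel_measurable M" using v by (intro l2_measurable H1_weak_grad)
  note [measurable] = odd_power_measurable[OF r_pos]
  have "v \<in> X_space \<Omega> (ereal q)"
    using v not_integrable_integral_eq[OF not] by (simp add: X_space_iff)
  from X_space_Sobolev(1)[OF this] have "integrable M (\<lambda>x. 1 + \<bar>v x\<bar> powr (r + 2))"
    by simp
  then have "integrable M (\<lambda>x. odd_power r (v x))"
    by (rule Bochner_Integration.integrable_bound)
       (use order_trans[OF odd_power_bound[OF r_pos] abs_ge_self] in auto)
  with not show False by simp
qed

lemma odd_power_shift_integrable: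
  "v \<in> H1 \<Omega> \<Longrightarrow> integrable M (\<lambda>x. odd_power r (v x + k))"
  by (intro H1_odd_power_integrable H1_add H1_const)

text \<open>The odd powers of \<open>v + m\<close> grow without bound as \<open>m\<close> increases.
  Truncated at 1 they converge to 1 and stay above the odd power of \<open>v\<close>, so dominated
  convergence makes the truncated integrals tend to the measure of \<Omega>, which is
  positive.\<close>

lemma ex_positive_shift:
  assumes v: "v \<in> H1 \<Omega>"
  shows "\<exists>k\<ge>0. (LINT x|M. odd_power r (v x + k)) > 0"
proof -
  have [measurable]: "v \<in> borel_measurable M" using v by (intro l2_measurable H1_weak_grad)
  note [measurable] = odd_power_measurable[OF r_pos]
  define g where "g m x = min (odd_power r (v x + real m)) 1" for m x
  have "(\<lambda>m. LINT x|M. g m x) \<longlonglongrightarrow> (LINT x|M. 1)"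
  proof (rule integral_dominated_convergence)
    show "integrable M (\<lambda>x. \<bar>odd_power r (v x)\<bar> + 1)"
      using H1_odd_power_integrable[OF v] by simp
    show "AE x in M. (\<lambda>m. g m x) \<longlonglongrightarrow> 1"
    proof (rule AE_I2)
      fix x
      have "g m x = 1" if "m \<ge> nat \<lceil>1 + \<bar>v x\<bar>\<rceil>" for m
      proof -
        have "v x + real m \<ge> 1" using that by linarith
        from odd_power_mono[OF r_pos this] show ?thesis by (simp add: g_def odd_power_def)
      qed
      then show "(\<lambda>m. g m x) \<longlonglongrightarrow> 1"
        by (intro tendsto_eventually eventually_sequentiallyI[of "nat \<lceil>1 + \<bar>v x\<bar>\<rceil>"])
    qed
    show "AE x in M. norm (g m x) \<le> \<bar>odd_power r (v x)\<bar> + 1" for m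
    proof (rule AE_I2)
      fix x
      have "odd_power r (v x) \<le> odd_power r (v x + real m)" by (rule odd_power_mono[OF r_pos]) simp
      then show "norm (g m x) \<le> \<bar>odd_power r (v x)\<bar> + 1" unfolding g_def real_norm_def by linarith
    qed
  qed (simp_all add: g_def)
  moreover have "(LINT x|M. 1) > (0::real)" using measure_\<Omega>_pos by simp
  ultimately have "\<forall>\<^sub>F m in sequentially. (LINT x|M. g m x) > 0" by (rule order_tendstoD)
  then obtain m where m: "(LINT x|M. g m x) > 0" by (auto simp: eventually_sequentially)
  also have "(LINT x|M. g m x) \<le> (LINT x|M. odd_power r (v x + real m))"
    unfolding g_def by (intro integral_mono odd_power_shift_integrable[OF v] integrable_min) simp_all
  finally show ?thesis by (intro exI[of _ "real m"]) simp
qed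

text \<open>Intermediate value theorem for the integral as a function of the shift. The positive end
  is given by \<open>v\<close>, the negative one by \<open>- v\<close> and oddness. Monotonicity
  squeezes the integrand between its two end values, which gives the majorant needed for
  continuity.\<close>

lemma ex_shift_in_X_space:
  assumes v: "v \<in> H1 \<Omega>"
  shows "\<exists>k. (\<lambda>x. v x + k) \<in> X_space \<Omega> (ereal q)"
proof -
  have [measurable]: "v \<in> borel_measurable M" using v by (intro l2_measurable H1_weak_grad)
  note [measurable] = odd_power_measurable[OF r_pos]
  define F where "F k = (LINT x|M. odd_power r (v x + k))" for k
  obtain b where b: "b \<ge> 0" "F b > 0" using ex_positive_shift[OF v] by (auto simp: F_def)
  obtain a where a: "a \<ge> 0" "(LINT x|M. odd_power r (- v x + a)) > 0"
    using ex_positive_shift[OF H1_cmult(1)[OF v, of "-1"]] by auto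
  have "odd_power r (- v x + a) = - odd_power r (v x + - a)" for x
    using odd_power_uminus[of r "v x + - a"] by simp
  then have Fa: "F (- a) < 0" using a(2) by (simp add: F_def)
  have "continuous_on {- a..b} F"
    unfolding continuous_on_sequentially
  proof (intro allI ballI impI, elim conjE)
    fix s k assume k: "k \<in> {- a..b}" and s: "\<forall>n. s n \<in> {- a..b}" and lim: "s \<longlonglongrightarrow> k"
    show "(F \<circ> s) \<longlonglongrightarrow> F k"
      unfolding F_def comp_def
    proof (rule integral_dominated_convergence)
      show "integrable M (\<lambda>x. \<bar>odd_power r (v x + - a)\<bar> + \<bar>odd_power r (v x + b)\<bar>)"
        by (intro Bochner_Integration.integrable_add integrable_abs odd_power_shift_integrable v)
      show "AE x in M. (\<lambda>n. odd_power r (v x + s n)) \<longlonglongrightarrow> odd_power r (v x + k)"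
        by (intro AE_I2 continuous_on_tendsto_compose[OF odd_power_continuous[OF r_pos]] tendsto_intros lim) auto
      show "AE x in M. norm (odd_power r (v x + s n)) \<le> \<bar>odd_power r (v x + - a)\<bar> + \<bar>odd_power r (v x + b)\<bar>" for n
      proof (rule AE_I2)
        fix x
        have "odd_power r (v x + - a) \<le> odd_power r (v x + s n)" "odd_power r (v x + s n) \<le> odd_power r (v x + b)"
          using s by (auto intro!: odd_power_mono r_pos)
        then show "norm (odd_power r (v x + s n)) \<le> \<bar>odd_power r (v x + - a)\<bar> + \<bar>odd_power r (v x + b)\<bar>"
          by (simp add: abs_le_iff) linarith
      qed
    qed measurable
  qed
  then obtain k where "F k = 0" using IVT'[of F "- a" 0 b] a b Fa by auto
  then show ?thesis using H1_add(1)[OF v H1_const(1)] by (auto simp: X_space_iff F_def)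
qed

end

text \<open>Hoelder with exponents \<open>q\<close> and \<open>q'\<close> pairs a bounded weight
  with the square of the shifted function, whose \<open>q'\<close>-norm is the denominator
  \<open>Q\<close> in the definition of \<beta>. The weight b^+ produces the factor \<open>s\<close>
  below \<beta>, the weight 1 the comparison of the plain square integral with
  \<open>Q\<close>.\<close>

lemma scalar_coercive_finite:
  fixes b :: "'a \<Rightarrow> real"
  assumes b: "continuous_on (closure \<Omega>) b" and q: "q > 1"
    and lt: "Lp_norm \<Omega> (ereal q) (\<lambda>x. max (b x) 0) < \<beta> \<Omega> (ereal q)"
  shows "\<exists>\<kappa>>0. \<forall>v\<in>H1 \<Omega>. \<exists>k.
    \<kappa> * ((LINT x|M. (norm (weak_grad \<Omega> (\<lambda>x. v x + k) x))\<^sup>2) + (LINT x|M. (v x + k)\<^sup>2))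
      \<le> (LINT x|M. (norm (weak_grad \<Omega> (\<lambda>x. v x + k) x))\<^sup>2) - (LINT x|M. b x * (v x + k)\<^sup>2)"
proof -
  define r where "r = 2 / (q - 1)"
  define s where "s = Lp_norm \<Omega> (ereal q) (\<lambda>x. max (b x) 0)"
  have s: "s \<ge> 0" by (simp add: s_def Lp_norm_def)
  have \<beta>: "\<beta> \<Omega> (ereal q) > 0" using s lt by (simp add: s_def)
  define q' where "q' = q / (q - 1)"
  have q': "q' > 1" "1 / q + 1 / q' = 1" "1 / q' = (q - 1) / q" using q by (auto simp: q'_def field_simps)
  have r2: "2 * q' = r + 2" using r_2[OF q r_def \<beta>] by (simp add: q'_def)
  \<comment> \<open>The \<open>q\<close>-norm of the constant weight 1.\<close>
  define m where "m = measure M \<Omega> powr (1 / q)"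
  have m: "m > 0" using measure_\<Omega>_pos by (simp add: m_def)
  have [measurable]: "b \<in> borel_measurable M"
    using continuous_on_subset[OF b closure_subset] by (rule continuous_measurable_M)
  obtain Bb where Bb: "\<And>x. x \<in> closure \<Omega> \<Longrightarrow> norm (b x) \<le> Bb" using continuous_on_closure_bounded[OF b] by blast
  have "(1 - s / \<beta> \<Omega> (ereal q)) * min (1/2) (\<beta> \<Omega> (ereal q) / (2 * m)) > 0"
    using s lt \<beta> m by (intro mult_pos_pos) (auto simp: s_def min_def divide_simps)
  moreover
  have "\<exists>k. (1 - s / \<beta> \<Omega> (ereal q)) * min (1/2) (\<beta> \<Omega> (ereal q) / (2 * m)) *
      ((LINT x|M. (norm (weak_grad \<Omega> (\<lambda>x. v x + k) x))\<^sup>2) + (LINT x|M. (v x + k)\<^sup>2))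
      \<le> (LINT x|M. (norm (weak_grad \<Omega> (\<lambda>x. v x + k) x))\<^sup>2) - (LINT x|M. b x * (v x + k)\<^sup>2)"
    if v: "v \<in> H1 \<Omega>" for v
  proof -
    obtain k where k: "(\<lambda>x. v x + k) \<in> X_space \<Omega> (ereal q)"
      using ex_shift_in_X_space[OF q r_def \<beta> v] by blast
    define y where "y = (\<lambda>x. v x + k)"
    have y: "y \<in> X_space \<Omega> (ereal q)" using k by (simp add: y_def)
    then have yH: "y \<in> H1 \<Omega>" by (simp add: X_space_iff[OF q r_def \<beta>])
    have yl2: "y \<in> l2_set M" using H1_weak_grad(1)[OF yH] .
    have [measurable]: "y \<in> borel_measurable M" using yl2 by (rule l2_measurable)
    have y2: "integrable M (\<lambda>x. (y x)\<^sup>2)" using l2_integrable[OF yl2] by simp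
    define Q where "Q = (LINT x|M. \<bar>y x\<bar> powr (r + 2)) powr ((q - 1) / q)"
    have pw: "(y x)\<^sup>2 powr q' = \<bar>y x\<bar> powr (r + 2)" for x
    proof -
      have "(y x)\<^sup>2 = \<bar>y x\<bar> powr 2" by (cases "y x = 0") (simp_all add: powr_numeral)
      then show ?thesis by (simp only: powr_powr r2)
    qed
    have holder: "(LINT x|M. \<bar>f x * (y x)\<^sup>2\<bar>) \<le> (LINT x|M. \<bar>f x\<bar> powr q) powr (1 / q) * Q"
      if [measurable]: "f \<in> borel_measurable M" and f: "\<And>x. x \<in> \<Omega> \<Longrightarrow> \<bar>f x\<bar> \<le> Bf" for f Bf
    proof -
      have "integrable M (\<lambda>x. \<bar>f x\<bar> powr q)"
        by (rule integrable_const_bound[of _ "Bf powr q"]) (use f q in \<open>auto intro!: AE_I2 powr_mono2\<close>)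
      then show ?thesis
        using integral_Holder(2)[of f M "\<lambda>x. (y x)\<^sup>2" q q'] X_space_Sobolev(1)[OF q r_def \<beta> y] q q'
        by (simp add: pw Q_def)
    qed
    have "(LINT x|M. b x * (y x)\<^sup>2) \<le> (LINT x|M. \<bar>max (b x) 0 * (y x)\<^sup>2\<bar>)"
    proof (rule integral_mono)
      have bd: "integrable M (\<lambda>x. Bb * (y x)\<^sup>2)" using y2 by simp
      have Bb': "\<bar>b x\<bar> \<le> Bb" if "x \<in> \<Omega>" for x using Bb[of x] closure_subset that by auto
      show "integrable M (\<lambda>x. b x * (y x)\<^sup>2)"
        by (rule Bochner_Integration.integrable_bound[OF bd])
           (auto intro!: AE_I2 mult_right_mono order_trans[OF Bb' abs_ge_self] simp: abs_mult)
      show "integrable M (\<lambda>x. \<bar>max (b x) 0 * (y x)\<^sup>2\<bar>)"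
        by (rule Bochner_Integration.integrable_bound[OF bd])
           (use Bb' in \<open>force intro!: AE_I2 mult_right_mono simp: abs_mult\<close>)+
      show "b x * (y x)\<^sup>2 \<le> \<bar>max (b x) 0 * (y x)\<^sup>2\<bar>" for x
        by (auto simp: abs_mult intro!: mult_right_mono)
    qed
    also have "\<dots> \<le> (LINT x|M. \<bar>max (b x) 0\<bar> powr q) powr (1 / q) * Q"
      by (rule holder[of _ Bb]) (use Bb closure_subset in \<open>force\<close>)+
    also have "\<dots> = s * Q" by (simp add: s_def Lp_norm_def)
    finally have 1: "(LINT x|M. b x * (y x)\<^sup>2) \<le> s * Q" .
    have 2: "(LINT x|M. (y x)\<^sup>2) \<le> m * Q"
      using holder[of "\<lambda>x. 1" 1] by (simp add: m_def)
    have 3: "\<beta> \<Omega> (ereal q) * Q \<le> (LINT x|M. (norm (weak_grad \<Omega> y x))\<^sup>2)"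
      unfolding Q_def by (rule X_space_Sobolev(2)[OF q r_def \<beta> y])
    show ?thesis
      using scalar_coercive_aux[OF s _ m _ 3 1 2] lt unfolding y_def s_def[symmetric]
      by (intro exI[of _ k]) (simp add: Q_def)
  qed
  ultimately show ?thesis by blast
qed

text \<open>Here the constraint is vanishing mean, so the shift is minus the average, and the weight
  is bounded by its essential supremum instead of by Hoelder's inequality.\<close>

lemma scalar_coercive_infinite:
  fixes b :: "'a \<Rightarrow> real"
  assumes b: "continuous_on (closure \<Omega>) b"
    and lt: "Lp_norm \<Omega> \<infinity> (\<lambda>x. max (b x) 0) < \<beta> \<Omega> \<infinity>"
  shows "\<exists>\<kappa>>0. \<forall>v\<in>H1 \<Omega>. \<exists>k.
    \<kappa> * ((LINT x|M. (norm (weak_grad \<Omega> (\<lambda>x. v x + k) x))\<^sup>2) + (LINT x|M. (v x + k)\<^sup>2))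
      \<le> (LINT x|M. (norm (weak_grad \<Omega> (\<lambda>x. v x + k) x))\<^sup>2) - (LINT x|M. b x * (v x + k)\<^sup>2)"
proof -
  define e where "e = esssup M (\<lambda>x. ereal \<bar>max (b x) 0\<bar>)"
  define s where "s = Lp_norm \<Omega> \<infinity> (\<lambda>x. max (b x) 0)"
  have s_e: "s = real_of_ereal e" by (simp add: s_def e_def Lp_norm_def)
  have [measurable]: "b \<in> borel_measurable M"
    using continuous_on_subset[OF b closure_subset] by (rule continuous_measurable_M)
  obtain Bb where Bb: "Bb \<ge> 0" "\<And>x. x \<in> closure \<Omega> \<Longrightarrow> norm (b x) \<le> Bb"
    using continuous_on_closure_bounded[OF b] by blast
  have Bb': "\<bar>b x\<bar> \<le> Bb" if "x \<in> \<Omega>" for x using Bb(2)[of x] closure_subset that by auto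
  have "e \<le> ereal Bb"
    unfolding e_def by (rule esssup_I) (use Bb' Bb(1) in \<open>auto intro!: AE_I2 simp: max_def abs_le_iff\<close>)
  moreover have "e \<ge> 0"
  proof -
    have "emeasure M (space M) \<noteq> 0" using measure_\<Omega>_pos by (simp add: emeasure_eq_measure)
    then have "esssup M (\<lambda>x. 0 :: ereal) = 0" by (rule esssup_const)
    moreover have "esssup M (\<lambda>x. 0 :: ereal) \<le> e" unfolding e_def
      by (rule esssup_mono) (auto simp only: ereal_less_eq zero_ereal_def abs_ge_zero, measurable)
    ultimately show ?thesis by simp
  qed
  \<comment> \<open>Both bounds together make \<open>e\<close> finite, so
    \<open>real_of_ereal\<close> returns the supremum itself and not a default value.\<close>
  ultimately have e: "e = ereal s" and s: "s \<ge> 0"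
    unfolding s_e by (cases e; simp)+
  have bs: "AE x in M. b x \<le> s"
    using esssup_AE[of "\<lambda>x. ereal \<bar>max (b x) 0\<bar>" M] unfolding e_def[symmetric] e
    by eventually_elim auto
  have \<beta>: "\<beta> \<Omega> \<infinity> > 0" using s lt by (simp add: s_def)
  \<comment> \<open>The parameter \<open>m\<close> of \<open>scalar_coercive_aux\<close> is 1,
    because \<open>Q\<close> is already the plain square integral.\<close>
  have "(1 - s / \<beta> \<Omega> \<infinity>) * min (1/2) (\<beta> \<Omega> \<infinity> / (2 * 1)) > 0"
    using s lt \<beta> by (intro mult_pos_pos) (auto simp: s_def min_def divide_simps)
  moreover
  have "\<exists>k. (1 - s / \<beta> \<Omega> \<infinity>) * min (1/2) (\<beta> \<Omega> \<infinity> / (2 * 1)) *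
      ((LINT x|M. (norm (weak_grad \<Omega> (\<lambda>x. v x + k) x))\<^sup>2) + (LINT x|M. (v x + k)\<^sup>2))
      \<le> (LINT x|M. (norm (weak_grad \<Omega> (\<lambda>x. v x + k) x))\<^sup>2) - (LINT x|M. b x * (v x + k)\<^sup>2)"
    if v: "v \<in> H1 \<Omega>" for v
  proof -
    define k where "k = - (LINT x|M. v x) / measure M \<Omega>"
    define y where "y = (\<lambda>x. v x + k)"
    have yH: "y \<in> H1 \<Omega>" unfolding y_def by (intro H1_add H1_const v)
    have yl2: "y \<in> l2_set M" using H1_weak_grad(1)[OF yH] .
    have [measurable]: "y \<in> borel_measurable M" using yl2 by (rule l2_measurable)
    have y2: "integrable M (\<lambda>x. (y x)\<^sup>2)" using l2_integrable[OF yl2] by simp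
    have "(LINT x|M. y x) = 0"
      using l2_imp_integrable(1)[OF H1_weak_grad(1)[OF v]] measure_\<Omega>_pos by (simp add: y_def k_def)
    then have y: "y \<in> X_space \<Omega> \<infinity>" using yH by (simp add: X_space_def)
    define Q where "Q = (LINT x|M. (y x)\<^sup>2)"
    have Q: "Q \<ge> 0" by (simp add: Q_def)
    have 1: "(LINT x|M. b x * (y x)\<^sup>2) \<le> s * Q"
    proof -
      have "(LINT x|M. b x * (y x)\<^sup>2) \<le> (LINT x|M. s * (y x)\<^sup>2)"
      proof (rule integral_mono_AE)
        have bd: "integrable M (\<lambda>x. Bb * (y x)\<^sup>2)" using y2 by simp
        show "integrable M (\<lambda>x. b x * (y x)\<^sup>2)"
          by (rule Bochner_Integration.integrable_bound[OF bd])
             (auto intro!: AE_I2 mult_right_mono order_trans[OF Bb' abs_ge_self] simp: abs_mult)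
        show "AE x in M. b x * (y x)\<^sup>2 \<le> s * (y x)\<^sup>2"
          using bs by eventually_elim (simp add: mult_right_mono)
      qed (use y2 in simp)
      then show ?thesis by (simp add: Q_def)
    qed
    have 3: "\<beta> \<Omega> \<infinity> * Q \<le> (LINT x|M. (norm (weak_grad \<Omega> y x))\<^sup>2)"
    proof (cases "Q = 0")
      case False
      have "\<not> (AE x in M. y x = 0)"
      proof
        assume "AE x in M. y x = 0"
        then have "AE x in M. (y x)\<^sup>2 = 0" by eventually_elim simp
        then have "Q = 0" unfolding Q_def by (rule integral_eq_zero_AE)
        with False show False ..
      qed
      from \<beta>_le_I_fun[OF y this] False Q show ?thesis by (simp add: I_fun_def Q_def[symmetric] le_divide_eq)
    qed simp
    show ?thesis
      using scalar_coercive_aux[OF s _ _ Q 3 1, of 1 "LINT x|M. (y x)\<^sup>2"] lt unfolding y_def s_def[symmetric]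
      by (intro exI[of _ k]) (simp add: Q_def y_def)
  qed
  ultimately show ?thesis by blast
qed

end

section \<open>Functions with bounded Hessian\<close>

lemma linear_axis_expansion:
  fixes f :: "real^'n \<Rightarrow> real"
  assumes "linear f"
  shows "f h = (\<Sum>i\<in>UNIV. h $ i * f (axis i 1))"
proof -
  have "f h = f (\<Sum>i\<in>UNIV. (h $ i) *\<^sub>R axis i 1)"
    using basis_expansion[of h] by (simp add: scalar_mult_eq_scaleR)
  also have "\<dots> = (\<Sum>i\<in>UNIV. h $ i * f (axis i 1))"
    using assms by (simp add: linear_sum linear_scale)
  finally show ?thesis .
qed

lemma DERIV_along_line:
  fixes f :: "real^'n \<Rightarrow> real"
  assumes "(f has_derivative frechet_derivative f (at (u + t *\<^sub>R h))) (at (u + t *\<^sub>R h))"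
  shows "((\<lambda>t. f (u + t *\<^sub>R h)) has_real_derivative
           (\<Sum>i\<in>UNIV. h $ i * frechet_derivative f (at (u + t *\<^sub>R h)) (axis i 1))) (at t)"
proof -
  have "((\<lambda>t. u + t *\<^sub>R h) has_derivative (\<lambda>s. s *\<^sub>R h)) (at t)"
    by (auto intro!: derivative_eq_intros)
  from has_derivative_compose[OF this assms]
  show ?thesis
    using linear_scale[OF has_derivative_linear[OF assms]]
      linear_axis_expansion[OF has_derivative_linear[OF assms], of h]
    by (simp add: has_field_derivative_def mult.commute[of _ "sum _ _"])
qed

lemma grad_inner: "grad f u \<bullet> h = (\<Sum>i\<in>UNIV. h $ i * frechet_derivative f (at u) (axis i 1))"
  by (simp add: grad_def inner_vec_def mult.commute)

text \<open>The sums are ordered as they arise from differentiating each gradient component along a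
  line. Both indices are contracted with \<open>h\<close>, so interchanging them requires no
  symmetry of second derivatives.\<close>

lemma hessian_form:
  "(hessian f u *v h) \<bullet> h = (\<Sum>j\<in>UNIV. (\<Sum>i\<in>UNIV. h $ i * frechet_derivative (\<lambda>w. grad f w $ j) (at u) (axis i 1)) * h $ j)"
proof -
  have "(hessian f u *v h) \<bullet> h = (\<Sum>i\<in>UNIV. \<Sum>j\<in>UNIV. h $ i * frechet_derivative (\<lambda>w. grad f w $ j) (at u) (axis i 1) * h $ j)"
    by (simp add: hessian_def inner_vec_def matrix_vector_mult_def sum_distrib_left sum_distrib_right mult_ac)
  then show ?thesis by (subst (asm) sum.swap) (simp add: sum_distrib_right)
qed

lemma grad_component_has_derivative:
  fixes g :: "real^'n \<Rightarrow> real"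
  assumes "C_k 2 g"
  shows "((\<lambda>w. grad g w $ j) has_derivative frechet_derivative (\<lambda>w. grad g w $ j) (at x)) (at x)"
proof -
  have "C_k (Suc 0) (\<lambda>w. frechet_derivative g (at w) (axis j 1))"
    using assms C_k.simps(2)[of "Suc 0" g] axis_in_Basis_iff[of j "1::real"] by (simp add: numeral_2_eq_2 del: C_k.simps(2))
  then show ?thesis unfolding grad_def by (simp add: C_k_has_derivative del: C_k.simps(2))
qed

lemma grad_continuous:
  fixes g :: "real^'n \<Rightarrow> real"
  assumes "C_k 2 g" shows "continuous_on UNIV (grad g)"
proof -
  have "isCont (\<lambda>w. grad g w $ j) x" for j x
    by (rule has_derivative_continuous[OF grad_component_has_derivative[OF assms]])
  then have "continuous_on UNIV (\<lambda>w. grad g w $ j)" for j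
    by (simp add: continuous_at_imp_continuous_on)
  then have "continuous_on UNIV (\<lambda>w. \<chi> j. grad g w $ j)"
    by (intro continuous_on_vec_lambda)
  then show ?thesis by simp
qed

text \<open>Maclaurin's formula of order two along the segment. The intermediate point is unknown,
  which is harmless because the matrix bounds hold at every point.\<close>

lemma Hessian_Taylor:
  fixes g :: "real^'n \<Rightarrow> real"
  assumes g: "C_k 2 g"
  obtains t where "0 < t" "t < 1"
    "g (u + h) - g u - grad g u \<bullet> h = (hessian g (u + t *\<^sub>R h) *v h) \<bullet> h / 2"
proof -
  define diff where "diff m t = (if m = 0 then g (u + t *\<^sub>R h)
      else if m = 1 then grad g (u + t *\<^sub>R h) \<bullet> h else (hessian g (u + t *\<^sub>R h) *v h) \<bullet> h)" for m :: nat and t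
  have C1: "C_k (Suc (Suc 0)) g" using g by (simp add: numeral_2_eq_2)
  have d0: "((\<lambda>t. g (u + t *\<^sub>R h)) has_real_derivative grad g (u + t *\<^sub>R h) \<bullet> h) (at t)" for t
    unfolding grad_inner by (rule DERIV_along_line[OF C_k_has_derivative[OF C1]])
  have d1: "((\<lambda>t. grad g (u + t *\<^sub>R h) \<bullet> h) has_real_derivative (hessian g (u + t *\<^sub>R h) *v h) \<bullet> h) (at t)" for t
  proof -
    have "((\<lambda>t. \<Sum>j\<in>UNIV. grad g (u + t *\<^sub>R h) $ j * h $ j) has_real_derivative (hessian g (u + t *\<^sub>R h) *v h) \<bullet> h) (at t)"
      unfolding hessian_form
      by (intro DERIV_sum DERIV_cmult_right DERIV_along_line[OF grad_component_has_derivative[OF g]])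
    then show ?thesis by (simp add: inner_vec_def)
  qed
  have "\<forall>m t. m < 2 \<and> 0 \<le> t \<and> t \<le> 1 \<longrightarrow> DERIV (diff m) t :> diff (Suc m) t"
    using d0 d1 by (auto simp: diff_def[abs_def] less_2_cases_iff)
  from Maclaurin[OF zero_less_one _ _ this, of "diff 0"]
  obtain t where t: "0 < t" "t < 1" and "diff 0 1 = (\<Sum>m<2. diff m 0 / fact m * 1 ^ m) + diff 2 t / fact 2 * 1 ^ 2"
    by auto
  then have "g (u + h) - g u - grad g u \<bullet> h = (hessian g (u + t *\<^sub>R h) *v h) \<bullet> h / 2"
    by (simp add: diff_def numeral_2_eq_2)
  with t show thesis by (rule that)
qed

lemma Taylor_psd_bounds:
  fixes g :: "real^'n \<Rightarrow> real"
  assumes "C_k 2 g" and "\<And>u. psd_le A (hessian g u) \<and> psd_le (hessian g u) B"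
  shows "(A *v h) \<bullet> h / 2 \<le> g (u + h) - g u - grad g u \<bullet> h"
    and "g (u + h) - g u - grad g u \<bullet> h \<le> (B *v h) \<bullet> h / 2"
proof -
  obtain t where t: "g (u + h) - g u - grad g u \<bullet> h = (hessian g (u + t *\<^sub>R h) *v h) \<bullet> h / 2"
    using Hessian_Taylor[OF assms(1)] by metis
  have "0 \<le> ((hessian g (u + t *\<^sub>R h) - A) *v h) \<bullet> h" "0 \<le> ((B - hessian g (u + t *\<^sub>R h)) *v h) \<bullet> h"
    using assms(2) by (auto simp: psd_le_def)
  then show "(A *v h) \<bullet> h / 2 \<le> g (u + h) - g u - grad g u \<bullet> h"
    and "g (u + h) - g u - grad g u \<bullet> h \<le> (B *v h) \<bullet> h / 2"
    by (auto simp: t matrix_vector_mult_diff_rdistrib inner_diff_left)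
qed

lemma matrix_form_bound:
  fixes A :: "real^'n^'n"
  shows "\<bar>(A *v h) \<bullet> h\<bar> \<le> real CARD('n) * norm A * (norm h)\<^sup>2"
proof -
  have "norm (A *v h) \<le> (\<Sum>i\<in>UNIV. \<bar>(A *v h) $ i\<bar>)" by (rule norm_le_l1_cart)
  also have "\<dots> \<le> (\<Sum>i\<in>(UNIV::'n set). norm A * norm h)"
  proof (rule sum_mono)
    fix i
    have "\<bar>(A *v h) $ i\<bar> \<le> norm (A $ i) * norm h"
      using Cauchy_Schwarz_ineq2[of "A $ i" h] by (simp add: matrix_vector_mul_component)
    also have "\<dots> \<le> norm A * norm h" by (intro mult_right_mono Finite_Cartesian_Product.norm_nth_le) simp
    finally show "\<bar>(A *v h) $ i\<bar> \<le> norm A * norm h" .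
  qed
  finally have "norm (A *v h) \<le> real CARD('n) * norm A * norm h" by simp
  then have "norm (A *v h) * norm h \<le> real CARD('n) * norm A * norm h * norm h"
    by (rule mult_right_mono) simp
  then show ?thesis
    using Cauchy_Schwarz_ineq2[of "A *v h" h] by (simp add: power2_eq_square)
qed

text \<open>A two-sided quadratic Taylor bound already makes the gradient Lipschitz; in particular no
  symmetry of the Hessian matrix is involved.\<close>

lemma quadratic_remainder_imp_Lipschitz:
  fixes g :: "'a::euclidean_space \<Rightarrow> real" and g' :: "'a \<Rightarrow> 'a"
  assumes K: "\<And>u h. \<bar>g (u + h) - g u - g' u \<bullet> h\<bar> \<le> K * (norm h)\<^sup>2"
  shows "norm (g' u - g' w) \<le> 6 * K * norm (u - w)"
proof -
  have "0 \<le> K * (norm (SOME i :: 'a. i \<in> Basis))\<^sup>2" using K[of 0 "SOME i. i \<in> Basis"] by linarith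
  then have K0: "K \<ge> 0" by simp
  define d where "d = g' u - g' w"
  show ?thesis
  proof (cases "d = 0 \<or> u = w")
    case True
    then show ?thesis using K0 by (auto simp: d_def)
  next
    case False
    define s where "s = norm (u - w)"
    have s: "s > 0" using False by (simp add: s_def)
    \<comment> \<open>The test increment points along the gradient difference and has the length of
      \<open>u - w\<close>. Three remainders enter, with increments of length at most
      \<open>s\<close>, \<open>2 * s\<close> and \<open>s\<close>; their squares add up to the
      factor 6.\<close>
    define h where "h = (s / norm d) *\<^sub>R d"
    have nh: "norm h = s" using False s by (simp add: h_def)
    have "d \<bullet> h = norm d * s"
      using False by (simp add: h_def dot_square_norm power2_eq_square)
    have "norm (u + h - w) \<le> 2 * s"
      using norm_triangle_ineq[of "u - w" h] by (simp add: nh s_def algebra_simps)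
    then have "(norm (u + h - w))\<^sup>2 \<le> (2 * s)\<^sup>2" by (intro power_mono) auto
    then have "K * (norm (u + h - w))\<^sup>2 \<le> K * (4 * s\<^sup>2)" using K0 by (intro mult_left_mono) (auto simp: power_mult_distrib)
    moreover have "d \<bullet> h = g' u \<bullet> h - (g' w \<bullet> (u + h - w) - g' w \<bullet> (u - w))"
      by (simp add: d_def inner_diff_left inner_diff_right inner_add_right)
    ultimately have "d \<bullet> h \<le> K * s\<^sup>2 + K * (4 * s\<^sup>2) + K * s\<^sup>2"
      using K[of u h] K[of w "u + h - w"] K[of w "u - w"]
      by (simp add: nh s_def[symmetric] abs_le_iff)
    also have "\<dots> = 6 * K * s * s" by (simp add: power2_eq_square)
    finally show ?thesis using \<open>d \<bullet> h = norm d * s\<close> s by (simp add: d_def s_def)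
  qed
qed

text \<open>Simple functions \<open>F i\<close> converge pointwise to \<open>u\<close>. On each of
  the finitely many level sets of \<open>F i\<close> the composition is measurable by
  \<open>f\<close>, and continuity in the second argument passes to the limit.\<close>

lemma Caratheodory_measurable:
  fixes f :: "'a \<Rightarrow> 'b::euclidean_space \<Rightarrow> 'c::euclidean_space"
  assumes f: "\<And>c. (\<lambda>x. f x c) \<in> borel_measurable N"
    and cont: "\<And>x. x \<in> space N \<Longrightarrow> continuous_on UNIV (f x)"
    and u: "u \<in> borel_measurable N"
  shows "(\<lambda>x. f x (u x)) \<in> borel_measurable N"
proof -
  obtain F where F: "\<And>i. simple_function N (F i)"
    and lim: "\<And>x. x \<in> space N \<Longrightarrow> (\<lambda>i. F i x) \<longlonglongrightarrow> u x"
    using borel_measurable_implies_sequence_metric[OF u, of 0] by blast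
  show ?thesis
  proof (rule borel_measurable_LIMSEQ_metric)
    fix i
    have fin: "finite (F i ` space N)" using F[of i] by (rule simple_functionD)
    have "F i \<in> measurable N (count_space (F i ` space N))"
      using F[of i] fin by (auto simp: measurable_count_space_eq2 simple_function_def)
    then show "(\<lambda>x. f x (F i x)) \<in> borel_measurable N"
      using f fin by (intro measurable_compose_countable'[where g="F i" and I="F i ` space N" and f="\<lambda>c x. f x c"])
        (auto intro: countable_finite)
  next
    fix x assume x: "x \<in> space N"
    show "(\<lambda>i. f x (F i x)) \<longlonglongrightarrow> f x (u x)"
      by (rule continuous_on_tendsto_compose[OF cont[OF x] lim[OF x]]) auto
  qed
qed

section \<open>Square integrable vector fields\<close>

lemma borel_measurable_vec_components:
  fixes f :: "'a \<Rightarrow> ('b::euclidean_space)^'n"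
  assumes "\<And>i. (\<lambda>x. f x $ i) \<in> borel_measurable N"
  shows "f \<in> borel_measurable N"
proof (subst borel_measurable_euclidean_space, rule ballI)
  fix b :: "'b^'n" assume "b \<in> Basis"
  then obtain i a where "b = axis i a" by (auto simp: Basis_vec_def)
  then show "(\<lambda>x. f x \<bullet> b) \<in> borel_measurable N" using assms[of i] by (simp add: inner_axis)
qed

lemma norm_vec_square: "(norm (v :: ('b::real_inner)^'n))\<^sup>2 = (\<Sum>i\<in>UNIV. (norm (v $ i))\<^sup>2)"
  by (simp add: power2_norm_eq_inner inner_vec_def)

lemma l2_vec:
  fixes f :: "'a \<Rightarrow> ('b::euclidean_space)^'n"
  assumes "\<And>i. (\<lambda>x. f x $ i) \<in> l2_set N"
  shows "f \<in> l2_set N"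
  using assms by (auto simp: l2_set_def norm_vec_square intro: borel_measurable_vec_components)

lemma l2_Pair:
  fixes f :: "'a \<Rightarrow> 'b::euclidean_space" and g :: "'a \<Rightarrow> 'c::euclidean_space"
  assumes f: "f \<in> l2_set N" and g: "g \<in> l2_set N"
  shows "(\<lambda>x. (f x, g x)) \<in> l2_set N"
    and "(l2_norm N (\<lambda>x. (f x, g x)))\<^sup>2 = (l2_norm N f)\<^sup>2 + (l2_norm N g)\<^sup>2"
proof -
  have *: "(norm (a, b))\<^sup>2 = (norm a)\<^sup>2 + (norm b)\<^sup>2" for a :: 'b and b :: 'c
    by (simp add: norm_Pair)
  show "(\<lambda>x. (f x, g x)) \<in> l2_set N"
    using f g by (auto simp: l2_set_def *)
  show "(l2_norm N (\<lambda>x. (f x, g x)))\<^sup>2 = (l2_norm N f)\<^sup>2 + (l2_norm N g)\<^sup>2"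
    using f g by (simp add: l2_norm_square * l2_integrable)
qed

section \<open>The variational problem\<close>

text \<open>The abstract theory lives on a real vector space; here it is that of all functions, with
  pointwise operations, and the Sobolev space is a subspace of it.\<close>

instantiation "fun" :: (type, real_vector) real_vector
begin

definition "t *\<^sub>R f = (\<lambda>x. t *\<^sub>R f x)"

instance
  by standard (simp_all add: scaleR_fun_def fun_eq_iff algebra_simps)

end

lemma scaleR_fun_apply [simp]: "(t *\<^sub>R f) x = t *\<^sub>R f x"
  by (simp add: scaleR_fun_def)

context bounded_open
begin

text \<open>The Jacobian, row by row. Each row is a chosen representative, so linearity of
  \<open>vgrad\<close> holds only almost everywhere.\<close>

definition vgrad :: "('a \<Rightarrow> real^'n) \<Rightarrow> 'a \<Rightarrow> 'a^'n" where
  "vgrad u x = (\<chi> i. weak_grad \<Omega> (\<lambda>y. u y $ i) x)"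

text \<open>Encoded as one square norm of the pair of function and gradient, so that the triangle
  inequality, homogeneity and completeness are inherited from the square integrable
  functions.\<close>

definition H1_norm :: "('a \<Rightarrow> real^'n) \<Rightarrow> real" where
  "H1_norm u = l2_norm M (\<lambda>x. (u x, vgrad u x))"

lemma H1_norm_nonneg: "H1_norm u \<ge> 0"
  by (simp add: H1_norm_def)

lemma H1_vec_component: "u \<in> H1_vec \<Omega> \<Longrightarrow> (\<lambda>y. u y $ i) \<in> H1 \<Omega>"
  by (simp add: H1_vec_def)

lemma H1_vec_l2:
  assumes "u \<in> H1_vec \<Omega>"
  shows "u \<in> l2_set M" and "vgrad u \<in> l2_set M" and "(\<lambda>x. (u x, vgrad u x)) \<in> l2_set M"
proof -
  show 1: "u \<in> l2_set M" using H1_weak_grad(1)[OF H1_vec_component[OF assms]] by (rule l2_vec)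
  show 2: "vgrad u \<in> l2_set M"
    using H1_weak_grad(2)[OF H1_vec_component[OF assms]] by (intro l2_vec) (simp add: vgrad_def)
  show "(\<lambda>x. (u x, vgrad u x)) \<in> l2_set M" by (rule l2_Pair[OF 1 2])
qed

lemma H1_norm_square:
  assumes "u \<in> H1_vec \<Omega>" shows "(H1_norm u)\<^sup>2 = (l2_norm M u)\<^sup>2 + (l2_norm M (vgrad u))\<^sup>2"
  unfolding H1_norm_def by (rule l2_Pair[OF H1_vec_l2(1,2)[OF assms]])

lemma H1_norm_ge:
  assumes "u \<in> H1_vec \<Omega>" shows "l2_norm M u \<le> H1_norm u" "l2_norm M (vgrad u) \<le> H1_norm u"
proof -
  have "(l2_norm M u)\<^sup>2 \<le> (H1_norm u)\<^sup>2" "(l2_norm M (vgrad u))\<^sup>2 \<le> (H1_norm u)\<^sup>2"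
    unfolding H1_norm_square[OF assms] by simp_all
  then show "l2_norm M u \<le> H1_norm u" "l2_norm M (vgrad u) \<le> H1_norm u"
    by (simp_all only: power2_le_imp_le H1_norm_nonneg)
qed

lemma vgrad_I:
  assumes "\<And>i. AE x in M. weak_grad \<Omega> (\<lambda>y. u y $ i) x = g x $ i"
  shows "AE x in M. vgrad u x = g x"
proof -
  have "AE x in M. \<forall>i\<in>UNIV. weak_grad \<Omega> (\<lambda>y. u y $ i) x = g x $ i"
    using assms by (intro AE_finite_allI) auto
  then show ?thesis by eventually_elim (simp add: vgrad_def vec_eq_iff)
qed

lemma H1_vec_add:
  assumes "u \<in> H1_vec \<Omega>" "w \<in> H1_vec \<Omega>"
  shows "u + w \<in> H1_vec \<Omega>" and "AE x in M. vgrad (u + w) x = vgrad u x + vgrad w x"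
proof -
  note * = H1_add[OF H1_vec_component[OF assms(1)] H1_vec_component[OF assms(2)]]
  show "u + w \<in> H1_vec \<Omega>" using *(1) by (simp add: H1_vec_def)
  show "AE x in M. vgrad (u + w) x = vgrad u x + vgrad w x"
    using *(2) by (intro vgrad_I) (simp add: vgrad_def)
qed

lemma H1_vec_scaleR:
  assumes "u \<in> H1_vec \<Omega>"
  shows "t *\<^sub>R u \<in> H1_vec \<Omega>" and "AE x in M. vgrad (t *\<^sub>R u) x = t *\<^sub>R vgrad u x"
proof -
  note * = H1_cmult[OF H1_vec_component[OF assms], where t=t]
  show "t *\<^sub>R u \<in> H1_vec \<Omega>" using *(1) by (simp add: H1_vec_def)
  show "AE x in M. vgrad (t *\<^sub>R u) x = t *\<^sub>R vgrad u x"
    using *(2) by (intro vgrad_I) (simp add: vgrad_def)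
qed

lemma H1_vec_const:
  shows "(\<lambda>x. k) \<in> H1_vec \<Omega>" and "AE x in M. vgrad (\<lambda>x. k) x = 0"
  using H1_const by (auto simp: H1_vec_def intro: vgrad_I)

lemma subspace_H1_vec: "subspace (H1_vec \<Omega> :: ('a \<Rightarrow> real^'n) set)"
  unfolding subspace_def using H1_vec_const(1)[of 0] by (auto simp: H1_vec_add H1_vec_scaleR zero_fun_def)

lemma vgrad_diff:
  assumes "u \<in> H1_vec \<Omega>" "w \<in> H1_vec \<Omega>"
  shows "AE x in M. vgrad (u - w) x = vgrad u x - vgrad w x"
  using H1_vec_add(2)[OF assms(1) H1_vec_scaleR(1)[OF assms(2), of "-1"]] H1_vec_scaleR(2)[OF assms(2), of "-1"]
  by eventually_elim simp

lemma H1_norm_eq: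
  assumes "u \<in> H1_vec \<Omega>" "F \<in> l2_set M" "AE x in M. F x = (u x, vgrad u x)"
  shows "H1_norm u = l2_norm M F"
  unfolding H1_norm_def by (rule l2_cong[OF assms(2) l2_measurable[OF H1_vec_l2(3)[OF assms(1)]] assms(3)])

lemma H1_norm_triangle:
  assumes "u \<in> H1_vec \<Omega>" "w \<in> H1_vec \<Omega>"
  shows "H1_norm (u + w) \<le> H1_norm u + H1_norm w"
proof -
  have "H1_norm (u + w) = l2_norm M (\<lambda>x. (u x, vgrad u x) + (w x, vgrad w x))"
    using H1_vec_add(2)[OF assms]
    by (intro H1_norm_eq H1_vec_add l2_add H1_vec_l2 assms) (auto elim: eventually_mono)
  also have "\<dots> \<le> H1_norm u + H1_norm w"
    unfolding H1_norm_def by (intro l2_norm_triangle H1_vec_l2 assms)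
  finally show ?thesis .
qed

lemma H1_norm_scaleR:
  assumes "u \<in> H1_vec \<Omega>"
  shows "H1_norm (t *\<^sub>R u) = \<bar>t\<bar> * H1_norm u"
proof -
  have "H1_norm (t *\<^sub>R u) = l2_norm M (\<lambda>x. t *\<^sub>R (u x, vgrad u x))"
    using H1_vec_scaleR(2)[OF assms, of t]
    by (intro H1_norm_eq H1_vec_scaleR l2_scaleR H1_vec_l2 assms) (auto elim: eventually_mono)
  then show ?thesis by (simp only: l2_norm_scaleR H1_norm_def)
qed

lemma H1_norm_diff:
  assumes "u \<in> H1_vec \<Omega>" "w \<in> H1_vec \<Omega>"
  shows "H1_norm (u - w) = l2_norm M (\<lambda>x. (u x, vgrad u x) - (w x, vgrad w x))"
  using vgrad_diff[OF assms]
  by (intro H1_norm_eq subspace_diff[OF subspace_H1_vec] l2_diff H1_vec_l2 assms) (auto elim: eventually_mono)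

lemma H1_norm_const: "H1_norm (\<lambda>x. k :: real^'n) = sqrt (measure M \<Omega>) * norm k"
proof -
  have "H1_norm (\<lambda>x. k) = l2_norm M (\<lambda>x. (k, 0 :: 'a^'n))"
    using H1_vec_const(2)[of k] H1_vec_const(1)[of k]
    by (intro H1_norm_eq l2_bounded[where B="norm k"]) (auto elim: eventually_mono simp: norm_Pair)
  then show ?thesis by (simp add: l2_norm_def norm_Pair real_sqrt_mult)
qed

text \<open>The pairs of function and gradient converge as square integrable functions, and
  closedness of the weak gradient identifies the second component of the limit as the gradient of
  the first.\<close>

lemma H1_vec_complete:
  fixes s :: "nat \<Rightarrow> 'a \<Rightarrow> real^'n"
  assumes s: "\<And>m. s m \<in> H1_vec \<Omega>" and bd: "\<And>m. H1_norm (s (Suc m) - s m) \<le> r * (1/2)^m"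
  shows "\<exists>u\<in>H1_vec \<Omega>. (\<lambda>m. H1_norm (s m - u)) \<longlonglongrightarrow> 0"
proof -
  define S where "S m x = (s m x, vgrad (s m) x)" for m x
  have S: "S m \<in> l2_set M" for m unfolding S_def[abs_def] by (rule H1_vec_l2(3)[OF s])
  have "l2_norm M (\<lambda>x. S (Suc m) x - S m x) \<le> r * (1/2)^m" for m
    using bd[of m] H1_norm_diff[OF s[of "Suc m"] s[of m]] by (simp add: S_def)
  from l2_complete[OF S this] obtain F where F: "F \<in> l2_set M"
    and lim: "(\<lambda>m. l2_norm M (\<lambda>x. S m x - F x)) \<longlonglongrightarrow> 0" by blast
  note [measurable] = l2_measurable[OF F]
  define u where "u x = fst (F x)" for x
  define g where "g x = snd (F x)" for x
  have [measurable]: "u \<in> borel_measurable M" "g \<in> borel_measurable M"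
    unfolding u_def[abs_def] g_def[abs_def]
    by (intro borel_measurable_continuous_on[OF _ l2_measurable[OF F]] continuous_intros)+
  have norm_proj: "norm (fst z) \<le> norm z" "norm (snd z) \<le> norm z" for z :: "(real^'n) \<times> ('a^'n)"
    using norm_fst_le[of "fst z" "snd z"] norm_snd_le[of "snd z" "fst z"] by simp_all
  have ul2: "u \<in> l2_set M"
    by (rule l2_bound[OF F]) (auto intro!: AE_I2 norm_proj simp: u_def)
  have gl2: "g \<in> l2_set M"
    by (rule l2_bound[OF F]) (auto intro!: AE_I2 norm_proj simp: g_def)
  have comp: "(\<lambda>x. f x $ i) \<in> l2_set M" if "f \<in> l2_set M" for f :: "'a \<Rightarrow> 'c::euclidean_space^'n" and i
  proof -
    note [measurable] = l2_measurable[OF that]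
    have "(\<lambda>x. f x $ i) \<in> borel_measurable M"
      by (rule borel_measurable_continuous_on[OF _ l2_measurable[OF that]]) (intro continuous_intros)
    then show ?thesis by (intro l2_bound[OF that]) (auto intro!: AE_I2 Finite_Cartesian_Product.norm_nth_le)
  qed
  have wg: "is_weak_gradient \<Omega> (\<lambda>x. u x $ i) (\<lambda>x. g x $ i)" for i
  proof (rule weak_gradient_limit)
    show "is_weak_gradient \<Omega> (\<lambda>x. s m x $ i) (\<lambda>x. vgrad (s m) x $ i)" for m
      using H1_weak_grad(3)[OF H1_vec_component[OF s]] by (simp add: vgrad_def)
    show "(\<lambda>m. l2_norm M (\<lambda>x. s m x $ i - u x $ i)) \<longlonglongrightarrow> 0"
    proof (rule Lim_null_comparison[OF _ lim], rule always_eventually, rule allI)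
      fix m
      have "norm (s m x $ i - u x $ i) \<le> norm (S m x - F x)" for x
        using Finite_Cartesian_Product.norm_nth_le[of "s m x - u x" i] norm_proj(1)[of "S m x - F x"] by (simp add: S_def u_def)
      then show "norm (l2_norm M (\<lambda>x. s m x $ i - u x $ i)) \<le> l2_norm M (\<lambda>x. S m x - F x)"
        by (simp, intro l2_norm_mono l2_diff S F comp ul2 H1_vec_l2 s AE_I2)
    qed
    show "(\<lambda>m. l2_norm M (\<lambda>x. vgrad (s m) x $ i - g x $ i)) \<longlonglongrightarrow> 0"
    proof (rule Lim_null_comparison[OF _ lim], rule always_eventually, rule allI)
      fix m
      have "norm (vgrad (s m) x $ i - g x $ i) \<le> norm (S m x - F x)" for x
        using Finite_Cartesian_Product.norm_nth_le[of "vgrad (s m) x - g x" i] norm_proj(2)[of "S m x - F x"] by (simp add: S_def g_def)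
      then show "norm (l2_norm M (\<lambda>x. vgrad (s m) x $ i - g x $ i)) \<le> l2_norm M (\<lambda>x. S m x - F x)"
        by (simp, intro l2_norm_mono l2_diff S F comp gl2 H1_vec_l2 s AE_I2)
    qed
  qed (intro comp ul2 gl2 H1_vec_l2 s)+
  have u: "u \<in> H1_vec \<Omega>" using H1_I(1)[OF comp[OF ul2] comp[OF gl2] wg] by (simp add: H1_vec_def)
  have gu: "AE x in M. vgrad u x = g x" by (intro vgrad_I H1_I(2) comp ul2 gl2 wg)
  have "H1_norm (s m - u) = l2_norm M (\<lambda>x. S m x - F x)" for m
  proof (rule H1_norm_eq)
    show "AE x in M. S m x - F x = ((s m - u) x, vgrad (s m - u) x)"
      using vgrad_diff[OF s[of m] u] gu by eventually_elim (auto simp: S_def u_def g_def prod_eq_iff)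
  qed (intro subspace_diff[OF subspace_H1_vec] s u l2_diff S F)+
  then have "(\<lambda>m. H1_norm (s m - u)) \<longlonglongrightarrow> 0" using lim by simp
  with u show ?thesis by blast
qed

end

lemma norm_axis: "norm (axis i x :: ('b::real_inner)^'n) = norm x"
  by (simp add: norm_eq_sqrt_inner inner_axis_axis)

locale neumann_problem = bounded_domain \<Omega> for \<Omega> :: "(real^'N) set" +
  fixes G :: "real^'N \<Rightarrow> real^'n \<Rightarrow> real"
    and A B :: "real^'N \<Rightarrow> real^'n^'n"
    and p :: "'n \<Rightarrow> ereal"
  assumes G_C2: "x \<in> closure \<Omega> \<Longrightarrow> C_k 2 (G x)"
    and G_cont: "continuous_on (closure \<Omega>) (\<lambda>x. G x u)"
    and A_cont: "continuous_on (closure \<Omega>) A"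
    and B_cont: "continuous_on (closure \<Omega>) B"
    and B_diag: "x \<in> closure \<Omega> \<Longrightarrow> i \<noteq> j \<Longrightarrow> B x $ i $ j = 0"
    and p_gt_1: "1 < p i"
    and hessian_bounds: "x \<in> closure \<Omega> \<Longrightarrow>
           psd_le (A x) (hessian (G x) u) \<and> psd_le (hessian (G x) u) (B x)"
    and B_small: "Lp_norm \<Omega> (p i) (\<lambda>x. max (B x $ i $ i) 0) < \<beta> \<Omega> (p i)"
    and A_pos: "k \<noteq> 0 \<Longrightarrow> (LINT x|lebesgue_on \<Omega>. (A x *v k) \<bullet> k) > 0"
begin

section \<open>The Taylor remainder of the potential and the composed functions\<close>

lemma in_closure: "x \<in> \<Omega> \<Longrightarrow> x \<in> closure \<Omega>"
  using closure_subset by blast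

text \<open>The second-order remainder in \<open>u\<close>. From here on the Hessian is replaced by
  the two quadratic bounds on \<open>rem\<close>.\<close>

definition rem :: "real^'N \<Rightarrow> real^'n \<Rightarrow> real^'n \<Rightarrow> real" where
  "rem x u h = G x (u + h) - G x u - grad (G x) u \<bullet> h"

lemma rem_psd_bounds:
  assumes "x \<in> closure \<Omega>"
  shows "(A x *v h) \<bullet> h / 2 \<le> rem x u h" and "rem x u h \<le> (B x *v h) \<bullet> h / 2"
  unfolding rem_def by (rule Taylor_psd_bounds; use G_C2 hessian_bounds assms in blast)+

text \<open>\<open>A\<close> and \<open>B\<close> are continuous on a compact set, hence bounded,
  and their quadratic forms enclose the remainder.\<close>

lemma ex_rem_bound: "\<exists>K\<ge>0. \<forall>x\<in>closure \<Omega>. \<forall>u h. \<bar>rem x u h\<bar> \<le> K * (norm h)\<^sup>2"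
proof -
  obtain a where a: "a \<ge> 0" "\<And>x. x \<in> closure \<Omega> \<Longrightarrow> norm (A x) \<le> a"
    using continuous_on_closure_bounded[OF A_cont] by blast
  obtain b where b: "b \<ge> 0" "\<And>x. x \<in> closure \<Omega> \<Longrightarrow> norm (B x) \<le> b"
    using continuous_on_closure_bounded[OF B_cont] by blast
  have form: "\<bar>(C *v h) \<bullet> h\<bar> \<le> real CARD('n) * (a + b) * (norm h)\<^sup>2"
    if "norm C \<le> a + b" for C :: "real^'n^'n" and h
    using order_trans[OF matrix_form_bound mult_right_mono[OF mult_left_mono[OF that, of "real CARD('n)"], of "(norm h)\<^sup>2"]]
    by simp
  have "\<bar>rem x u h\<bar> \<le> real CARD('n) * (a + b) * (norm h)\<^sup>2" if x: "x \<in> closure \<Omega>" for x u h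
    using form[of "A x" h] form[of "B x" h] a(2)[OF x] b(2)[OF x] a(1) b(1) rem_psd_bounds(1)[OF x, of h u] rem_psd_bounds(2)[OF x, of u h]
    by (simp add: abs_le_iff)
  then show ?thesis using a(1) b(1) by (intro exI[of _ "real CARD('n) * (a + b)"]) auto
qed

definition K :: real where
  "K = (SOME K. K \<ge> 0 \<and> (\<forall>x\<in>closure \<Omega>. \<forall>u h. \<bar>rem x u h\<bar> \<le> K * (norm h)\<^sup>2))"

lemma K_nonneg: "K \<ge> 0"
  and rem_bound: "x \<in> closure \<Omega> \<Longrightarrow> \<bar>rem x u h\<bar> \<le> K * (norm h)\<^sup>2"
  using someI_ex[OF ex_rem_bound] unfolding K_def by auto

lemma grad_Lipschitz:
  "x \<in> closure \<Omega> \<Longrightarrow> norm (grad (G x) u - grad (G x) w) \<le> 6 * K * norm (u - w)"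
  using rem_bound by (intro quadratic_remainder_imp_Lipschitz[where g="G x"]) (simp add: rem_def)

lemma G_const_measurable: "(\<lambda>x. G x c) \<in> borel_measurable M"
  using continuous_on_subset[OF G_cont closure_subset] by (rule continuous_measurable_M)

lemma G_continuous: "x \<in> closure \<Omega> \<Longrightarrow> continuous_on UNIV (G x)"
  using G_C2 by (rule C_k_imp_continuous)

lemma G_measurable: "u \<in> borel_measurable M \<Longrightarrow> (\<lambda>x. G x (u x)) \<in> borel_measurable M"
  by (rule Caratheodory_measurable[OF G_const_measurable]) (auto intro: G_continuous in_closure)

lemma grad_component_eq: "grad (G x) c $ i = G x (c + axis i 1) - G x c - rem x c (axis i 1)"
  by (simp add: rem_def inner_axis)

text \<open>Continuity in \<open>x\<close> is assumed of \<open>G\<close>, not of its gradient. For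
  fixed argument the gradient is the limit of difference quotients of \<open>G\<close>, the error
  being at most \<open>K * t m\<close>; the Lipschitz gradient is then composed with
  \<open>u\<close> as a Caratheodory function.\<close>

lemma grad_measurable:
  assumes "u \<in> borel_measurable M" shows "(\<lambda>x. grad (G x) (u x)) \<in> borel_measurable M"
proof (rule Caratheodory_measurable[OF _ _ assms])
  fix c
  show "(\<lambda>x. grad (G x) c) \<in> borel_measurable M"
  proof (rule borel_measurable_vec_components)
    fix i
    define t where "t m = inverse (real (Suc m))" for m
    have t: "t m > 0" for m by (simp add: t_def)
    show "(\<lambda>x. grad (G x) c $ i) \<in> borel_measurable M"
    proof (rule borel_measurable_LIMSEQ_metric)
      show "(\<lambda>x. (G x (c + axis i (t m)) - G x c) / t m) \<in> borel_measurable M" for m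
        using G_const_measurable by measurable
      fix x assume "x \<in> space M"
      then have x: "x \<in> closure \<Omega>" by (simp add: in_closure)
      show "(\<lambda>m. (G x (c + axis i (t m)) - G x c) / t m) \<longlonglongrightarrow> grad (G x) c $ i"
      proof (rule LIM_zero_cancel, rule Lim_null_comparison)
        have eq: "(G x (c + axis i (t m)) - G x c) / t m - grad (G x) c $ i = rem x c (axis i (t m)) / t m" for m
          using t[of m] by (simp add: rem_def inner_axis field_simps)
        have "\<bar>rem x c (axis i (t m)) / t m\<bar> \<le> K * t m" for m
          using rem_bound[OF x, of c "axis i (t m)"] t[of m]
          by (simp add: norm_axis power2_eq_square divide_le_eq mult.assoc)
        then show "\<forall>\<^sub>F m in sequentially. norm ((G x (c + axis i (t m)) - G x c) / t m - grad (G x) c $ i) \<le> K * t m"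
          by (simp add: eq)
        show "(\<lambda>m. K * t m) \<longlonglongrightarrow> 0"
          unfolding t_def using tendsto_mult[OF tendsto_const LIMSEQ_inverse_real_of_nat, of K] by simp
      qed
    qed
  qed
qed (auto intro: grad_continuous G_C2 in_closure)

text \<open>A difference of \<open>G\<close> over the unit step \<open>axis i 1\<close> determines
  the component of the gradient up to \<open>K\<close>, and \<open>G\<close> at the finitely many
  points involved is bounded on the compact closure.\<close>

lemma grad_0_bounded: "\<exists>c. \<forall>x\<in>closure \<Omega>. norm (grad (G x) 0) \<le> c"
proof -
  have "\<exists>b. \<forall>x\<in>closure \<Omega>. \<bar>G x c\<bar> \<le> b" for c
    using continuous_on_closure_bounded[OF G_cont, of c] by (metis real_norm_def)
  then obtain b where b: "\<And>c x. x \<in> closure \<Omega> \<Longrightarrow> \<bar>G x c\<bar> \<le> b c" by metis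
  have "norm (grad (G x) 0) \<le> (\<Sum>i\<in>UNIV. b (axis i 1) + b 0 + K)" if x: "x \<in> closure \<Omega>" for x
  proof -
    have "norm (grad (G x) 0) \<le> (\<Sum>i\<in>UNIV. \<bar>grad (G x) 0 $ i\<bar>)" by (rule norm_le_l1_cart)
    also have "\<dots> \<le> (\<Sum>i\<in>UNIV. b (axis i 1) + b 0 + K)"
    proof (rule sum_mono)
      fix i
      show "\<bar>grad (G x) 0 $ i\<bar> \<le> b (axis i 1) + b 0 + K"
        using b[OF x, of "axis i 1"] b[OF x, of 0] rem_bound[OF x, of 0 "axis i 1"]
        unfolding grad_component_eq by (simp add: norm_axis)
    qed
    finally show ?thesis .
  qed
  then show ?thesis by blast
qed

lemma grad_l2:
  assumes u: "u \<in> l2_set M" shows "(\<lambda>x. grad (G x) (u x)) \<in> l2_set M"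
proof -
  obtain c where c: "\<And>x. x \<in> closure \<Omega> \<Longrightarrow> norm (grad (G x) 0) \<le> c" using grad_0_bounded by blast
  note [measurable] = l2_measurable[OF u]
  have "(\<lambda>x. c + (6 * K) *\<^sub>R norm (u x)) \<in> l2_set M"
    by (intro l2_add l2_scaleR l2_bounded[of "\<lambda>x. c" "\<bar>c\<bar>"] l2_bound[OF u]) auto
  then show ?thesis
  proof (rule l2_bound)
    show "(\<lambda>x. grad (G x) (u x)) \<in> borel_measurable M" by (rule grad_measurable) measurable
    show "AE x in M. norm (grad (G x) (u x)) \<le> norm (c + (6 * K) *\<^sub>R norm (u x))"
    proof (rule AE_I2)
      fix x assume "x \<in> space M"
      then have x: "x \<in> closure \<Omega>" by (simp add: in_closure)
      have "norm (grad (G x) (u x)) \<le> norm (grad (G x) 0) + norm (grad (G x) (u x) - grad (G x) 0)"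
        by (metis add.commute diff_add_cancel norm_triangle_ineq)
      also have "\<dots> \<le> c + 6 * K * norm (u x)" using c[OF x] grad_Lipschitz[OF x, of "u x" 0] by simp
      finally show "norm (grad (G x) (u x)) \<le> norm (c + (6 * K) *\<^sub>R norm (u x))" by simp
    qed
  qed
qed

lemma rem_integrable:
  assumes u: "u \<in> l2_set M" and h: "h \<in> l2_set M"
  shows "integrable M (\<lambda>x. rem x (u x) (h x))"
proof (rule Bochner_Integration.integrable_bound)
  show "integrable M (\<lambda>x. K * (norm (h x))\<^sup>2)" using h by (simp add: l2_integrable)
  note [measurable] = l2_measurable[OF u] l2_measurable[OF h]
  show "(\<lambda>x. rem x (u x) (h x)) \<in> borel_measurable M"
    unfolding rem_def
    by (intro borel_measurable_diff borel_measurable_inner G_measurable grad_measurable) measurable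
  show "AE x in M. norm (rem x (u x) (h x)) \<le> norm (K * (norm (h x))\<^sup>2)"
    by (intro AE_I2) (use rem_bound in_closure K_nonneg in \<open>simp add: abs_mult\<close>)
qed

lemma rem_integral_bound:
  assumes u: "u \<in> l2_set M" and h: "h \<in> l2_set M"
  shows "\<bar>LINT x|M. rem x (u x) (h x)\<bar> \<le> K * (l2_norm M h)\<^sup>2"
proof -
  have "\<bar>LINT x|M. rem x (u x) (h x)\<bar> \<le> (LINT x|M. \<bar>rem x (u x) (h x)\<bar>)" by (rule integral_abs_bound)
  also have "\<dots> \<le> (LINT x|M. K * (norm (h x))\<^sup>2)"
    using rem_integrable[OF u h] h by (intro integral_mono rem_bound in_closure) (auto simp: l2_integrable)
  finally show ?thesis by (simp add: l2_norm_square)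
qed

text \<open>Expansion about zero: \<open>G\<close> differs from a bounded function by a linear term
  with bounded coefficient and a remainder of at most quadratic size.\<close>

lemma G_integrable:
  assumes u: "u \<in> l2_set M" shows "integrable M (\<lambda>x. G x (u x))"
proof -
  have "integrable M (\<lambda>x. G x 0 + grad (G x) 0 \<bullet> u x + rem x 0 (u x))"
    by (intro Bochner_Integration.integrable_add l2_inner_integrable u grad_l2 l2_zero rem_integrable
        l2_imp_integrable(1) continuous_l2 G_cont)
  then show ?thesis by (simp add: rem_def)
qed

section \<open>The action functional and its derivative\<close>

definition J :: "(real^'N \<Rightarrow> real^'n) \<Rightarrow> real" where
  "J u = (LINT x|M. (norm (vgrad u x))\<^sup>2) / 2 - (LINT x|M. G x (u x))"

definition DJ :: "(real^'N \<Rightarrow> real^'n) \<Rightarrow> (real^'N \<Rightarrow> real^'n) \<Rightarrow> real" where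
  "DJ u h = (LINT x|M. vgrad u x \<bullet> vgrad h x) - (LINT x|M. grad (G x) (u x) \<bullet> h x)"

text \<open>An exact identity, from which the Taylor bound, concavity along constants and coercivity
  are all obtained by estimating the integral of \<open>rem\<close>.\<close>

lemma J_expand:
  assumes u: "u \<in> H1_vec \<Omega>" and h: "h \<in> H1_vec \<Omega>"
  shows "J (u + h) = J u + DJ u h + (LINT x|M. (norm (vgrad h x))\<^sup>2) / 2 - (LINT x|M. rem x (u x) (h x))"
proof -
  note u2 = H1_vec_l2[OF u] and h2 = H1_vec_l2[OF h]
  have uh: "u + h \<in> H1_vec \<Omega>" by (rule H1_vec_add[OF u h])
  note [measurable] = l2_measurable[OF u2(2)] l2_measurable[OF h2(2)] l2_measurable[OF H1_vec_l2(2)[OF uh]]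
  have "(LINT x|M. (norm (vgrad (u + h) x))\<^sup>2) =
      (LINT x|M. (norm (vgrad u x))\<^sup>2 + 2 * (vgrad u x \<bullet> vgrad h x) + (norm (vgrad h x))\<^sup>2)"
  proof (rule integral_cong_AE)
    show "AE x in M. (norm (vgrad (u + h) x))\<^sup>2 =
        (norm (vgrad u x))\<^sup>2 + 2 * (vgrad u x \<bullet> vgrad h x) + (norm (vgrad h x))\<^sup>2"
      using H1_vec_add(2)[OF u h]
      by eventually_elim (simp add: power2_norm_eq_inner inner_add inner_commute)
  qed measurable
  also have "\<dots> = (LINT x|M. (norm (vgrad u x))\<^sup>2) + 2 * (LINT x|M. vgrad u x \<bullet> vgrad h x)
      + (LINT x|M. (norm (vgrad h x))\<^sup>2)"
    using u2 h2 by (simp add: l2_integrable l2_inner_integrable)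
  finally have 1: "(LINT x|M. (norm (vgrad (u + h) x))\<^sup>2) = \<dots>" .
  have "(LINT x|M. G x ((u + h) x)) = (LINT x|M. G x (u x) + grad (G x) (u x) \<bullet> h x + rem x (u x) (h x))"
    by (simp add: rem_def)
  also have "\<dots> = (LINT x|M. G x (u x)) + (LINT x|M. grad (G x) (u x) \<bullet> h x) + (LINT x|M. rem x (u x) (h x))"
    using u2 h2 by (simp add: G_integrable grad_l2 l2_inner_integrable rem_integrable)
  finally show ?thesis unfolding J_def DJ_def 1 by (simp add: field_simps)
qed

lemma J_taylor:
  assumes u: "u \<in> H1_vec \<Omega>" and h: "h \<in> H1_vec \<Omega>"
  shows "\<bar>J (u + h) - J u - DJ u h\<bar> \<le> (1 + 6 * K) * (H1_norm h)\<^sup>2"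
proof -
  have "\<bar>J (u + h) - J u - DJ u h\<bar> \<le> (l2_norm M (vgrad h))\<^sup>2 / 2 + K * (l2_norm M h)\<^sup>2"
    using rem_integral_bound[OF H1_vec_l2(1)[OF u] H1_vec_l2(1)[OF h]]
      zero_le_power2[of "l2_norm M (vgrad h)"]
    unfolding J_expand[OF u h] l2_norm_square[symmetric] by linarith
  \<comment> \<open>The constant is larger than the Taylor bound requires; it is the one that the
    Lipschitz estimate of \<open>DJ\<close> produces.\<close>
  also have "\<dots> \<le> (1 + 6 * K) * (l2_norm M (vgrad h))\<^sup>2 + (1 + 6 * K) * (l2_norm M h)\<^sup>2"
    using K_nonneg mult_right_mono[of "1/2" "1 + 6 * K" "(l2_norm M (vgrad h))\<^sup>2"]
    by (intro add_mono mult_right_mono) auto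
  also have "\<dots> = (1 + 6 * K) * (H1_norm h)\<^sup>2" by (simp add: H1_norm_square[OF h] algebra_simps)
  finally show ?thesis .
qed

lemma DJ_add:
  assumes u: "u \<in> H1_vec \<Omega>" and h: "h \<in> H1_vec \<Omega>" and h': "h' \<in> H1_vec \<Omega>"
  shows "DJ u (h + h') = DJ u h + DJ u h'"
proof -
  note u2 = H1_vec_l2[OF u] and h2 = H1_vec_l2[OF h] and h'2 = H1_vec_l2[OF h']
  have s: "h + h' \<in> H1_vec \<Omega>" by (rule H1_vec_add[OF h h'])
  note [measurable] = l2_measurable[OF u2(2)] l2_measurable[OF h2(2)] l2_measurable[OF h'2(2)]
    l2_measurable[OF H1_vec_l2(2)[OF s]]
  have "(LINT x|M. vgrad u x \<bullet> vgrad (h + h') x) = (LINT x|M. vgrad u x \<bullet> vgrad h x + vgrad u x \<bullet> vgrad h' x)"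
  proof (rule integral_cong_AE)
    show "AE x in M. vgrad u x \<bullet> vgrad (h + h') x = vgrad u x \<bullet> vgrad h x + vgrad u x \<bullet> vgrad h' x"
      using H1_vec_add(2)[OF h h'] by eventually_elim (simp add: inner_add_right)
  qed measurable
  then show ?thesis
    using u2 h2 h'2 by (simp add: DJ_def inner_add_right l2_inner_integrable grad_l2)
qed

lemma DJ_scaleR:
  assumes u: "u \<in> H1_vec \<Omega>" and h: "h \<in> H1_vec \<Omega>"
  shows "DJ u (t *\<^sub>R h) = t * DJ u h"
proof -
  note u2 = H1_vec_l2[OF u] and h2 = H1_vec_l2[OF h]
  have s: "t *\<^sub>R h \<in> H1_vec \<Omega>" by (rule H1_vec_scaleR[OF h])
  note [measurable] = l2_measurable[OF u2(2)] l2_measurable[OF h2(2)] l2_measurable[OF H1_vec_l2(2)[OF s]]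
  have "(LINT x|M. vgrad u x \<bullet> vgrad (t *\<^sub>R h) x) = (LINT x|M. t * (vgrad u x \<bullet> vgrad h x))"
  proof (rule integral_cong_AE)
    show "AE x in M. vgrad u x \<bullet> vgrad (t *\<^sub>R h) x = t * (vgrad u x \<bullet> vgrad h x)"
      using H1_vec_scaleR(2)[OF h, of t] by eventually_elim simp
  qed measurable
  then show ?thesis by (simp add: DJ_def right_diff_distrib)
qed

lemma DJ_bound:
  assumes u: "u \<in> H1_vec \<Omega>"
  shows "\<exists>b. \<forall>h\<in>H1_vec \<Omega>. \<bar>DJ u h\<bar> \<le> b * H1_norm h"
proof (intro exI ballI)
  fix h :: "real^'N \<Rightarrow> real^'n" assume h: "h \<in> H1_vec \<Omega>"
  note u2 = H1_vec_l2[OF u] and h2 = H1_vec_l2[OF h]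
  have "\<bar>DJ u h\<bar> \<le> l2_norm M (vgrad u) * l2_norm M (vgrad h) + l2_norm M (\<lambda>x. grad (G x) (u x)) * l2_norm M h"
    using l2_inner_bound[OF u2(2) h2(2)] l2_inner_bound[OF grad_l2[OF u2(1)] h2(1)]
    unfolding DJ_def by linarith
  also have "\<dots> \<le> l2_norm M (vgrad u) * H1_norm h + l2_norm M (\<lambda>x. grad (G x) (u x)) * H1_norm h"
    by (intro add_mono mult_left_mono H1_norm_ge h) auto
  finally show "\<bar>DJ u h\<bar> \<le> (l2_norm M (vgrad u) + l2_norm M (\<lambda>x. grad (G x) (u x))) * H1_norm h"
    by (simp add: distrib_right)
qed

lemma DJ_Lipschitz:
  assumes u: "u \<in> H1_vec \<Omega>" and w: "w \<in> H1_vec \<Omega>" and h: "h \<in> H1_vec \<Omega>"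
  shows "\<bar>DJ u h - DJ w h\<bar> \<le> (1 + 6 * K) * H1_norm (u - w) * H1_norm h"
proof -
  note u2 = H1_vec_l2[OF u] and w2 = H1_vec_l2[OF w] and h2 = H1_vec_l2[OF h]
  have uw: "u - w \<in> H1_vec \<Omega>" by (rule subspace_diff[OF subspace_H1_vec u w])
  note uw2 = H1_vec_l2[OF uw]
  define d where "d x = grad (G x) (u x) - grad (G x) (w x)" for x
  have d: "d \<in> l2_set M" unfolding d_def[abs_def] by (intro l2_diff grad_l2 u2 w2)
  have "l2_norm M d \<le> l2_norm M (\<lambda>x. (6 * K) *\<^sub>R (u - w) x)"
    using K_nonneg grad_Lipschitz[OF in_closure]
    by (intro l2_norm_mono l2_scaleR uw2 d AE_I2) (simp add: d_def)
  also have "\<dots> = 6 * K * l2_norm M (u - w)" using K_nonneg l2_norm_scaleR[of M "6 * K" "u - w"] by simp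
  finally have nd: "l2_norm M d \<le> 6 * K * l2_norm M (u - w)" .
  have vd: "l2_norm M (\<lambda>x. vgrad u x - vgrad w x) = l2_norm M (vgrad (u - w))"
    by (rule l2_cong(2)[OF uw2(2) l2_measurable[OF l2_diff[OF u2(2) w2(2)]] vgrad_diff[OF u w]])
  have "DJ u h - DJ w h = (LINT x|M. (vgrad u x - vgrad w x) \<bullet> vgrad h x) - (LINT x|M. d x \<bullet> h x)"
    using u2 w2 h2 by (simp add: DJ_def d_def inner_diff_left l2_inner_integrable grad_l2)
  also have "\<bar>\<dots>\<bar> \<le> l2_norm M (vgrad (u - w)) * l2_norm M (vgrad h) + l2_norm M d * l2_norm M h"
    using l2_inner_bound[OF l2_diff[OF u2(2) w2(2)] h2(2)] l2_inner_bound[OF d h2(1)]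
    unfolding vd by linarith
  also have "\<dots> \<le> H1_norm (u - w) * H1_norm h + (6 * K * H1_norm (u - w)) * H1_norm h"
  proof (intro add_mono mult_mono H1_norm_ge uw h)
    show "l2_norm M d \<le> 6 * K * H1_norm (u - w)"
      using nd K_nonneg mult_left_mono[OF H1_norm_ge(1)[OF uw], of "6 * K"] by simp
  qed (use K_nonneg in \<open>simp_all add: H1_norm_nonneg\<close>)
  finally show ?thesis by (simp add: algebra_simps)
qed

section \<open>Concavity from the lower and coercivity from the upper matrix bound\<close>

lemma A_uniformly_positive: "\<exists>a>0. \<forall>k. a * (norm k)\<^sup>2 \<le> (LINT x|M. (A x *v k) \<bullet> k)"
proof -
  define Q where "Q k = (LINT x|M. (A x *v k) \<bullet> k)" for k
  have int: "integrable M (\<lambda>x. A x $ i $ j)" for i j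
    by (intro l2_imp_integrable(1) continuous_l2 continuous_intros A_cont)
  \<comment> \<open>As a quadratic polynomial in the coordinates of \<open>k\<close>,
    \<open>Q\<close> is continuous and homogeneous; its minimum over the unit sphere is the uniform
    constant.\<close>
  have Q: "Q k = (\<Sum>i\<in>UNIV. \<Sum>j\<in>UNIV. (LINT x|M. A x $ i $ j) * k $ j * k $ i)" for k
    unfolding Q_def using int
    by (simp add: inner_vec_def matrix_vector_mult_def sum_distrib_right)
  have "continuous_on UNIV Q"
    unfolding Q by (intro continuous_intros)
  then have "continuous_on (sphere 0 1) Q" by (rule continuous_on_subset) simp
  moreover have "axis (undefined :: 'n) (1::real) \<in> sphere 0 1" by (simp add: norm_axis)
  then have "sphere (0 :: real^'n) 1 \<noteq> {}" by blast
  ultimately obtain k0 where k0: "k0 \<in> sphere 0 1" "\<And>k. k \<in> sphere 0 1 \<Longrightarrow> Q k0 \<le> Q k"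
    using continuous_attains_inf[OF compact_sphere] by blast
  have "k0 \<noteq> 0" using k0(1) by auto
  then have "Q k0 > 0" using A_pos by (simp add: Q_def)
  moreover have "Q k0 * (norm k)\<^sup>2 \<le> Q k" for k
  proof (cases "k = 0")
    case False
    define e where "e = (1 / norm k) *\<^sub>R k"
    have "e \<in> sphere 0 1" using False by (simp add: e_def)
    then have "Q k0 * (norm k)\<^sup>2 \<le> Q e * (norm k)\<^sup>2" using k0(2) by (intro mult_right_mono) auto
    also have "\<dots> = Q k"
      using False unfolding Q by (simp add: e_def sum_distrib_right power2_eq_square)
    finally show ?thesis .
  qed (simp add: Q)
  ultimately show ?thesis unfolding Q_def by blast
qed

text \<open>A constant increment has no gradient, so the expansion of \<open>J\<close> retains only
  minus the integral of \<open>rem\<close>, bounded by half the form of \<open>A\<close>.\<close>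

lemma J_concave:
  assumes a: "\<And>k. a * (norm k)\<^sup>2 \<le> (LINT x|M. (A x *v k) \<bullet> k)" and u: "u \<in> H1_vec \<Omega>"
  shows "J (u + (\<lambda>x. k)) \<le> J u + DJ u (\<lambda>x. k) - a / 2 * (norm k)\<^sup>2"
proof -
  have k2: "(\<lambda>x. k) \<in> l2_set M" by (rule H1_vec_l2(1)[OF H1_vec_const(1)])
  have 0: "(LINT x|M. (norm (vgrad (\<lambda>x. k) x))\<^sup>2) = 0"
    by (rule integral_eq_zero_AE, use H1_vec_const(2)[of k] in eventually_elim) simp
  have "a / 2 * (norm k)\<^sup>2 \<le> (LINT x|M. (A x *v k) \<bullet> k / 2)" using a[of k] by simp
  also have "\<dots> \<le> (LINT x|M. rem x (u x) k)"
  proof (rule integral_mono)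
    have "continuous_on (closure \<Omega>) (\<lambda>x. (A x *v k) \<bullet> k)"
      by (intro continuous_intros continuous_on_compose2[OF _ A_cont, of UNIV "\<lambda>C. C *v k"]
          linear_continuous_on linear_conv_bounded_linear[THEN iffD1] linearI)
        (auto simp: matrix_vector_mult_add_rdistrib scaleR_matrix_vector_assoc)
    from l2_imp_integrable(1)[OF continuous_l2[OF this]]
    show "integrable M (\<lambda>x. (A x *v k) \<bullet> k / 2)" by simp
  qed (use rem_psd_bounds(1) in_closure rem_integrable[OF H1_vec_l2(1)[OF u] k2] in auto)
  finally show ?thesis unfolding J_expand[OF u H1_vec_const(1)] 0 by simp
qed

lemma scalar_coercive:
  "\<exists>\<kappa>>0. \<forall>v\<in>H1 \<Omega>. \<exists>k.
    \<kappa> * ((LINT x|M. (norm (weak_grad \<Omega> (\<lambda>x. v x + k) x))\<^sup>2) + (LINT x|M. (v x + k)\<^sup>2))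
      \<le> (LINT x|M. (norm (weak_grad \<Omega> (\<lambda>x. v x + k) x))\<^sup>2) - (LINT x|M. B x $ i $ i * (v x + k)\<^sup>2)"
proof -
  have b: "continuous_on (closure \<Omega>) (\<lambda>x. B x $ i $ i)" by (intro continuous_intros B_cont)
  show ?thesis
  proof (cases "p i")
    case (real q)
    then show ?thesis using p_gt_1[of i] B_small[of i] by (intro scalar_coercive_finite[OF b, of q]) auto
  next
    case PInf
    then show ?thesis using B_small[of i] by (intro scalar_coercive_infinite[OF b]) auto
  next
    case MInf
    then show ?thesis using p_gt_1[of i] by simp
  qed
qed

lemma B_form:
  assumes "x \<in> closure \<Omega>"
  shows "(B x *v h) \<bullet> h = (\<Sum>i\<in>UNIV. B x $ i $ i * (h $ i)\<^sup>2)"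
proof -
  have "(B x *v h) $ i = B x $ i $ i * h $ i" for i
  proof -
    have "(B x *v h) $ i = (\<Sum>j\<in>UNIV. B x $ i $ j * h $ j)" by (simp add: matrix_vector_mult_def)
    also have "\<dots> = (\<Sum>j\<in>UNIV. if j = i then B x $ i $ i * h $ i else 0)"
      using B_diag[OF assms, of i] by (intro sum.cong) auto
    finally show ?thesis by simp
  qed
  then show ?thesis by (simp add: inner_vec_def power2_eq_square mult.assoc)
qed

text \<open>Since \<open>B\<close> is diagonal, its form decouples into the components of the
  increment. The scalar estimate supplies a shift for each component separately, with its own
  exponent, and these shifts are the entries of \<open>k\<close>.\<close>

lemma J_coercive:
  "\<exists>\<kappa>>0. \<forall>z\<in>H1_vec \<Omega>. \<exists>k. \<forall>u\<in>H1_vec \<Omega>.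
     J u + DJ u (z + (\<lambda>x. k)) + \<kappa> * (H1_norm (z + (\<lambda>x. k)))\<^sup>2 \<le> J (u + (z + (\<lambda>x. k)))"
proof -
  define W where "W v = (LINT x|M. (norm (weak_grad \<Omega> v x))\<^sup>2)" for v
  define I where "I v = (LINT x|M. (v x)\<^sup>2)" for v :: "real^'N \<Rightarrow> real"
  have "\<forall>i. \<exists>\<kappa>>0. \<forall>v\<in>H1 \<Omega>. \<exists>k. \<kappa> * (W (\<lambda>x. v x + k) + I (\<lambda>x. v x + k))
      \<le> W (\<lambda>x. v x + k) - (LINT x|M. B x $ i $ i * (v x + k)\<^sup>2)"
    unfolding W_def I_def using scalar_coercive by blast
  from choice[OF this] obtain \<kappa>f where *: "\<forall>i. \<kappa>f i > 0 \<and> (\<forall>v\<in>H1 \<Omega>. \<exists>k. \<kappa>f i * (W (\<lambda>x. v x + k) + I (\<lambda>x. v x + k))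
      \<le> W (\<lambda>x. v x + k) - (LINT x|M. B x $ i $ i * (v x + k)\<^sup>2))"
    by (elim exE)
  note \<kappa>f = conjunct1[OF spec[OF *]] bspec[OF conjunct2[OF spec[OF *]]]
  \<comment> \<open>The minimum is halved because both the Dirichlet integral and the bound on
    \<open>rem\<close> enter \<open>J\<close> with the factor 1/2.\<close>
  define \<kappa> where "\<kappa> = Min (range \<kappa>f) / 2"
  have \<kappa>_pos: "\<kappa> > 0" using \<kappa>f(1) by (auto simp: \<kappa>_def)
  have \<kappa>_le: "2 * \<kappa> \<le> \<kappa>f i" for i by (simp add: \<kappa>_def)
  have "\<exists>k. \<forall>u\<in>H1_vec \<Omega>.
     J u + DJ u (z + (\<lambda>x. k)) + \<kappa> * (H1_norm (z + (\<lambda>x. k)))\<^sup>2 \<le> J (u + (z + (\<lambda>x. k)))"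
    if z: "z \<in> H1_vec \<Omega>" for z
  proof -
    have "\<forall>i. \<exists>k. \<kappa>f i * (W (\<lambda>x. z x $ i + k) + I (\<lambda>x. z x $ i + k))
      \<le> W (\<lambda>x. z x $ i + k) - (LINT x|M. B x $ i $ i * (z x $ i + k)\<^sup>2)"
      by (intro allI \<kappa>f(2)[OF H1_vec_component[OF z]])
    from choice[OF this] obtain kf where *: "\<forall>i. \<kappa>f i * (W (\<lambda>x. z x $ i + kf i) + I (\<lambda>x. z x $ i + kf i))
      \<le> W (\<lambda>x. z x $ i + kf i) - (LINT x|M. B x $ i $ i * (z x $ i + kf i)\<^sup>2)"
      by (elim exE)
    note kf = spec[OF *]
    define k where "k = (\<chi> i. kf i)"
    define h where "h = z + (\<lambda>x. k)"
    have h: "h \<in> H1_vec \<Omega>" unfolding h_def by (intro H1_vec_add z H1_vec_const)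
    note h2 = H1_vec_l2[OF h]
    have hi: "(\<lambda>x. h x $ i) = (\<lambda>x. z x $ i + kf i)" for i by (simp add: h_def k_def)
    have hil2: "(\<lambda>x. h x $ i) \<in> l2_set M" "weak_grad \<Omega> (\<lambda>x. h x $ i) \<in> l2_set M" for i
      using H1_weak_grad[OF H1_vec_component[OF h]] by auto
    have int_b: "integrable M (\<lambda>x. B x $ i $ i * (h x $ i)\<^sup>2)" for i
    proof -
      have b: "continuous_on (closure \<Omega>) (\<lambda>x. B x $ i $ i)" by (intro continuous_intros B_cont)
      obtain Bb where Bb: "\<And>x. x \<in> closure \<Omega> \<Longrightarrow> norm (B x $ i $ i) \<le> Bb"
        using continuous_on_closure_bounded[OF b] by blast
      note [measurable] = l2_measurable[OF hil2(1)[of i]] l2_measurable[OF continuous_l2[OF b]]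
      show ?thesis
      proof (rule Bochner_Integration.integrable_bound)
        show "integrable M (\<lambda>x. Bb * (h x $ i)\<^sup>2)" using l2_integrable[OF hil2(1)[of i]] by simp
        show "AE x in M. norm (B x $ i $ i * (h x $ i)\<^sup>2) \<le> norm (Bb * (h x $ i)\<^sup>2)"
          using order_trans[OF Bb[OF in_closure] abs_ge_self]
          by (intro AE_I2) (auto simp: abs_mult intro!: mult_right_mono)
      qed measurable
    qed
    have Wsum: "(LINT x|M. (norm (vgrad h x))\<^sup>2) = (\<Sum>i\<in>UNIV. W (\<lambda>x. h x $ i))"
      using l2_integrable[OF hil2(2)] by (simp add: norm_vec_square vgrad_def W_def)
    have Isum: "(LINT x|M. (norm (h x))\<^sup>2) = (\<Sum>i\<in>UNIV. I (\<lambda>x. h x $ i))"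
      using l2_integrable[OF hil2(1)] by (simp add: norm_vec_square I_def)
    have "2 * \<kappa> * (H1_norm h)\<^sup>2 = (\<Sum>i\<in>UNIV. 2 * \<kappa> * (W (\<lambda>x. h x $ i) + I (\<lambda>x. h x $ i)))"
      unfolding H1_norm_square[OF h] l2_norm_square Wsum Isum
      by (simp add: sum.distrib sum_distrib_left algebra_simps)
    also have "\<dots> \<le> (\<Sum>i\<in>UNIV. W (\<lambda>x. h x $ i) - (LINT x|M. B x $ i $ i * (h x $ i)\<^sup>2))"
    proof (rule sum_mono)
      fix i
      have "2 * \<kappa> * (W (\<lambda>x. h x $ i) + I (\<lambda>x. h x $ i)) \<le> \<kappa>f i * (W (\<lambda>x. h x $ i) + I (\<lambda>x. h x $ i))"
        by (intro mult_right_mono \<kappa>_le) (auto simp: W_def I_def intro!: add_nonneg_nonneg integral_nonneg_AE)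
      then show "2 * \<kappa> * (W (\<lambda>x. h x $ i) + I (\<lambda>x. h x $ i)) \<le> W (\<lambda>x. h x $ i) - (LINT x|M. B x $ i $ i * (h x $ i)\<^sup>2)"
        using kf[of i] unfolding hi[of i] by (simp add: h_def k_def)
    qed
    also have "\<dots> = (LINT x|M. (norm (vgrad h x))\<^sup>2) - (LINT x|M. (\<Sum>i\<in>UNIV. B x $ i $ i * (h x $ i)\<^sup>2))"
      using int_b by (simp add: Wsum sum_subtractf)
    finally have main: "2 * \<kappa> * (H1_norm h)\<^sup>2 \<le>
        (LINT x|M. (norm (vgrad h x))\<^sup>2) - (LINT x|M. (\<Sum>i\<in>UNIV. B x $ i $ i * (h x $ i)\<^sup>2))" .
    have "J u + DJ u h + \<kappa> * (H1_norm h)\<^sup>2 \<le> J (u + h)" if u: "u \<in> H1_vec \<Omega>" for u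
    proof -
      have "(LINT x|M. rem x (u x) (h x)) \<le> (LINT x|M. (\<Sum>i\<in>UNIV. B x $ i $ i * (h x $ i)\<^sup>2) / 2)"
      proof (rule integral_mono)
        show "rem x (u x) (h x) \<le> (\<Sum>i\<in>UNIV. B x $ i $ i * (h x $ i)\<^sup>2) / 2" if "x \<in> space M" for x
          using rem_psd_bounds(2)[of x "u x" "h x"] B_form[of x "h x"] that by (simp add: in_closure)
      qed (use rem_integrable[OF H1_vec_l2(1)[OF u] h2(1)] int_b in auto)
      then show ?thesis using main unfolding J_expand[OF u h] by simp
    qed
    then show ?thesis unfolding h_def by blast
  qed
  with \<kappa>_pos show ?thesis by blast
qed

section \<open>Weak solutions as critical points of the action\<close>

lemma neumann_weak_solution_iff:
  "neumann_weak_solution \<Omega> G u \<longleftrightarrow> u \<in> H1_vec \<Omega> \<and> (\<forall>h\<in>H1_vec \<Omega>. DJ u h = 0)"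
proof (cases "u \<in> H1_vec \<Omega>")
  case u: True
  have "integrable M (\<lambda>x. grad (G x) (u x) \<bullet> h x)"
    and "(\<Sum>i\<in>UNIV. LINT x|M. weak_grad \<Omega> (\<lambda>y. u y $ i) x \<bullet> weak_grad \<Omega> (\<lambda>y. h y $ i) x)
        = (LINT x|M. vgrad u x \<bullet> vgrad h x)" if h: "h \<in> H1_vec \<Omega>" for h
  proof -
    show "integrable M (\<lambda>x. grad (G x) (u x) \<bullet> h x)"
      by (intro l2_inner_integrable grad_l2 H1_vec_l2 u h)
    have "integrable M (\<lambda>x. weak_grad \<Omega> (\<lambda>y. u y $ i) x \<bullet> weak_grad \<Omega> (\<lambda>y. h y $ i) x)" for i
      by (intro l2_inner_integrable H1_weak_grad H1_vec_component u h)
    then show "(\<Sum>i\<in>UNIV. LINT x|M. weak_grad \<Omega> (\<lambda>y. u y $ i) x \<bullet> weak_grad \<Omega> (\<lambda>y. h y $ i) x)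
        = (LINT x|M. vgrad u x \<bullet> vgrad h x)"
      by (simp add: vgrad_def inner_vec_def)
  qed
  then show ?thesis using u by (auto simp: neumann_weak_solution_def DJ_def)
qed (simp add: neumann_weak_solution_def)

theorem ex_unique_solution:
  "\<exists>u. neumann_weak_solution \<Omega> G u \<and> (\<forall>w. neumann_weak_solution \<Omega> G w \<longrightarrow> (AE x in M. w x = u x))"
proof -
  obtain a where a: "a > 0" "\<And>k. a * (norm k)\<^sup>2 \<le> (LINT x|M. (A x *v k) \<bullet> k)"
    using A_uniformly_positive by blast
  obtain \<kappa> where \<kappa>: "\<kappa> > 0" "\<And>z. z \<in> H1_vec \<Omega> \<Longrightarrow> \<exists>k. \<forall>u\<in>H1_vec \<Omega>.
     J u + DJ u (z + (\<lambda>x. k)) + \<kappa> * (H1_norm (z + (\<lambda>x. k)))\<^sup>2 \<le> J (u + (z + (\<lambda>x. k)))"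
    using J_coercive by blast
  \<comment> \<open>\<open>a / 2\<close> inherits the factor 1/2 of the second-order remainder, and
    \<open>sqrt (measure M \<Omega>)\<close> is the norm of a constant unit vector field.\<close>
  interpret saddle_functional "H1_vec \<Omega>" H1_norm "\<lambda>k x. k" J DJ "1 + 6 * K" "a / 2" \<kappa> "sqrt (measure M \<Omega>)"
  proof (rule saddle_functional.intro)
    show "subspace (H1_vec \<Omega> :: (real^'N \<Rightarrow> real^'n) set)" by (rule subspace_H1_vec)
    show "linear (\<lambda>(k :: real^'n) (x :: real^'N). k)"
      by (rule linearI) (simp_all add: fun_eq_iff)
    show "\<exists>u\<in>H1_vec \<Omega>. (\<lambda>m. H1_norm (s m - u)) \<longlonglongrightarrow> 0"
      if "\<And>m. s m \<in> H1_vec \<Omega>" "\<And>m. H1_norm (s (Suc m) - s m) \<le> r * (1/2)^m" for s :: "nat \<Rightarrow> real^'N \<Rightarrow> real^'n" and r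
      using that by (rule H1_vec_complete)
    show "J (u + (\<lambda>x. k)) \<le> J u + DJ u (\<lambda>x. k) - a / 2 * (norm k)\<^sup>2" if "u \<in> H1_vec \<Omega>" for u k
      using a(2) that by (rule J_concave)
  qed (use a \<kappa> K_nonneg in \<open>auto simp: H1_norm_const intro: H1_norm_nonneg H1_norm_triangle H1_norm_scaleR
      H1_vec_const DJ_add DJ_scaleR DJ_bound DJ_Lipschitz J_taylor\<close>)
  obtain u where u: "u \<in> H1_vec \<Omega>" "\<And>h. h \<in> H1_vec \<Omega> \<Longrightarrow> DJ u h = 0"
    using ex_critical_point by blast
  have "AE x in M. w x = u x" if w: "neumann_weak_solution \<Omega> G w" for w
  proof -
    have w': "w \<in> H1_vec \<Omega>" "\<And>h. h \<in> H1_vec \<Omega> \<Longrightarrow> DJ w h = 0"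
      using w by (auto simp: neumann_weak_solution_iff)
    have wu: "w - u \<in> H1_vec \<Omega>" by (rule V_diff[OF w'(1) u(1)])
    have "H1_norm (w - u) = 0" by (rule critical_point_unique[OF u(1) w'(1) u(2) w'(2)])
    then have "l2_norm M (w - u) = 0" using H1_norm_ge(1)[OF wu] l2_norm_nonneg[of M "w - u"] by linarith
    from l2_norm_zero_AE[OF H1_vec_l2(1)[OF wu] this] show ?thesis by eventually_elim simp
  qed
  then show ?thesis using u by (auto simp: neumann_weak_solution_iff)
qed

end

theorem theorem3p4:
  fixes \<Omega> :: "(real^'N) set"
    and G :: "real^'N \<Rightarrow> real^'n \<Rightarrow> real"
    and A B :: "real^'N \<Rightarrow> real^'n^'n"
    and p :: "'n \<Rightarrow> ereal"
  assumes "CARD('N) \<ge> 2"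
    and "bounded_regular_domain \<Omega>"
    and "\<And>x. x \<in> closure \<Omega> \<Longrightarrow> C_k 2 (G x)"
    and "\<And>u. continuous_on (closure \<Omega>) (\<lambda>x. G x u)"
    and "continuous_on (closure \<Omega>) A"
    and "continuous_on (closure \<Omega>) B"
    and "\<And>x i j. x \<in> closure \<Omega> \<Longrightarrow> i \<noteq> j \<Longrightarrow> B x $ i $ j = 0"
    and "\<And>i. ereal (real CARD('N) / 2) < p i"
    and "\<And>x u. x \<in> closure \<Omega> \<Longrightarrow>
           psd_le (A x) (hessian (G x) u) \<and> psd_le (hessian (G x) u) (B x)"
    and "\<And>i. Lp_norm \<Omega> (p i) (\<lambda>x. max (B x $ i $ i) 0) < \<beta> \<Omega> (p i)"
    and "\<And>k. k \<noteq> 0 \<Longrightarrow> (LINT x|lebesgue_on \<Omega>. (A x *v k) \<bullet> k) > 0"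
  shows "\<exists>u. neumann_weak_solution \<Omega> G u \<and>
           (\<forall>w. neumann_weak_solution \<Omega> G w \<longrightarrow> (AE x in lebesgue_on \<Omega>. w x = u x))"
proof -
  \<comment> \<open>Dimension at least 2 gives N/2 \<ge> 1, so every exponent exceeds 1 and its
    Hoelder conjugate is finite.\<close>
  have "1 < p i" for i
  proof -
    have "ereal 1 \<le> ereal (real CARD('N) / 2)" using assms(1) by simp
    then show ?thesis using assms(8)[of i] unfolding one_ereal_def by (rule le_less_trans)
  qed
  with assms interpret neumann_problem \<Omega> G A B p
    by unfold_locales (auto simp: bounded_regular_domain_def)
  show ?thesis by (rule ex_unique_solution)
qed

end
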